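(* For every $\beta\in(0,1]$ there exist constants $C,c_l,c_e>0$ (depending only on $\beta$) such that the following holds for all $n_1,n_2$ with $\min\{n_1,n_2\}\ge\beta n$, where $n=\max\{n_1,n_2\}$. Let $X^*\in\mathcal M(n_1,n_2,r,\mu,\kappa)$. Let $\epsilon\in(0,1)$, and assume $\Omega\subseteq[n_1]\times[n_2]$ is sampled uniformly at random among subsets of a given cardinality $|\Omega|$, and that $p=|\Omega|/(n_1n_2)$ satisfies $$np\ge\frac{C}{\epsilon^2}\,\mu r\max\left\{\log n,\ \frac{\mu r\kappa^2}{\epsilon^2}\right\}.$$ Then with probability at least $1-3/n^3$, for all matrices $X=UV^\top$ with $\begin{pmatrix} U \\ V \end{pmatrix}\in\mathcal B_{\rm err}(\epsilon/c_e)\cap\mathcal B_{\rm bln}(1/c_l)\cap\mathcal B_\mu$, $$(1-\epsilon)\|X-X^*\|_F\le\frac1{\sqrt p}\|\mathcal P_\Omega(X-X^* )\|\le(1+\epsilon)\|X-X^*\|_F.$$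
   Context: Norms: $\|\cdot\|_F$ Frobenius, $\|\cdot\|$ Euclidean, $\|A\|_{2,\infty}$ the largest Euclidean norm of a row of $A$. $\mathcal P_\Omega(X)\in\mathbb R^{|\Omega|}$ is the vector of entries $X_{ij}$, $(i,j)\in\Omega$. $\sigma_i^*=\sigma_i(X^* )$ is the $i$-th largest singular value of $X^*$. A rank-$r$ matrix $X\in\mathbb R^{n_1\times n_2}$ with SVD $X=U\Sigma V^\top$ ($U\in\mathbb R^{n_1\times r}$, $V\in\mathbb R^{n_2\times r}$) is $\mu$-incoherent if $\|U\|_{2,\infty}\le\sqrt{\mu r/n_1}$ and $\|V\|_{2,\infty}\le\sqrt{\mu r/n_2}$. $\mathcal M(n_1,n_2,r,\mu,\kappa)$ is the set of $\mu$-incoherent $n_1\times n_2$ matrices of rank $r$ with condition number $\sigma_1/\sigma_r=\kappa$. The following are sets of stacked factor matrices $\begin{pmatrix} U \\ V \end{pmatrix}\in\mathbb R^{(n_1+n_2)\times r}$ with $U\in\mathbb R^{n_1\times r}$, $V\in\mathbb R^{n_2\times r}$: $\mathcal B_{\rm err}(\epsilon)$: $\|UV^\top-X^*\|_F\le\epsilon\sigma_r^*$; $\mathcal B_{\rm bln}(\delta)$: $\|U^\top U-V^\top V\|_F\le\delta\sigma_r^*$; $\mathcal B_\mu$: $\|U\|_{2,\infty}\le\sqrt{3\mu r\sigma_1^*/n_1}$ and $\|V\|_{2,\infty}\le\sqrt{3\mu r\sigma_1^*/n_2}$. *)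

theory Defs
  imports
    "HOL-Probability.Probability_Mass_Function"
    "HOL-Analysis.L2_Norm"
    "Jordan_Normal_Form.DL_Rank"
    "Jordan_Normal_Form.Char_Poly"
begin

text \<open>
  Matrices are those of Jordan_Normal_Form, because the dimensions and the rank are quantified
  inside the statement. Rows and columns are indexed from 0; singular values are indexed from 1.
\<close>

definition frobenius_norm :: "real mat \<Rightarrow> real" where
  "frobenius_norm A = L2_set (\<lambda>ij. A $$ ij) ({..<dim_row A} \<times> {..<dim_col A})"

text \<open>Only meaningful for matrices with at least one row.\<close>

definition two_inf_norm :: "real mat \<Rightarrow> real" where
  "two_inf_norm A = Max ((\<lambda>i. L2_set (\<lambda>j. A $$ (i, j)) {..<dim_col A}) ` {..<dim_row A})"

text \<open>
  The vector of observed entries is a function on the index set; its Euclidean norm is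
  \<open>L2_set (P_obs \<Omega> X) \<Omega>\<close>.
\<close>

definition P_obs :: "(nat \<times> nat) set \<Rightarrow> real mat \<Rightarrow> nat \<times> nat \<Rightarrow> real" where
  "P_obs \<Omega> X = restrict (\<lambda>ij. X $$ ij) \<Omega>"

text \<open>
  The square roots of the eigenvalues of \<open>A\<^sup>T A\<close>, with multiplicity, in nonincreasing order. The list
  has \<open>dim_col A\<close> entries: the usual list of singular values, padded with zeros if \<open>A\<close> has more
  columns than rows.
\<close>

definition singular_values :: "real mat \<Rightarrow> real list" where
  "singular_values A =
     rev (sorted_list_of_multiset (image_mset sqrt (proots (char_poly (transpose_mat A * A)))))"

definition singular_value :: "nat \<Rightarrow> real mat \<Rightarrow> real" where
  "singular_value i A = singular_values A ! (i - 1)"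

text \<open>The reduced singular value decomposition \<open>X = U \<Sigma> V\<^sup>T\<close> of a matrix of rank \<open>r\<close>.\<close>

definition reduced_svd :: "nat \<Rightarrow> real mat \<Rightarrow> real mat \<Rightarrow> real mat \<Rightarrow> real mat \<Rightarrow> bool" where
  "reduced_svd r X U S V \<longleftrightarrow>
     U \<in> carrier_mat (dim_row X) r \<and> S \<in> carrier_mat r r \<and> V \<in> carrier_mat (dim_col X) r \<and>
     transpose_mat U * U = 1\<^sub>m r \<and> transpose_mat V * V = 1\<^sub>m r \<and>
     diagonal_mat S \<and> (\<forall>i<r. S $$ (i, i) = singular_value (i + 1) X) \<and>
     X = U * S * transpose_mat V"

text \<open>
  The row norms of \<open>U\<close> and \<open>V\<close> are those of the orthogonal projections onto the column and the
  row space of \<open>X\<close>, so it does not matter which decomposition is chosen.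
\<close>

definition incoherent :: "real \<Rightarrow> nat \<Rightarrow> real mat \<Rightarrow> bool" where
  "incoherent \<mu> r X \<longleftrightarrow>
     (\<exists>U S V. reduced_svd r X U S V \<and>
        two_inf_norm U \<le> sqrt (\<mu> * real r / real (dim_row X)) \<and>
        two_inf_norm V \<le> sqrt (\<mu> * real r / real (dim_col X)))"

definition incoherent_mats :: "nat \<Rightarrow> nat \<Rightarrow> nat \<Rightarrow> real \<Rightarrow> real \<Rightarrow> real mat set" where
  "incoherent_mats n1 n2 r \<mu> \<kappa> =
     {X \<in> carrier_mat n1 n2. vec_space.rank n1 X = r \<and> incoherent \<mu> r X \<and>
        singular_value 1 X / singular_value r X = \<kappa>}"

text \<open>
  Sets of factor matrices with \<open>U\<close> stacked on top of \<open>V\<close>; the dimensions of \<open>X\<^sup>*\<close> (here \<open>Xs\<close>)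
  determine where a stacked matrix is split.
\<close>

definition B_err :: "nat \<Rightarrow> real mat \<Rightarrow> real \<Rightarrow> real mat set" where
  "B_err r Xs \<epsilon> = {U @\<^sub>r V | U V.
     U \<in> carrier_mat (dim_row Xs) r \<and> V \<in> carrier_mat (dim_col Xs) r \<and>
     frobenius_norm (U * transpose_mat V - Xs) \<le> \<epsilon> * singular_value r Xs}"

definition B_bln :: "nat \<Rightarrow> real mat \<Rightarrow> real \<Rightarrow> real mat set" where
  "B_bln r Xs \<delta> = {U @\<^sub>r V | U V.
     U \<in> carrier_mat (dim_row Xs) r \<and> V \<in> carrier_mat (dim_col Xs) r \<and>
     frobenius_norm (transpose_mat U * U - transpose_mat V * V) \<le> \<delta> * singular_value r Xs}"

definition B_mu :: "nat \<Rightarrow> real mat \<Rightarrow> real \<Rightarrow> real mat set" where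
  "B_mu r Xs \<mu> = {U @\<^sub>r V | U V.
     U \<in> carrier_mat (dim_row Xs) r \<and> V \<in> carrier_mat (dim_col Xs) r \<and>
     two_inf_norm U \<le> sqrt (3 * \<mu> * real r * singular_value 1 Xs / real (dim_row Xs)) \<and>
     two_inf_norm V \<le> sqrt (3 * \<mu> * real r * singular_value 1 Xs / real (dim_col Xs))}"

text \<open>A proper uniform distribution only for \<open>m \<le> n1 * n2\<close>.\<close>

definition uniform_sample :: "nat \<Rightarrow> nat \<Rightarrow> nat \<Rightarrow> (nat \<times> nat) set pmf" where
  "uniform_sample n1 n2 m = pmf_of_set {\<Omega>. \<Omega> \<subseteq> {..<n1} \<times> {..<n2} \<and> card \<Omega> = m}"

end

theory Submission
  imports Defs
begin

text \<open>
  Write \<open>X\<^sup>* = P S Q\<^sup>T\<close> and \<open>E = U V\<^sup>T - X\<^sup>*\<close>, and let \<open>T\<close> be the space of matrices \<open>P A\<^sup>T + B Q\<^sup>T\<close>.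
  The component of \<open>E\<close> orthogonal to \<open>T\<close> is \<open>A B\<^sup>T\<close> with \<open>A = (1 - P P\<^sup>T) U\<close> and \<open>B = (1 - Q Q\<^sup>T) V\<close>.

  On \<open>T\<close> sampling is a near isometry with high probability: \<open>P\<^sub>T P\<^sub>\<Omega> P\<^sub>T - p P\<^sub>T\<close> is a sum of independent
  centred rank-one operators, and the trace of its power \<open>2 q\<close> with \<open>q\<close> of order \<open>log n\<close> is estimated by
  a recursion in \<open>q\<close>. Independence is available after the uniform sample has been replaced by a Bernoulli
  sample, which costs a factor \<open>n1 n2 + 1\<close> in the probability.

  The squared entries of \<open>A B\<^sup>T\<close> are at most \<open>|A\<^sub>i|\<^sup>2 |B\<^sub>j|\<^sup>2\<close>. The sum of these products over \<open>\<Omega>\<close> is controlled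
  by the discrepancy of \<open>\<Omega>\<close>, seen as a bipartite graph, after both factors have been decomposed into
  indicators of level sets. Balancedness keeps the smallest singular values of \<open>U\<close> and \<open>V\<close> of order
  \<open>sqrt \<sigma>\<^sub>r\<close>, so that \<open>|A|\<^sub>F\<^sup>2\<close> and \<open>|B|\<^sub>F\<^sup>2\<close> are at most \<open>2 |E|\<^sub>F\<^sup>2 / \<sigma>\<^sub>r\<close>: the contribution of \<open>A B\<^sup>T\<close> is
  quadratic in \<open>E\<close>.
\<close>


section \<open>Finite-dimensional inner products and self-adjoint operators\<close>

text \<open>The isometry must hold for all admissible factor pairs at once, so probability enters
  only through two events that depend on \<open>Xs\<close> and the sample alone: near isometry on
  \<open>T\<close> and low discrepancy. Everything about \<open>U\<close> and \<open>V\<close> is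
  deterministic after that. Near isometry cannot be asked of all matrices, since a single unit
  matrix is either observed or missed; the part of \<open>E\<close> outside \<open>T\<close>
  therefore has to be small instead, and it is, because it is quadratic in \<open>E\<close>. The two
  terms of the maximum in the sampling condition have different origins. The logarithm comes from
  the trace moments: \<open>q\<close> must be of order \<open>log n\<close> to beat the dimension
  and the conversion factor, while \<open>q\<close> times the largest squared row norm of the kernel
  of \<open>P_T\<close>, of order \<open>\<mu> r / n\<close>, must stay below
  \<open>\<epsilon>\<^sup>2 p\<close>. The condition number comes from the square-root term of the
  discrepancy: \<open>sqrt (n p)\<close> times row bounds of order
  \<open>\<sigma>_1 \<mu> r / n\<close> must stay below
  \<open>p \<epsilon>\<^sup>2 \<sigma>_r\<close>, and squaring this gives \<open>\<mu>\<^sup>2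
  r\<^sup>2 \<kappa>\<^sup>2 / \<epsilon>\<^sup>4\<close>.\<close>

definition ip :: "'a set \<Rightarrow> ('a \<Rightarrow> real) \<Rightarrow> ('a \<Rightarrow> real) \<Rightarrow> real" where
  "ip I f g = (\<Sum>i\<in>I. f i * g i)"

definition unit_fun :: "'a \<Rightarrow> 'a \<Rightarrow> real" where
  "unit_fun e = (\<lambda>i. if i = e then 1 else 0)"

text \<open>Operators are plain functions without a linearity predicate: for finite \<open>I\<close>
  the identity, tested against all \<open>h\<close>, already forces the values of \<open>X f\<close>
  on \<open>I\<close> to depend linearly on those of \<open>f\<close>.\<close>

definition self_adjoint :: "'a set \<Rightarrow> (('a \<Rightarrow> real) \<Rightarrow> 'a \<Rightarrow> real) \<Rightarrow> bool" where
  "self_adjoint I X \<longleftrightarrow> (\<forall>f h. ip I (X f) h = ip I f (X h))"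

definition op_trace :: "'a set \<Rightarrow> (('a \<Rightarrow> real) \<Rightarrow> 'a \<Rightarrow> real) \<Rightarrow> real" where
  "op_trace I X = (\<Sum>e\<in>I. ip I (unit_fun e) (X (unit_fun e)))"

lemma ip_commute: "ip I f g = ip I g f"
  by (simp add: ip_def mult.commute)

lemma ip_self_nonneg [simp]: "0 \<le> ip I f f"
  by (simp add: ip_def sum_nonneg)

lemma ip_self_power2: "ip I f f = (\<Sum>i\<in>I. (f i)\<^sup>2)"
  by (simp add: ip_def power2_eq_square)

lemma ip_Cauchy_Schwarz: "(ip I f g)\<^sup>2 \<le> ip I f f * ip I g g"
  unfolding ip_def using Cauchy_Schwarz_ineq_sum[of f g I] by (simp add: power2_eq_square)

lemma ip_unit_left: "finite I \<Longrightarrow> e \<in> I \<Longrightarrow> ip I (unit_fun e) f = f e"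
  by (simp add: ip_def unit_fun_def if_distrib[of "\<lambda>x. x * _"] cong: if_cong)

lemma ip_unit_right: "finite I \<Longrightarrow> e \<in> I \<Longrightarrow> ip I f (unit_fun e) = f e"
  using ip_unit_left ip_commute by metis

lemma self_adjointD: "self_adjoint I X \<Longrightarrow> ip I (X f) h = ip I f (X h)"
  by (simp add: self_adjoint_def)

lemma ip_funpow_add:
  assumes "self_adjoint I X"
  shows "ip I ((X ^^ i) f) ((X ^^ j) h) = ip I f ((X ^^ (i + j)) h)"
proof (induction i arbitrary: j)
  case (Suc i)
  have "ip I ((X ^^ Suc i) f) ((X ^^ j) h) = ip I ((X ^^ i) f) ((X ^^ Suc j) h)"
    using self_adjointD[OF assms] by simp
  then show ?case using Suc[of "Suc j"] by simp
qed simp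

lemma ip_funpow_shift:
  assumes "self_adjoint I X" and "i + j = k + l"
  shows "ip I ((X ^^ i) f) ((X ^^ j) f) = ip I ((X ^^ k) f) ((X ^^ l) f)"
  using ip_funpow_add[OF assms(1)] assms(2) by metis

text \<open>At the least index where the maximum \<open>M\<close> is attained the left neighbour is
  strictly smaller. If that index were interior and \<open>M > 1\<close>, log-convexity there would
  give \<open>M * M < M * M\<close>.\<close>

lemma log_convex_le_one:
  fixes c :: "nat \<Rightarrow> real"
  assumes nn: "\<And>j. j \<le> m \<Longrightarrow> 0 \<le> c j"
    and lc: "\<And>j. 0 < j \<Longrightarrow> j < m \<Longrightarrow> (c j)\<^sup>2 \<le> c (j - 1) * c (j + 1)"
    and e: "c 0 \<le> 1" "c m \<le> 1" and "j \<le> m"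
  shows "c j \<le> 1"
proof (rule ccontr)
  assume h: "\<not> c j \<le> 1"
  define M where "M = Max (c ` {..m})"
  have "M \<in> c ` {..m}" unfolding M_def by (rule Max_in) auto
  then have ex: "\<exists>i. i \<le> m \<and> c i = M" by auto
  define i where "i = (LEAST i. i \<le> m \<and> c i = M)"
  have i: "i \<le> m" "c i = M" using LeastI_ex[OF ex] by (auto simp: i_def)
  have M: "c l \<le> M" if "l \<le> m" for l unfolding M_def using that by auto
  have "M > 1" using M[OF \<open>j \<le> m\<close>] h by simp
  have "i \<noteq> 0 \<and> i \<noteq> m" using i e \<open>M > 1\<close> by (intro conjI notI) auto
  then have i0: "0 < i" "i < m" using i(1) by simp_all
  have "c (i - 1) \<noteq> M" using not_less_Least[of "i - 1" "\<lambda>i. i \<le> m \<and> c i = M"] i0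
    by (auto simp: i_def[symmetric])
  moreover have "c (i - 1) \<le> M" using i0 by (intro M) simp
  ultimately have l: "c (i - 1) < M" by simp
  have "M * M \<le> c (i - 1) * c (i + 1)" using lc[OF i0] i by (simp add: power2_eq_square)
  also have "\<dots> \<le> c (i - 1) * M" using M[of "i + 1"] nn[of "i - 1"] i0 by (intro mult_left_mono) auto
  also have "\<dots> < M * M" using l \<open>M > 1\<close> by simp
  finally show False by simp
qed

text \<open>The moments of a self-adjoint operator are log-convex; this replaces the spectral theorem.\<close>

lemma moment_bound:
  assumes sa: "self_adjoint I X" and "0 < \<theta>" and "0 < a"
    and e: "ip I g g \<le> a" "ip I g ((X ^^ (2 * m)) g) \<le> a * \<theta> ^ (2 * m)" and "i \<le> 2 * m"
  shows "\<bar>ip I g ((X ^^ i) g)\<bar> \<le> a * \<theta> ^ i"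
proof -
  define c where "c j = ip I ((X ^^ j) g) ((X ^^ j) g) / (a * \<theta> ^ (2 * j))" for j
  have nn: "0 \<le> c j" for j using assms by (simp add: c_def)
  have even: "c j \<le> 1" if "j \<le> m" for j
  proof (rule log_convex_le_one[of m c])
    fix j :: nat assume j: "0 < j" "j < m"
    have "(ip I ((X ^^ j) g) ((X ^^ j) g))\<^sup>2 = (ip I ((X ^^ (j - 1)) g) ((X ^^ (j + 1)) g))\<^sup>2"
      using ip_funpow_shift[OF sa, of j j "j - 1" "j + 1"] j by simp
    also have "\<dots> \<le> ip I ((X ^^ (j - 1)) g) ((X ^^ (j - 1)) g) * ip I ((X ^^ (j + 1)) g) ((X ^^ (j + 1)) g)"
      by (rule ip_Cauchy_Schwarz)
    finally have *: "(ip I ((X ^^ j) g) ((X ^^ j) g))\<^sup>2 \<le> ip I ((X ^^ (j - 1)) g) ((X ^^ (j - 1)) g) * ip I ((X ^^ (j + 1)) g) ((X ^^ (j + 1)) g)" .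
    obtain k where "j = Suc k" using j by (cases j) auto
    then have "(a * \<theta> ^ (2 * j))\<^sup>2 = (a * \<theta> ^ (2 * (j - 1))) * (a * \<theta> ^ (2 * (j + 1)))"
      by (simp add: power2_eq_square mult_ac)
    then show "(c j)\<^sup>2 \<le> c (j - 1) * c (j + 1)"
      using * assms unfolding c_def power_divide times_divide_times_eq by (intro divide_mono) (auto simp: zero_less_mult_iff)
  next
    show "c m \<le> 1" using e(2) ip_funpow_add[OF sa, of m g m g] assms by (simp add: c_def mult_2)
  qed (use nn e assms that in \<open>auto simp: c_def\<close>)
  have ev: "ip I ((X ^^ j) g) ((X ^^ j) g) \<le> a * \<theta> ^ (2 * j)" if "j \<le> m" for j
    using even[OF that] assms by (simp add: c_def)
  show ?thesis
  proof (cases "even i")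
    case True
    then obtain j where j: "i = 2 * j" by auto
    have "ip I g ((X ^^ i) g) = ip I ((X ^^ j) g) ((X ^^ j) g)"
      using ip_funpow_add[OF sa, of j g j g] j by (simp add: mult_2)
    then show ?thesis using ev[of j] j assms by simp
  next
    case False
    then obtain j where j: "i = 2 * j + 1" using oddE by blast
    have "\<bar>ip I g ((X ^^ i) g)\<bar>\<^sup>2 = (ip I ((X ^^ j) g) ((X ^^ Suc j) g))\<^sup>2"
      using ip_funpow_add[OF sa, of j g "Suc j" g] j by (simp add: mult_2)
    also have "\<dots> \<le> ip I ((X ^^ j) g) ((X ^^ j) g) * ip I ((X ^^ Suc j) g) ((X ^^ Suc j) g)"
      by (rule ip_Cauchy_Schwarz)
    also have "\<dots> \<le> (a * \<theta> ^ (2 * j)) * (a * \<theta> ^ (2 * Suc j))"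
      using j assms by (intro mult_mono ev) auto
    also have "\<dots> = (a * \<theta> ^ i)\<^sup>2" by (simp add: j power2_eq_square mult_ac)
    finally show ?thesis by (rule power2_le_imp_le) (use assms in auto)
  qed
qed

text \<open>Both operators are compared with one common scale \<open>\<theta>\<close>, chosen so
  that \<open>M * \<theta> ^ (2 * m)\<close> dominates both top moments. \<open>moment_bound\<close>
  then gives \<open>M * \<theta> ^ i\<close> and \<open>M * \<theta> ^ (2 * m - i)\<close>, whose
  product no longer depends on \<open>i\<close>.\<close>

lemma moment_product_bound:
  assumes A: "self_adjoint I A" and B: "self_adjoint I B" and "ip I g g \<le> M" and M: "0 < M"
    and i: "i \<le> 2 * m"
  shows "ip I g ((A ^^ i) g) * ip I g ((B ^^ (2 * m - i)) g)
    \<le> M * (ip I g ((A ^^ (2 * m)) g) + ip I g ((B ^^ (2 * m)) g))"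
proof -
  define \<alpha> where "\<alpha> = ip I g ((A ^^ (2 * m)) g)"
  define \<gamma> where "\<gamma> = ip I g ((B ^^ (2 * m)) g)"
  have ge: "0 \<le> \<alpha>" "0 \<le> \<gamma>"
    using ip_funpow_add[OF A, of m g m g] ip_funpow_add[OF B, of m g m g]
    by (auto simp: \<alpha>_def \<gamma>_def mult_2[symmetric]) (metis ip_self_nonneg)+
  show ?thesis
  proof (cases "m = 0")
    case True
    then have "ip I g g * ip I g g \<le> M * (ip I g g)" using assms by (intro mult_right_mono) auto
    also have "\<dots> \<le> M * (ip I g g + ip I g g)" using M by (intro mult_left_mono) auto
    finally show ?thesis using True i by simp
  next
    case False
    have "ip I g ((A ^^ i) g) * ip I g ((B ^^ (2 * m - i)) g) \<le> M * (\<alpha> + \<gamma>) + \<delta>" if "0 < \<delta>" for \<delta>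
    proof -
      \<comment> \<open>The slack \<open>\<delta>\<close> keeps \<open>\<theta>\<close> positive
        when both top moments vanish.\<close>
      define t where "t = (\<alpha> + \<gamma> + \<delta> / M) / M"
      have t: "0 < t" using ge that M by (simp add: t_def add_nonneg_pos)
      define \<theta> where "\<theta> = root (2 * m) t"
      have th: "0 < \<theta>" "\<theta> ^ (2 * m) = t" using t False by (auto simp: \<theta>_def)
      have Mt: "M * t = \<alpha> + \<gamma> + \<delta> / M" using M by (simp add: t_def)
      have 1: "\<bar>ip I g ((A ^^ i) g)\<bar> \<le> M * \<theta> ^ i"
        using Mt ge that M assms th by (intro moment_bound[OF A _ M, of \<theta> g m]) (auto simp: \<alpha>_def)
      have 2: "\<bar>ip I g ((B ^^ (2 * m - i)) g)\<bar> \<le> M * \<theta> ^ (2 * m - i)"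
        using Mt ge that M assms th by (intro moment_bound[OF B _ M, of \<theta> g m]) (auto simp: \<gamma>_def)
      have "ip I g ((A ^^ i) g) * ip I g ((B ^^ (2 * m - i)) g) \<le> \<bar>ip I g ((A ^^ i) g)\<bar> * \<bar>ip I g ((B ^^ (2 * m - i)) g)\<bar>"
        by (metis abs_ge_self abs_mult)
      also have "\<dots> \<le> (M * \<theta> ^ i) * (M * \<theta> ^ (2 * m - i))" using 1 2 M th by (intro mult_mono) auto
      also have "\<dots> = M * (M * \<theta> ^ (2 * m))" using i by (simp add: power_add[symmetric])
      also have "\<dots> = M * (\<alpha> + \<gamma>) + \<delta>" unfolding th Mt using M by (simp add: algebra_simps)
      finally show ?thesis .
    qed
    then show ?thesis unfolding \<alpha>_def \<gamma>_def by (rule field_le_epsilon)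
  qed
qed

text \<open>This is the noncommutative expansion of \<open>A^(n+1) - B^(n+1)\<close> into the terms
  \<open>A^i (A - B) B^(n-i)\<close>. As \<open>A - B\<close> is the rank-one operator of
  \<open>g\<close>, each term between two copies of \<open>g\<close> factors into two scalar
  moments. \<open>D\<close> interpolates between the two ends of the telescoping sum.\<close>

lemma rank_one_update_moments:
  assumes A: "self_adjoint I A" and B: "self_adjoint I B"
    and upd: "\<And>f h. ip I (A f) h - ip I (B f) h = ip I g f * ip I g h"
  shows "ip I g ((A ^^ Suc n) g) - ip I g ((B ^^ Suc n) g)
    = (\<Sum>i\<le>n. ip I g ((A ^^ i) g) * ip I g ((B ^^ (n - i)) g))"
proof -
  define D where "D i = ip I ((A ^^ i) g) ((B ^^ (Suc n - i)) g)" for i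
  have "D (Suc i) - D i = ip I g ((A ^^ i) g) * ip I g ((B ^^ (n - i)) g)" if "i \<le> n" for i
  proof -
    have "D i = ip I ((A ^^ i) g) (B ((B ^^ (n - i)) g))"
      using that by (simp add: D_def Suc_diff_le)
    also have "\<dots> = ip I (B ((A ^^ i) g)) ((B ^^ (n - i)) g)"
      using self_adjointD[OF B] by simp
    finally show ?thesis using upd[of "(A ^^ i) g" "(B ^^ (n - i)) g"] by (simp add: D_def)
  qed
  then have "(\<Sum>i\<le>n. ip I g ((A ^^ i) g) * ip I g ((B ^^ (n - i)) g)) = (\<Sum>i\<le>n. D (Suc i) - D i)"
    by (intro sum.cong) auto
  also have "\<dots> = D (Suc n) - D 0" using sum_lessThan_telescope[of D "Suc n"] by (simp add: lessThan_Suc_atMost)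
  also have "\<dots> = ip I g ((A ^^ Suc n) g) - ip I g ((B ^^ Suc n) g)"
    using ip_commute[of I "(A ^^ Suc n) g" g] by (simp add: D_def)
  finally show ?thesis by simp
qed

lemma rank_one_update_le:
  assumes "self_adjoint I A" "self_adjoint I B" and "ip I g g \<le> M" "0 < M"
    and "\<And>f h. ip I (A f) h - ip I (B f) h = ip I g f * ip I g h"
  shows "ip I g ((A ^^ Suc (2 * m)) g) - ip I g ((B ^^ Suc (2 * m)) g)
    \<le> real (2 * m + 1) * M * (ip I g ((A ^^ (2 * m)) g) + ip I g ((B ^^ (2 * m)) g))"
proof -
  have "(\<Sum>i\<le>2 * m. ip I g ((A ^^ i) g) * ip I g ((B ^^ (2 * m - i)) g))
     \<le> (\<Sum>i\<le>2 * m. M * (ip I g ((A ^^ (2 * m)) g) + ip I g ((B ^^ (2 * m)) g)))"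
    using assms by (intro sum_mono moment_product_bound) auto
  then show ?thesis using rank_one_update_moments[OF assms(1,2,5), of "2 * m"] by simp
qed

text \<open>The trace of \<open>X^(2q)\<close> is the squared Hilbert-Schmidt norm of
  \<open>X^q\<close>, so it bounds \<open>|X^q f|^2 / |f|^2\<close>. Log-convexity of the numbers
  \<open>|X^j f|^2\<close> carries the bound from \<open>j = q\<close> down to
  \<open>j = 1\<close>.\<close>

lemma self_adjoint_quadratic_bound:
  assumes sa: "self_adjoint I X" and fin: "finite I" and "0 < q"
  shows "\<bar>ip I f (X f)\<bar> ^ (2 * q) \<le> (ip I f f) ^ (2 * q) * op_trace I (X ^^ (2 * q))"
proof -
  define b where "b j = ip I ((X ^^ j) f) ((X ^^ j) f)" for j
  have lc: "(b (Suc j))\<^sup>2 \<le> b j * b (Suc (Suc j))" for j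
  proof -
    have "(b (Suc j))\<^sup>2 = (ip I ((X ^^ j) f) ((X ^^ (j + 2)) f))\<^sup>2"
      using ip_funpow_shift[OF sa, of "Suc j" "Suc j" j "j + 2"] by (simp add: b_def)
    then show ?thesis using ip_Cauchy_Schwarz[of I "(X ^^ j) f" "(X ^^ (j + 2)) f"] by (simp add: b_def)
  qed
  have nn: "0 \<le> b j" for j by (simp add: b_def)
  have hs: "b q \<le> b 0 * op_trace I (X ^^ (2 * q))"
  proof -
    have "b q = (\<Sum>e\<in>I. ((X ^^ q) f e)\<^sup>2)" by (simp add: b_def ip_self_power2)
    also have "\<dots> \<le> (\<Sum>e\<in>I. b 0 * ip I (unit_fun e) ((X ^^ (2 * q)) (unit_fun e)))"
    proof (rule sum_mono)
      fix e assume e: "e \<in> I"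
      have "(X ^^ q) f e = ip I ((X ^^ q) f) ((X ^^ 0) (unit_fun e))" using ip_unit_right[OF fin e] by simp
      also have "\<dots> = ip I f ((X ^^ q) (unit_fun e))" using ip_funpow_add[OF sa, of q f 0] by simp
      finally have "((X ^^ q) f e)\<^sup>2 \<le> ip I f f * ip I ((X ^^ q) (unit_fun e)) ((X ^^ q) (unit_fun e))"
        using ip_Cauchy_Schwarz by metis
      then show "((X ^^ q) f e)\<^sup>2 \<le> b 0 * ip I (unit_fun e) ((X ^^ (2 * q)) (unit_fun e))"
        using ip_funpow_add[OF sa, of q _ q] by (simp add: b_def mult_2)
    qed
    finally show ?thesis by (simp add: op_trace_def sum_distrib_left)
  qed
  \<comment> \<open>The second conjunct says that the ratio of consecutive terms is never below
    \<open>b 1 / b 0\<close>, written without division because the terms may vanish; it feeds the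
    induction for the first.\<close>
  have pw: "(b 1) ^ j \<le> b j * (b 0) ^ (j - 1) \<and> b 1 * b j \<le> b 0 * b (Suc j)" if "0 < j" for j
    using that
  proof (induction j rule: nat_induct_non_zero)
    case 1
    show ?case using lc[of 0] by (simp add: power2_eq_square)
  next
    case (Suc j)
    have "b 1 * b j * b (Suc j) \<le> b 0 * (b (Suc j) * b (Suc j))"
      using mult_right_mono[OF conjunct2[OF Suc.IH] nn[of "Suc j"]] by (simp add: mult.assoc)
    also have "\<dots> \<le> b 0 * (b j * b (Suc (Suc j)))"
      using lc[of j] nn by (intro mult_left_mono) (auto simp: power2_eq_square)
    finally have *: "b j * (b 1 * b (Suc j)) \<le> b j * (b 0 * b (Suc (Suc j)))" by (simp add: algebra_simps)
    have A: "b 1 * b (Suc j) \<le> b 0 * b (Suc (Suc j))"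
    proof (cases "b j = 0")
      case True
      then have "(b (Suc j))\<^sup>2 \<le> 0" using lc[of j] by simp
      then have "b (Suc j) = 0" by simp
      then show ?thesis using nn by simp
    next
      case False
      then show ?thesis using * nn[of j] by (simp add: mult_le_cancel_left_pos)
    qed
    have "(b 1) ^ Suc j \<le> b 1 * (b j * (b 0) ^ (j - 1))"
      using Suc nn by (simp add: mult_left_mono)
    also have "\<dots> = (b 1 * b j) * (b 0) ^ (j - 1)" by simp
    also have "\<dots> \<le> (b 0 * b (Suc j)) * (b 0) ^ (j - 1)" using Suc nn by (intro mult_right_mono) auto
    also have "\<dots> = b (Suc j) * (b 0) ^ (Suc j - 1)" using Suc.hyps by (cases j) auto
    finally show ?case using A by simp
  qed
  have "\<bar>ip I f (X f)\<bar> ^ (2 * q) = ((ip I f (X f))\<^sup>2) ^ q" by (simp add: power_mult power_abs)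
  also have "\<dots> \<le> (b 0 * b 1) ^ q"
    using ip_Cauchy_Schwarz[of I f "X f"] by (intro power_mono) (auto simp: b_def)
  also have "\<dots> = (b 0) ^ q * (b 1) ^ q" by (simp add: power_mult_distrib)
  also have "\<dots> \<le> (b 0) ^ q * (b q * (b 0) ^ (q - 1))" using pw[OF \<open>0 < q\<close>] nn by (intro mult_left_mono) auto
  also have "\<dots> \<le> (b 0) ^ q * ((b 0 * op_trace I (X ^^ (2 * q))) * (b 0) ^ (q - 1))"
    using hs nn by (intro mult_left_mono mult_right_mono) auto
  also have "\<dots> = (b 0) ^ q * (b 0 * (b 0) ^ (q - 1)) * op_trace I (X ^^ (2 * q))" by simp
  also have "b 0 * (b 0) ^ (q - 1) = (b 0) ^ q" using \<open>0 < q\<close> by (cases q) auto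
  finally show ?thesis by (simp add: b_def power_add[symmetric] mult_2)
qed

section \<open>Bernoulli sampling\<close>

text \<open>The expectation of \<open>f\<close> when every element of \<open>E\<close> is kept
  independently with probability \<open>p\<close>. As a finite sum it turns conditioning on one
  coordinate into the algebraic identity \<open>bern_remove\<close>.\<close>

definition bern :: "real \<Rightarrow> 'a set \<Rightarrow> ('a set \<Rightarrow> real) \<Rightarrow> real" where
  "bern p E f = (\<Sum>W\<in>Pow E. p ^ card W * (1 - p) ^ card (E - W) * f W)"

lemma bern_cong: "(\<And>W. W \<subseteq> E \<Longrightarrow> f W = g W) \<Longrightarrow> bern p E f = bern p E g"
  by (simp add: bern_def)

lemma bern_add: "bern p E (\<lambda>W. f W + g W) = bern p E f + bern p E g"
  by (simp add: bern_def sum.distrib algebra_simps)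

lemma bern_cmult: "bern p E (\<lambda>W. c * f W) = c * bern p E f"
  by (simp add: bern_def sum_distrib_left algebra_simps)

lemma bern_divide: "bern p E (\<lambda>W. f W / c) = bern p E f / c"
  by (simp add: bern_def sum_divide_distrib)

lemma bern_sum: "bern p E (\<lambda>W. \<Sum>i\<in>A. f i W) = (\<Sum>i\<in>A. bern p E (f i))"
  unfolding bern_def sum_distrib_left by (rule sum.swap)

lemma bern_mono:
  assumes "0 \<le> p" "p \<le> 1" "\<And>W. W \<subseteq> E \<Longrightarrow> f W \<le> g W"
  shows "bern p E f \<le> bern p E g"
  unfolding bern_def using assms by (intro sum_mono mult_left_mono) auto

lemma bern_insert:
  assumes "finite E" "k \<notin> E"
  shows "bern p (insert k E) f = bern p E (\<lambda>W. p * f (insert k W) + (1 - p) * f W)"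
proof -
  have inj: "inj_on (insert k) (Pow E)" using assms(2) by (auto simp: inj_on_def)
  have d: "Pow E \<inter> insert k ` Pow E = {}" using assms(2) by auto
  have 1: "(\<Sum>W\<in>Pow E. p ^ card W * (1 - p) ^ card (insert k E - W) * f W)
     = (\<Sum>W\<in>Pow E. p ^ card W * (1 - p) ^ card (E - W) * ((1 - p) * f W))"
  proof (rule sum.cong)
    fix W assume "W \<in> Pow E"
    then have "insert k E - W = insert k (E - W)" using assms(2) by auto
    then show "p ^ card W * (1 - p) ^ card (insert k E - W) * f W = p ^ card W * (1 - p) ^ card (E - W) * ((1 - p) * f W)"
      using assms by (simp add: card_insert_if)
  qed simp
  have 2: "(\<Sum>W\<in>insert k ` Pow E. p ^ card W * (1 - p) ^ card (insert k E - W) * f W)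
     = (\<Sum>W\<in>Pow E. p ^ card W * (1 - p) ^ card (E - W) * (p * f (insert k W)))"
    unfolding sum.reindex[OF inj] o_def
  proof (rule sum.cong)
    fix W assume W: "W \<in> Pow E"
    then have "insert k E - insert k W = E - W" "k \<notin> W" "finite W" using assms finite_subset by auto
    then show "p ^ card (insert k W) * (1 - p) ^ card (insert k E - insert k W) * f (insert k W)
        = p ^ card W * (1 - p) ^ card (E - W) * (p * f (insert k W))"
      by (simp add: card_insert_if)
  qed simp
  have "bern p (insert k E) f
     = (\<Sum>W\<in>Pow E. p ^ card W * (1 - p) ^ card (insert k E - W) * f W)
     + (\<Sum>W\<in>insert k ` Pow E. p ^ card W * (1 - p) ^ card (insert k E - W) * f W)"
    unfolding bern_def Pow_insert using assms d by (intro sum.union_disjoint) auto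
  also have "\<dots> = bern p E (\<lambda>W. p * f (insert k W) + (1 - p) * f W)"
    unfolding 1 2 unfolding bern_def sum.distrib[symmetric]
    by (intro sum.cong refl) (simp only: distrib_left add.commute)
  finally show ?thesis .
qed

lemma bern_remove:
  assumes "finite E" "k \<in> E"
  shows "bern p E f = bern p (E - {k}) (\<lambda>W. p * f (insert k W) + (1 - p) * f W)"
  using bern_insert[of "E - {k}" k p f] assms by (simp add: insert_absorb)

lemma bern_const [simp]: "finite E \<Longrightarrow> bern p E (\<lambda>W. c) = c"
proof (induction E rule: finite_induct)
  case empty
  show ?case by (simp add: bern_def)
next
  case (insert k E)
  have "p * c + (1 - p) * c = c" by (simp add: algebra_simps)
  then show ?case using insert by (simp add: bern_insert)
qed

lemma bern_nonneg:
  assumes "0 \<le> p" "p \<le> 1" "\<And>W. W \<subseteq> E \<Longrightarrow> 0 \<le> f W"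
  shows "0 \<le> bern p E f"
  unfolding bern_def using assms by (intro sum_nonneg) auto

lemma bern_exp_card:
  assumes "finite E"
  shows "bern p E (\<lambda>W. exp (l * real (card (W \<inter> F)))) = (1 + p * (exp l - 1)) ^ card (E \<inter> F)"
  using assms
proof (induction E rule: finite_induct)
  case empty
  show ?case by (simp add: bern_def)
next
  case (insert k E)
  let ?g = "\<lambda>W. exp (l * real (card (W \<inter> F)))"
  let ?c = "if k \<in> F then 1 + p * (exp l - 1) else 1"
  have "p * ?g (insert k W) + (1 - p) * ?g W = ?c * ?g W" if "W \<subseteq> E" for W
  proof -
    have "finite (W \<inter> F)" "k \<notin> W" using that insert finite_subset by auto
    then show ?thesis by (auto simp: Int_insert_left algebra_simps exp_add)
  qed
  then have "bern p (insert k E) ?g = bern p E (\<lambda>W. ?c * ?g W)"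
    unfolding bern_insert[OF insert(1,2)] by (rule bern_cong)
  also have "\<dots> = ?c * (1 + p * (exp l - 1)) ^ card (E \<inter> F)" using insert by (simp only: bern_cmult)
  also have "\<dots> = (1 + p * (exp l - 1)) ^ card (insert k E \<inter> F)"
    using insert by (simp add: Int_insert_left)
  finally show ?case .
qed

lemma bern_Chernoff:
  assumes "finite E" "F \<subseteq> E" "0 \<le> p" "p \<le> 1" "0 \<le> l"
  shows "bern p E (\<lambda>W. of_bool (a \<le> real (card (W \<inter> F)))) \<le> exp (p * real (card F) * (exp l - 1) - l * a)"
proof -
  have "bern p E (\<lambda>W. of_bool (a \<le> real (card (W \<inter> F)))) \<le> bern p E (\<lambda>W. exp (- (l * a)) * exp (l * real (card (W \<inter> F))))"
    using assms by (intro bern_mono) (auto simp: of_bool_def exp_add[symmetric] mult_left_mono)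
  also have "\<dots> = exp (- (l * a)) * (1 + p * (exp l - 1)) ^ card F"
    unfolding bern_cmult using assms by (simp add: bern_exp_card Int_absorb1)
  also have "\<dots> \<le> exp (- (l * a)) * exp (p * (exp l - 1)) ^ card F"
    using assms by (intro mult_left_mono power_mono add_nonneg_nonneg mult_nonneg_nonneg exp_ge_add_one_self) auto
  also have "\<dots> = exp (p * real (card F) * (exp l - 1) - l * a)"
    by (simp add: exp_add[symmetric] exp_of_nat_mult[symmetric] algebra_simps)
  finally show ?thesis .
qed

lemma bern_Markov:
  assumes "0 \<le> p" "p \<le> 1" "0 < a" "\<And>W. W \<subseteq> E \<Longrightarrow> 0 \<le> f W"
    and "\<And>W. W \<subseteq> E \<Longrightarrow> Q W \<Longrightarrow> a \<le> f W"
  shows "bern p E (\<lambda>W. of_bool (Q W)) \<le> bern p E f / a"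
  unfolding bern_divide[symmetric] using assms by (intro bern_mono) (auto simp: of_bool_def)

section \<open>From Bernoulli samples to samples of fixed size\<close>

text \<open>For \<open>p = m / N\<close> the ratio of the weights at \<open>k + 1\<close> and
  \<open>k\<close> is \<open>m (N - k) / ((N - m) (k + 1))\<close>, which is at least one for
  \<open>k < m\<close> and at most one for \<open>k \<ge> m\<close>. The products are compared
  instead of the ratio, because \<open>m = N\<close> is allowed.\<close>

lemma binomial_mode:
  assumes "0 < N" "m \<le> N" "k \<le> N" and p: "p = real m / real N"
  shows "real (N choose k) * p ^ k * (1 - p) ^ (N - k) \<le> real (N choose m) * p ^ m * (1 - p) ^ (N - m)"
proof -
  have p01: "0 \<le> p" "p \<le> 1" using assms by auto
  define b where "b k = real (N choose k) * p ^ k * (1 - p) ^ (N - k)" for k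
  have nn: "0 \<le> b k" for k using p01 by (simp add: b_def)
  have step: "(1 - p) * real (Suc k) * b (Suc k) = p * real (N - k) * b k" if "k < N" for k
  proof -
    have "N - k = Suc (N - Suc k)" using that by simp
    moreover have "real (Suc k) * real (N choose Suc k) = real (N choose k) * real (N - k)"
      using binomial_absorb_comp[of N k] binomial_absorption[of k "N"] that
      by (metis Suc_times_binomial_eq binomial_absorption mult.commute of_nat_mult diff_Suc_Suc)
    ultimately show ?thesis unfolding b_def by (simp add: mult_ac del: of_nat_Suc)
  qed
  have q: "1 - p = real (N - m) / real N" using assms by (simp add: of_nat_diff field_simps)
  have step': "real (N - m) * real (Suc k) * b (Suc k) = real m * real (N - k) * b k" if "k < N" for k
    using step[OF that] assms(1) unfolding q unfolding p by (simp add: divide_simps mult_ac del: of_nat_diff of_nat_Suc)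
  have up: "b k \<le> b (Suc k)" if "Suc k \<le> m" for k
  proof (rule ccontr)
    assume h: "\<not> b k \<le> b (Suc k)"
    have c: "(N - m) * Suc k \<le> m * (N - k)" using that assms by (intro order_trans[OF mult_mono[of "N - m" "N - k" "Suc k" m]]) auto
    have "real (N - m) * real (Suc k) * b (Suc k) \<le> real m * real (N - k) * b (Suc k)"
      using c nn[of "Suc k"] by (intro mult_right_mono) (metis of_nat_le_iff of_nat_mult, simp)
    also have "\<dots> < real m * real (N - k) * b k" using h that assms by (intro mult_strict_left_mono) auto
    finally show False using step'[of k] that assms by simp
  qed
  have down: "b (Suc k) \<le> b k" if "m \<le> k" "k < N" for k
  proof -
    have c: "m * (N - k) \<le> (N - m) * Suc k" using that assms by (subst mult.commute, intro mult_mono) auto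
    have "real (N - m) * real (Suc k) * b (Suc k) \<le> real (N - m) * real (Suc k) * b k"
      unfolding step'[OF that(2)] using c nn[of k] by (intro mult_right_mono) (metis of_nat_le_iff of_nat_mult, simp)
    moreover have "0 < real (N - m) * real (Suc k)" using that by simp
    ultimately show ?thesis using mult_le_cancel_left_pos by blast
  qed
  have "b k \<le> b m"
  proof (cases "k \<le> m")
    case True
    then show ?thesis
    proof (induction k rule: inc_induct)
      case (step i) then show ?case using up[of i] by simp
    qed simp
  next
    case False
    then have "m \<le> k" by simp
    then show ?thesis using assms(3)
    proof (induction k rule: dec_induct)
      case (step i) then show ?case using down[of i] by simp
    qed simp
  qed
  then show ?thesis by (simp add: b_def)
qed

text \<open>A Bernoulli sample conditioned on having \<open>m\<close> elements is uniform. As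
  \<open>m\<close> is the most likely of the \<open>N + 1\<close> possible sizes, the conditioning
  event has probability at least \<open>1 / (N + 1)\<close>.\<close>

lemma card_subsets_le_bern:
  assumes fin: "finite E" and N: "card E = N" "0 < N" and m: "m \<le> N" and p: "p = real m / real N"
  shows "real (card {W. W \<subseteq> E \<and> card W = m \<and> Q W}) / real (N choose m)
    \<le> (real N + 1) * bern p E (\<lambda>W. of_bool (Q W))"
proof -
  have p01: "0 \<le> p" "p \<le> 1" using assms by auto
  let ?w = "p ^ m * (1 - p) ^ (N - m)"
  have "1 = (\<Sum>k\<le>N. real (N choose k) * p ^ k * (1 - p) ^ (N - k))"
    using binomial_ring[of p "1 - p" N] by simp
  also have "\<dots> \<le> (\<Sum>k\<le>N. real (N choose m) * ?w)"
    using binomial_mode[of N m _ p] assms by (intro sum_mono) (auto simp: mult_ac)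
  finally have 1: "1 \<le> (real N + 1) * (real (N choose m) * ?w)" by (simp add: algebra_simps)
  let ?A = "{W. W \<subseteq> E \<and> card W = m \<and> Q W}"
  have finA: "finite ?A" using fin by (auto intro: finite_subset[of _ "Pow E"])
  have "real (card ?A) * ?w = (\<Sum>W\<in>?A. p ^ card W * (1 - p) ^ card (E - W) * of_bool (Q W))"
  proof -
    have "card (E - W) = N - m" if "W \<in> ?A" for W
      using that N fin by (auto simp: card_Diff_subset finite_subset)
    then show ?thesis by simp
  qed
  also have "\<dots> \<le> bern p E (\<lambda>W. of_bool (Q W))"
    unfolding bern_def using p01 fin by (intro sum_mono2) auto
  finally have 2: "real (card ?A) * ?w \<le> bern p E (\<lambda>W. of_bool (Q W))" .
  have c: "0 < real (N choose m)" using m by simp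
  have "real (card ?A) \<le> real (card ?A) * ((real N + 1) * (real (N choose m) * ?w))"
    using mult_left_mono[OF 1, of "real (card ?A)"] by simp
  also have "\<dots> = (real N + 1) * real (N choose m) * (real (card ?A) * ?w)" by (simp only: mult_ac)
  also have "\<dots> \<le> (real N + 1) * real (N choose m) * bern p E (\<lambda>W. of_bool (Q W))"
    using 2 by (intro mult_left_mono) auto
  finally show ?thesis using c by (simp add: divide_simps mult_ac)
qed

section \<open>Random sums of rank-one operators\<close>

text \<open>In the application \<open>g k\<close> is the projection onto \<open>T\<close> of the
  unit matrix at position \<open>k\<close>. The Bessel inequality is then contraction by the
  projection, \<open>M\<close> comes from incoherence, and \<open>frame_op p W\<close> is
  \<open>P_T P_W P_T - p P_T\<close>.\<close>

locale bessel_system =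
  fixes E :: "'a set" and g :: "'a \<Rightarrow> 'a \<Rightarrow> real" and M :: real
  assumes fin: "finite E"
    and bessel: "\<And>f. (\<Sum>k\<in>E. (ip E (g k) f)\<^sup>2) \<le> ip E f f"
    and gM: "\<And>k. k \<in> E \<Longrightarrow> ip E (g k) (g k) \<le> M" and M: "0 < M"
begin

definition frame_op :: "real \<Rightarrow> 'a set \<Rightarrow> ('a \<Rightarrow> real) \<Rightarrow> 'a \<Rightarrow> real" where
  "frame_op p W f = (\<lambda>e. \<Sum>k\<in>E. (of_bool (k \<in> W) - p) * ip E (g k) f * g k e)"

lemma ip_frame_op:
  "ip E (frame_op p W f) h = (\<Sum>k\<in>E. (of_bool (k \<in> W) - p) * ip E (g k) f * ip E (g k) h)"
proof -
  have "ip E (frame_op p W f) h = (\<Sum>e\<in>E. \<Sum>k\<in>E. (of_bool (k \<in> W) - p) * ip E (g k) f * g k e * h e)"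
    unfolding frame_op_def by (subst ip_def) (simp add: sum_distrib_right)
  also have "\<dots> = (\<Sum>k\<in>E. \<Sum>e\<in>E. (of_bool (k \<in> W) - p) * ip E (g k) f * g k e * h e)"
    by (rule sum.swap)
  also have "\<dots> = (\<Sum>k\<in>E. (of_bool (k \<in> W) - p) * ip E (g k) f * ip E (g k) h)"
    by (simp add: ip_def[of E "g _" h] sum_distrib_left mult.assoc)
  finally show ?thesis .
qed

lemma self_adjoint_frame_op: "self_adjoint E (frame_op p W)"
  unfolding self_adjoint_def ip_commute[of E _ "frame_op p W _"] ip_frame_op by (simp add: mult_ac)

lemma frame_op_update:
  assumes "k \<in> E" "k \<notin> W"
  shows "ip E (frame_op p (insert k W) f) h - ip E (frame_op p W f) h = ip E (g k) f * ip E (g k) h"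
proof -
  have "ip E (frame_op p (insert k W) f) h - ip E (frame_op p W f) h
    = (\<Sum>j\<in>E. if j = k then ip E (g k) f * ip E (g k) h else 0)"
    unfolding ip_frame_op sum_subtractf[symmetric]
    by (rule sum.cong) (use assms in \<open>auto simp: algebra_simps\<close>)
  then show ?thesis using assms fin by simp
qed

text \<open>Peeling off one factor exposes a centred coefficient for each \<open>k\<close>; this is
  the place where independence of coordinate \<open>k\<close> from the others can act.\<close>

lemma op_trace_frame_op:
  "op_trace E (frame_op p W ^^ Suc n)
    = (\<Sum>k\<in>E. (of_bool (k \<in> W) - p) * ip E (g k) ((frame_op p W ^^ n) (g k)))"
proof -
  let ?X = "frame_op p W"
  note sa = self_adjoint_frame_op[of p W]
  have "ip E (unit_fun e) ((?X ^^ Suc n) (unit_fun e))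
     = (\<Sum>k\<in>E. (of_bool (k \<in> W) - p) * ((?X ^^ n) (g k) e * g k e))" if e: "e \<in> E" for e
  proof -
    have "ip E (g k) ((?X ^^ n) (unit_fun e)) = (?X ^^ n) (g k) e" for k
      using ip_funpow_add[OF sa, of n "g k" 0 "unit_fun e"] ip_unit_right[OF fin e] by simp
    moreover have "ip E (unit_fun e) ((?X ^^ Suc n) (unit_fun e)) = ip E (?X ((?X ^^ n) (unit_fun e))) (unit_fun e)"
      by (subst ip_commute) simp
    ultimately show ?thesis
      unfolding ip_frame_op using ip_unit_right[OF fin e] by (simp add: mult.assoc)
  qed
  then have "op_trace E (?X ^^ Suc n) = (\<Sum>e\<in>E. \<Sum>k\<in>E. (of_bool (k \<in> W) - p) * ((?X ^^ n) (g k) e * g k e))"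
    unfolding op_trace_def by (rule sum.cong[OF refl])
  also have "\<dots> = (\<Sum>k\<in>E. \<Sum>e\<in>E. (of_bool (k \<in> W) - p) * ((?X ^^ n) (g k) e * g k e))" by (rule sum.swap)
  also have "\<dots> = (\<Sum>k\<in>E. (of_bool (k \<in> W) - p) * ip E (g k) ((?X ^^ n) (g k)))"
    by (simp add: ip_def sum_distrib_left mult_ac)
  finally show ?thesis .
qed

lemma ip_even_power: "ip E f ((frame_op p W ^^ (2 * m)) f) = ip E ((frame_op p W ^^ m) f) ((frame_op p W ^^ m) f)"
  using ip_funpow_add[OF self_adjoint_frame_op[of p W], of m f m f] by (simp add: mult_2)

text \<open>By self-adjointness the left side is the sum over \<open>k\<close> and \<open>e\<close>
  of \<open>(ip E (g k) (X^m e))^2\<close>. Summing over \<open>k\<close> first allows the Bessel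
  inequality for each column of \<open>X^m\<close>.\<close>

lemma frame_energy_le_trace:
  "(\<Sum>k\<in>E. ip E (g k) ((frame_op p W ^^ (2 * m)) (g k))) \<le> op_trace E (frame_op p W ^^ (2 * m))"
proof -
  let ?X = "frame_op p W"
  have "ip E (g k) ((?X ^^ (2 * m)) (g k)) = (\<Sum>e\<in>E. (ip E (g k) ((?X ^^ m) (unit_fun e)))\<^sup>2)" for k
    unfolding ip_even_power ip_self_power2
  proof (rule sum.cong)
    fix e assume e: "e \<in> E"
    show "((?X ^^ m) (g k) e)\<^sup>2 = (ip E (g k) ((?X ^^ m) (unit_fun e)))\<^sup>2"
      using ip_funpow_add[OF self_adjoint_frame_op[of p W], of m "g k" 0 "unit_fun e"] ip_unit_right[OF fin e] by simp
  qed simp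
  then have "(\<Sum>k\<in>E. ip E (g k) ((?X ^^ (2 * m)) (g k)))
    = (\<Sum>k\<in>E. \<Sum>e\<in>E. (ip E (g k) ((?X ^^ m) (unit_fun e)))\<^sup>2)" by simp
  also have "\<dots> = (\<Sum>e\<in>E. \<Sum>k\<in>E. (ip E (g k) ((?X ^^ m) (unit_fun e)))\<^sup>2)" by (rule sum.swap)
  also have "\<dots> \<le> (\<Sum>e\<in>E. ip E ((?X ^^ m) (unit_fun e)) ((?X ^^ m) (unit_fun e)))" by (intro sum_mono bessel)
  finally show ?thesis by (simp add: op_trace_def ip_even_power)
qed

text \<open>The arithmetic-geometric mean inequality applied to \<open>X^m u\<close> and
  \<open>X^(m+1) u\<close>. The recursion only tracks even powers, whose traces are nonnegative; the
  free weight \<open>s\<close> lets it absorb the higher one.\<close>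

lemma op_trace_odd_le:
  assumes "0 < s"
  shows "op_trace E (frame_op p W ^^ Suc (2 * m))
    \<le> s / 2 * op_trace E (frame_op p W ^^ (2 * m)) + 1 / (2 * s) * op_trace E (frame_op p W ^^ (2 * Suc m))"
proof -
  let ?X = "frame_op p W"
  have "ip E u ((?X ^^ Suc (2 * m)) u) \<le> s / 2 * ip E u ((?X ^^ (2 * m)) u) + 1 / (2 * s) * ip E u ((?X ^^ (2 * Suc m)) u)" for u
  proof -
    have "Suc (2 * m) = m + Suc m" by simp
    then have "ip E u ((?X ^^ Suc (2 * m)) u) = ip E ((?X ^^ m) u) ((?X ^^ Suc m) u)"
      using ip_funpow_add[OF self_adjoint_frame_op[of p W], of m u "Suc m" u] by metis
    also have "\<dots> \<le> (\<Sum>i\<in>E. s / 2 * ((?X ^^ m) u i)\<^sup>2 + 1 / (2 * s) * ((?X ^^ Suc m) u i)\<^sup>2)"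
      unfolding ip_def
    proof (rule sum_mono)
      fix i
      have "0 \<le> (s * (?X ^^ m) u i - (?X ^^ Suc m) u i)\<^sup>2 / (2 * s)" using assms by simp
      also have "\<dots> = s / 2 * ((?X ^^ m) u i)\<^sup>2 + 1 / (2 * s) * ((?X ^^ Suc m) u i)\<^sup>2 - (?X ^^ m) u i * (?X ^^ Suc m) u i"
        using assms by (simp add: power2_eq_square field_simps)
      finally show "(?X ^^ m) u i * (?X ^^ Suc m) u i \<le> s / 2 * ((?X ^^ m) u i)\<^sup>2 + 1 / (2 * s) * ((?X ^^ Suc m) u i)\<^sup>2"
        by linarith
    qed
    also have "\<dots> = s / 2 * ip E ((?X ^^ m) u) ((?X ^^ m) u) + 1 / (2 * s) * ip E ((?X ^^ Suc m) u) ((?X ^^ Suc m) u)"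
      by (simp only: ip_self_power2 sum.distrib sum_distrib_left)
    finally show ?thesis by (simp only: ip_even_power)
  qed
  then have "op_trace E (?X ^^ Suc (2 * m)) \<le> (\<Sum>e\<in>E. s / 2 * ip E (unit_fun e) ((?X ^^ (2 * m)) (unit_fun e))
     + 1 / (2 * s) * ip E (unit_fun e) ((?X ^^ (2 * Suc m)) (unit_fun e)))"
    unfolding op_trace_def by (intro sum_mono)
  also have "\<dots> = s / 2 * op_trace E (?X ^^ (2 * m)) + 1 / (2 * s) * op_trace E (?X ^^ (2 * Suc m))"
    by (simp only: op_trace_def sum.distrib sum_distrib_left)
  finally show ?thesis .
qed

text \<open>Conditioning on all coordinates but \<open>k\<close>, the operators for the two values of coordinate \<open>k\<close> differ by
  the rank-one operator of \<open>g k\<close>. The right-hand side is written so that its sum over \<open>k\<close> is again a trace.\<close>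

lemma bern_coordinate_le:
  assumes p: "0 \<le> p" "p \<le> 1" and k: "k \<in> E"
  shows "bern p E (\<lambda>W. (of_bool (k \<in> W) - p) * ip E (g k) ((frame_op p W ^^ Suc (2 * m)) (g k)))
    \<le> real (2 * m + 1) * M * bern p E (\<lambda>W. (of_bool (k \<in> W) - p + 2 * p) * ip E (g k) ((frame_op p W ^^ (2 * m)) (g k)))"
proof -
  define \<phi> where "\<phi> W = ip E (g k) ((frame_op p W ^^ Suc (2 * m)) (g k))" for W
  define \<psi> where "\<psi> W = ip E (g k) ((frame_op p W ^^ (2 * m)) (g k))" for W
  have \<psi>0: "0 \<le> \<psi> W" for W by (simp add: \<psi>_def ip_even_power)
  have c: "0 \<le> real (2 * m + 1) * M" using M by simp
  have "bern p E (\<lambda>W. (of_bool (k \<in> W) - p) * \<phi> W)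
      = bern p (E - {k}) (\<lambda>W. p * (1 - p) * (\<phi> (insert k W) - \<phi> W))"
    unfolding bern_remove[OF fin k] by (rule bern_cong) (auto simp: algebra_simps)
  also have "\<dots> \<le> bern p (E - {k}) (\<lambda>W. p * (1 - p) * (real (2 * m + 1) * M * (\<psi> (insert k W) + \<psi> W)))"
  proof (intro bern_mono[OF p] mult_left_mono)
    fix W assume "W \<subseteq> E - {k}"
    then have "k \<notin> W" by auto
    show "\<phi> (insert k W) - \<phi> W \<le> real (2 * m + 1) * M * (\<psi> (insert k W) + \<psi> W)"
      unfolding \<phi>_def \<psi>_def
      by (rule rank_one_update_le[OF self_adjoint_frame_op self_adjoint_frame_op gM[OF k] M frame_op_update[OF k \<open>k \<notin> W\<close>]])
  qed (use p in auto)
  also have "\<dots> \<le> bern p (E - {k}) (\<lambda>W. real (2 * m + 1) * M * (p * ((1 + p) * \<psi> (insert k W)) + (1 - p) * (p * \<psi> W)))"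
  proof (rule bern_mono[OF p])
    fix W
    have "(1 - p) * \<psi> (insert k W) \<le> (1 + p) * \<psi> (insert k W)" using p \<psi>0 by (intro mult_right_mono) auto
    then have "p * ((1 - p) * \<psi> (insert k W)) \<le> p * ((1 + p) * \<psi> (insert k W))" using p(1) by (rule mult_left_mono)
    then have "p * (1 - p) * (\<psi> (insert k W) + \<psi> W) \<le> p * ((1 + p) * \<psi> (insert k W)) + (1 - p) * (p * \<psi> W)"
      by (simp add: algebra_simps)
    then have "real (2 * m + 1) * M * (p * (1 - p) * (\<psi> (insert k W) + \<psi> W))
       \<le> real (2 * m + 1) * M * (p * ((1 + p) * \<psi> (insert k W)) + (1 - p) * (p * \<psi> W))"
      using c by (rule mult_left_mono)
    then show "p * (1 - p) * (real (2 * m + 1) * M * (\<psi> (insert k W) + \<psi> W))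
       \<le> real (2 * m + 1) * M * (p * ((1 + p) * \<psi> (insert k W)) + (1 - p) * (p * \<psi> W))"
      by (simp only: mult_ac)
  qed
  also have "\<dots> = real (2 * m + 1) * M * bern p E (\<lambda>W. (of_bool (k \<in> W) - p + 2 * p) * \<psi> W)"
    unfolding bern_cmult bern_remove[OF fin k] by (intro arg_cong2[where f = "(*)"] bern_cong refl) auto
  finally show ?thesis by (simp only: \<phi>_def \<psi>_def)
qed

text \<open>When \<open>bern_coordinate_le\<close> is summed over \<open>k\<close>, the centred
  coefficients rebuild the trace of the power \<open>2 * m + 1\<close>, and the remaining
  \<open>2 * p\<close> multiplies the energy bounded by
  \<open>frame_energy_le_trace\<close>.\<close>

lemma trace_moment_step:
  assumes p: "0 \<le> p" "p \<le> 1" and s: "s = real (2 * m + 1) * M"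
  shows "bern p E (\<lambda>W. op_trace E (frame_op p W ^^ (2 * Suc m)))
    \<le> (s\<^sup>2 + 4 * p * s) * bern p E (\<lambda>W. op_trace E (frame_op p W ^^ (2 * m)))"
proof -
  define \<tau> where "\<tau> m = bern p E (\<lambda>W. op_trace E (frame_op p W ^^ (2 * m)))" for m
  have s0: "0 < s" using M by (simp add: s)
  have "\<tau> (Suc m) = (\<Sum>k\<in>E. bern p E (\<lambda>W. (of_bool (k \<in> W) - p) * ip E (g k) ((frame_op p W ^^ Suc (2 * m)) (g k))))"
    unfolding \<tau>_def bern_sum[symmetric] op_trace_frame_op[symmetric] by simp
  also have "\<dots> \<le> (\<Sum>k\<in>E. s * bern p E (\<lambda>W. (of_bool (k \<in> W) - p + 2 * p) * ip E (g k) ((frame_op p W ^^ (2 * m)) (g k))))"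
    unfolding s by (intro sum_mono bern_coordinate_le p)
  also have "\<dots> = s * bern p E (\<lambda>W. op_trace E (frame_op p W ^^ Suc (2 * m))
      + 2 * p * (\<Sum>k\<in>E. ip E (g k) ((frame_op p W ^^ (2 * m)) (g k))))"
    unfolding sum_distrib_left[symmetric] bern_sum[symmetric] op_trace_frame_op distrib_right sum.distrib mult.assoc ..
  also have "\<dots> \<le> s * bern p E (\<lambda>W. s / 2 * op_trace E (frame_op p W ^^ (2 * m))
      + 1 / (2 * s) * op_trace E (frame_op p W ^^ (2 * Suc m)) + 2 * p * op_trace E (frame_op p W ^^ (2 * m)))"
    using s0 p
    by (intro mult_left_mono[OF bern_mono] add_mono op_trace_odd_le mult_left_mono[OF frame_energy_le_trace]) auto
  also have "\<dots> = s * (s / 2 * \<tau> m + 1 / (2 * s) * \<tau> (Suc m) + 2 * p * \<tau> m)"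
    unfolding bern_add bern_cmult \<tau>_def ..
  \<comment> \<open>The weight in \<open>op_trace_odd_le\<close> was taken equal to
    \<open>s\<close>, so the next trace comes back with coefficient exactly 1/2 and can be absorbed
    on the left.\<close>
  also have "\<dots> = (s\<^sup>2 + 4 * p * s) * \<tau> m / 2 + \<tau> (Suc m) / 2"
    using s0 by (simp add: field_simps power2_eq_square)
  finally show ?thesis unfolding \<tau>_def by simp
qed

lemma op_trace_nonneg: "0 \<le> op_trace E (frame_op p W ^^ (2 * m))"
  unfolding op_trace_def ip_even_power by (intro sum_nonneg) simp

lemma trace_moment_bound:
  assumes p: "0 \<le> p" "p \<le> 1" and Q: "2 * real Q * M \<le> p" and "q \<le> Q"
  shows "bern p E (\<lambda>W. op_trace E (frame_op p W ^^ (2 * q))) \<le> (10 * real Q * M * p) ^ q * real (card E)"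
  using \<open>q \<le> Q\<close>
proof (induction q)
  case 0
  have "op_trace E (\<lambda>f. f) = real (card E)" unfolding op_trace_def
    using ip_unit_left[OF fin] by (simp add: unit_fun_def)
  then show ?case using fin by (simp add: id_def)
next
  case (Suc m)
  define s where "s = real (2 * m + 1) * M"
  have s: "s \<le> 2 * real Q * M" using Suc.prems M unfolding s_def by (intro mult_right_mono) auto
  have s0: "0 \<le> s" using M by (simp add: s_def)
  \<comment> \<open>Since \<open>s \<le> 2 * Q * M \<le> p\<close>, the quadratic term is at most
    \<open>p * s\<close>; hence \<open>5 * p * s\<close>, which is the constant 10.\<close>
  have "s\<^sup>2 + 4 * p * s \<le> p * s + 4 * p * s"
    using s Q s0 by (auto simp: power2_eq_square intro: mult_right_mono)
  also have "\<dots> \<le> 10 * real Q * M * p" using mult_left_mono[OF s, of "5 * p"] p by simp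
  finally have c: "s\<^sup>2 + 4 * p * s \<le> 10 * real Q * M * p" .
  have "bern p E (\<lambda>W. op_trace E (frame_op p W ^^ (2 * Suc m)))
    \<le> (s\<^sup>2 + 4 * p * s) * bern p E (\<lambda>W. op_trace E (frame_op p W ^^ (2 * m)))"
    by (rule trace_moment_step[OF p s_def])
  also have "\<dots> \<le> (10 * real Q * M * p) * ((10 * real Q * M * p) ^ m * real (card E))"
    using Suc c s0 p M by (intro mult_mono bern_nonneg op_trace_nonneg) auto
  finally show ?case by (simp only: power_Suc mult.assoc)
qed

text \<open>The trace dominates the quadratic forms of all \<open>f\<close> simultaneously, so no
  union over \<open>f\<close> is taken. Markov's inequality for the power \<open>2 * Q\<close>
  leaves \<open>10 * Q * M / (\<epsilon>\<^sup>2 * p)\<close> to the power \<open>Q\<close>, and the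
  hypothesis makes this base at most \<open>exp (- 1)\<close>.\<close>

theorem frame_op_tail:
  assumes p: "0 < p" "p \<le> 1" and \<epsilon>: "0 < \<epsilon>" "\<epsilon> \<le> 1" and Q: "0 < Q" "10 * exp 1 * real Q * M \<le> \<epsilon>\<^sup>2 * p"
  shows "bern p E (\<lambda>W. of_bool (\<exists>f. \<bar>ip E f (frame_op p W f)\<bar> > \<epsilon> * p * ip E f f)) \<le> exp (- real Q) * real (card E)"
proof -
  have e1: "2 \<le> exp (1 :: real)" using exp_ge_add_one_self[of 1] by simp
  have \<epsilon>2: "\<epsilon>\<^sup>2 \<le> 1" using \<epsilon> by (simp add: power_le_one)
  have "2 * real Q * M \<le> 10 * exp 1 * real Q * M"
    using e1 M by (intro mult_right_mono) auto
  also have "\<dots> \<le> p" using Q(2) mult_right_mono[OF \<epsilon>2, of p] p by linarith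
  finally have Q2: "2 * real Q * M \<le> p" .
  have pos: "0 < (\<epsilon> * p) ^ (2 * Q)" using p \<epsilon> by simp
  have big: "(\<epsilon> * p) ^ (2 * Q) \<le> op_trace E (frame_op p W ^^ (2 * Q))"
    if ex: "\<exists>f. \<bar>ip E f (frame_op p W f)\<bar> > \<epsilon> * p * ip E f f" for W
  proof -
    obtain f where f: "\<bar>ip E f (frame_op p W f)\<bar> > \<epsilon> * p * ip E f f" using ex by auto
    have f0: "ip E f f \<noteq> 0"
    proof
      assume "ip E f f = 0"
      then have "(ip E f (frame_op p W f))\<^sup>2 \<le> 0" using ip_Cauchy_Schwarz[of E f "frame_op p W f"] by simp
      then show False using f \<open>ip E f f = 0\<close> by simp
    qed
    have "(ip E f f) ^ (2 * Q) * (\<epsilon> * p) ^ (2 * Q) = (\<epsilon> * p * ip E f f) ^ (2 * Q)"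
      by (simp add: power_mult_distrib)
    also have "\<dots> \<le> \<bar>ip E f (frame_op p W f)\<bar> ^ (2 * Q)"
      using f p \<epsilon> by (intro power_mono) auto
    also have "\<dots> \<le> (ip E f f) ^ (2 * Q) * op_trace E (frame_op p W ^^ (2 * Q))"
      by (rule self_adjoint_quadratic_bound[OF self_adjoint_frame_op fin Q(1)])
    finally show ?thesis using f0 by (simp add: power_mult mult_le_cancel_left)
  qed
  have "bern p E (\<lambda>W. of_bool (\<exists>f. \<bar>ip E f (frame_op p W f)\<bar> > \<epsilon> * p * ip E f f))
     \<le> bern p E (\<lambda>W. op_trace E (frame_op p W ^^ (2 * Q))) / (\<epsilon> * p) ^ (2 * Q)"
    using p by (intro bern_Markov pos big op_trace_nonneg) auto
  also have "\<dots> \<le> (10 * real Q * M * p) ^ Q * real (card E) / (\<epsilon> * p) ^ (2 * Q)"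
    using p Q2 pos by (intro divide_right_mono trace_moment_bound) auto
  also have "\<dots> = (10 * real Q * M / (\<epsilon>\<^sup>2 * p)) ^ Q * real (card E)"
    using p \<epsilon> by (simp add: power_mult power_divide power_mult_distrib divide_simps power2_eq_square)
  also have "\<dots> \<le> (exp (- 1)) ^ Q * real (card E)"
    using Q p \<epsilon> M by (intro mult_right_mono power_mono) (auto simp: exp_minus divide_simps mult_ac)
  also have "(exp (- 1 :: real)) ^ Q = exp (- real Q)" by (simp add: exp_of_nat_mult[symmetric])
  finally show ?thesis .
qed

end

section \<open>Discrepancy of a random bipartite graph\<close>

definition set_entropy :: "nat \<Rightarrow> nat \<Rightarrow> real" where
  "set_entropy n s = real s * (1 + ln (real n / real s))"

text \<open>One term of the binomial expansion of \<open>(1 + s / n) ^ n\<close>, which is at most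
  \<open>exp s\<close>.\<close>

lemma binomial_le_exp_entropy:
  assumes "1 \<le> s" "s \<le> n"
  shows "real (n choose s) \<le> exp (set_entropy n s)"
proof -
  have n: "0 < real n" "0 < real s" using assms by auto
  have "real (n choose s) * (real s / real n) ^ s \<le> (\<Sum>k\<le>n. real (n choose k) * (real s / real n) ^ k * 1 ^ (n - k))"
    using assms member_le_sum[of s "{..n}" "\<lambda>k. real (n choose k) * (real s / real n) ^ k * 1 ^ (n - k)"] by simp
  also have "\<dots> = (real s / real n + 1) ^ n" by (rule binomial_ring[symmetric])
  also have "\<dots> \<le> exp (real s / real n) ^ n"
    using exp_ge_add_one_self[of "real s / real n"] by (intro power_mono) (auto simp: add.commute)
  also have "\<dots> = exp (real s)" using n by (simp add: exp_of_nat_mult[symmetric])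
  finally have 1: "real (n choose s) * (real s / real n) ^ s \<le> exp (real s)" .
  have "exp (set_entropy n s) = exp (real s) * (real n / real s) ^ s"
    using n by (simp add: set_entropy_def distrib_left exp_add exp_of_nat_mult)
  moreover have "real (n choose s) = real (n choose s) * (real s / real n) ^ s * (real n / real s) ^ s"
    using n by (simp add: power_divide)
  moreover have "real (n choose s) * (real s / real n) ^ s * (real n / real s) ^ s \<le> exp (real s) * (real n / real s) ^ s"
    using 1 by (rule mult_right_mono) simp
  ultimately show ?thesis by linarith
qed

lemma set_entropy_mono:
  assumes "1 \<le> s" "s \<le> t" "t \<le> n"
  shows "set_entropy n s \<le> set_entropy n t"
proof -
  have p: "0 < real s" "0 < real t" "0 < real n" "real s \<le> real t" "real t \<le> real n" using assms by auto
  have "ln (real t / real s) \<le> real t / real s - 1" using p by (intro ln_le_minus_one) auto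
  then have "real s * ln (real t / real s) \<le> real s * (real t / real s - 1)" using p by (intro mult_left_mono) auto
  also have "\<dots> = real t - real s" using p by (simp add: field_simps)
  finally have 1: "real s * (ln (real t) - ln (real s)) \<le> real t - real s" using p by (simp add: ln_div)
  have 2: "0 \<le> (real t - real s) * (ln (real n) - ln (real t))" using p by (intro mult_nonneg_nonneg) auto
  show ?thesis using 1 2 p by (simp add: set_entropy_def ln_div algebra_simps)
qed

lemma set_entropy_ge:
  assumes "1 \<le> s" "s \<le> n"
  shows "1 + ln (real n) \<le> set_entropy n s"
  using set_entropy_mono[of 1 s n] assms by (simp add: set_entropy_def)

text \<open>For sets of sizes \<open>x \<ge> y\<close> this is applied with \<open>R = n / x\<close> and \<open>\<rho> = d y / x\<close>, where \<open>d = n p\<close>; both sides are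
  divided by \<open>x\<close>. The exponential parameter is \<open>max 1 (ln (R / sqrt \<rho>))\<close>.\<close>

lemma Chernoff_exponent:
  fixes R \<rho> :: real
  assumes R: "1 \<le> R" and \<rho>: "1 \<le> \<rho>"
  shows "\<exists>l\<ge>0. \<rho> / R * (exp l - 1) - l * (40 * (\<rho> / R + sqrt \<rho>)) \<le> - (12 * (1 + ln R))"
proof -
  define u where "u = sqrt \<rho>"
  have u: "1 \<le> u" "\<rho> = u * u" using \<rho> by (auto simp: u_def)
  have e: "2 \<le> exp (1 :: real)" "exp 1 \<le> (3 :: real)" using exp_ge_add_one_self[of 1] exp_le by auto
  show ?thesis
  proof (cases "R \<le> exp 1 * u")
    case True
    have "1 + ln R \<le> R" using ln_le_minus_one[of R] R by simp
    also have "R \<le> 3 * u" using True mult_right_mono[OF e(2), of u] u(1) by linarith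
    finally have a: "1 + ln R \<le> 3 * u" .
    have "\<rho> / R * (exp 1 - 1) \<le> \<rho> / R * 40" using e \<rho> R by (intro mult_left_mono) auto
    then have "\<rho> / R * (exp 1 - 1) - 1 * (40 * (\<rho> / R + sqrt \<rho>)) \<le> - (12 * (1 + ln R))"
      using a u unfolding u_def[symmetric] by (simp add: algebra_simps)
    then show ?thesis by (intro exI[of _ 1]) simp
  next
    case False
    define l where "l = ln (R / u)"
    have el: "exp l = R / u" using R u by (simp add: l_def)
    have l1: "1 \<le> l" using False u R by (simp add: l_def ln_ge_iff pos_le_divide_eq)
    have lnR: "ln R = l + ln u" using R u by (simp add: l_def ln_div)
    have "ln u \<le> u - 1" using u by (intro ln_le_minus_one) simp
    then have a: "1 + ln R \<le> l + u" using lnR by simp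
    have b: "l \<le> l * u" "u \<le> l * u" using l1 u by auto
    have c: "\<rho> / R * exp l = u" using el u R by simp
    have "0 \<le> \<rho> / R" "0 \<le> l * (40 * (\<rho> / R))" using \<rho> R l1 by auto
    then have "\<rho> / R * (exp l - 1) - l * (40 * (\<rho> / R + sqrt \<rho>)) \<le> u - 40 * (l * u)"
      unfolding u_def[symmetric] right_diff_distrib c by (simp add: algebra_simps)
    also have "\<dots> \<le> - 12 - 12 * ln R" using a b u(1) by linarith
    also have "\<dots> = - (12 * (1 + ln R))" by simp
    finally show ?thesis using l1 by (intro exI[of _ l]) simp
  qed
qed

text \<open>The upper half of an expander mixing inequality, up to the constant 40:
  \<open>p |S| |T|\<close> is the expected number of edges, and the square root is the error that a
  spectral gap of order the square root of the degree would give.\<close>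

definition low_discrepancy :: "nat \<Rightarrow> nat \<Rightarrow> real \<Rightarrow> (nat \<times> nat) set \<Rightarrow> bool" where
  "low_discrepancy n1 n2 p W \<longleftrightarrow> (\<forall>S T. S \<subseteq> {..<n1} \<longrightarrow> T \<subseteq> {..<n2} \<longrightarrow>
     real (card (W \<inter> S \<times> T)) \<le> 40 * (p * real (card S) * real (card T)
       + sqrt (real (max n1 n2) * p * real (card S) * real (card T))))"

locale random_bipartite =
  fixes n1 n2 n :: nat and p d :: real
  assumes n: "n = max n1 n2" and n1: "1 \<le> n1" "1 \<le> n2" and p: "0 < p" "p \<le> 1" and d: "d = real n * p"
begin

abbreviation "grid \<equiv> {..<n1} \<times> {..<n2}"

text \<open>The size restriction is \<open>1 \<le> \<rho>\<close> in
  \<open>Chernoff_exponent\<close>; more unbalanced pairs are left to the degree bounds. The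
  exponent is twelve entropies of the larger size, and by monotonicity it splits into six for each
  set. The product form lets the later union bound factor.\<close>

lemma pair_tail:
  assumes S: "S \<subseteq> {..<n1}" "S \<noteq> {}" and T: "T \<subseteq> {..<n2}" "T \<noteq> {}"
    and big: "real (max (card S) (card T)) \<le> d * real (min (card S) (card T))"
  shows "bern p grid (\<lambda>W. of_bool (40 * (p * real (card S) * real (card T) + sqrt (d * real (card S) * real (card T)))
     \<le> real (card (W \<inter> S \<times> T)))) \<le> exp (- 6 * set_entropy n (card S)) * exp (- 6 * set_entropy n (card T))"
proof -
  define x where "x = max (card S) (card T)"
  define y where "y = min (card S) (card T)"
  have "finite S" "finite T" using S T finite_subset by auto
  then have c: "1 \<le> card S" "1 \<le> card T" using S T by (auto simp: Suc_le_eq card_gt_0_iff)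
  have c': "card S \<le> n1" "card T \<le> n2" using card_mono[OF _ S(1)] card_mono[OF _ T(1)] by auto
  have x: "1 \<le> x" "x \<le> n" "1 \<le> y" and xS: "card S \<le> x" "card T \<le> x" using c c' n by (auto simp: x_def y_def)
  have st: "real (card S) * real (card T) = real x * real y" by (auto simp: x_def y_def max_def min_def)
  define R where "R = real n / real x"
  define \<rho> where "\<rho> = d * real y / real x"
  have R: "1 \<le> R" using x by (simp add: R_def)
  have \<rho>: "1 \<le> \<rho>" using big x by (simp add: \<rho>_def x_def y_def)
  have d0: "0 \<le> d" using p d by simp
  obtain l where l: "0 \<le> l" "\<rho> / R * (exp l - 1) - l * (40 * (\<rho> / R + sqrt \<rho>)) \<le> - (12 * (1 + ln R))"
    using Chernoff_exponent[OF R \<rho>] by auto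
  have e1: "p * real (card S) * real (card T) = real x * (\<rho> / R)"
    unfolding mult.assoc st using x n n1 by (simp add: \<rho>_def R_def d)
  have "d * real (card S) * real (card T) = (real x)\<^sup>2 * \<rho>"
    unfolding mult.assoc st using x by (simp add: \<rho>_def power2_eq_square)
  then have e2: "sqrt (d * real (card S) * real (card T)) = real x * sqrt \<rho>" by (simp add: real_sqrt_mult)
  have "bern p grid (\<lambda>W. of_bool (40 * (p * real (card S) * real (card T) + sqrt (d * real (card S) * real (card T)))
     \<le> real (card (W \<inter> S \<times> T))))
    \<le> exp (p * real (card (S \<times> T)) * (exp l - 1) - l * (40 * (p * real (card S) * real (card T) + sqrt (d * real (card S) * real (card T)))))"
    using S T p l by (intro bern_Chernoff) auto
  also have "p * real (card (S \<times> T)) = real x * (\<rho> / R)" using e1 by (simp add: card_cartesian_product mult.assoc)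
  also have "real x * (\<rho> / R) * (exp l - 1) - l * (40 * (p * real (card S) * real (card T) + sqrt (d * real (card S) * real (card T))))
     = real x * (\<rho> / R * (exp l - 1) - l * (40 * (\<rho> / R + sqrt \<rho>)))"
    unfolding e1 e2 by (simp only: right_diff_distrib left_diff_distrib distrib_left distrib_right mult_ac)
  also have "exp \<dots> \<le> exp (real x * (- (12 * (1 + ln R))))" using l(2) by (intro iffD2[OF exp_le_cancel_iff] mult_left_mono) auto
  also have "real x * (- (12 * (1 + ln R))) = - 12 * set_entropy n x" by (simp add: set_entropy_def R_def algebra_simps)
  also have "exp (- 12 * set_entropy n x) \<le> exp (- 6 * set_entropy n (card S) + - 6 * set_entropy n (card T))"
    using set_entropy_mono[OF c(1) xS(1) x(2)] set_entropy_mono[OF c(2) xS(2) x(2)] by simp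
  also have "\<dots> = exp (- 6 * set_entropy n (card S)) * exp (- 6 * set_entropy n (card T))" by (rule exp_add)
  finally show ?thesis .
qed

text \<open>Of the six entropies one pays for the number of sets of a given size. The other five
  give \<open>n\<close> to the power -5, and there are at most \<open>n\<close> sizes.\<close>

lemma sum_exp_entropy:
  assumes "m \<le> n"
  shows "(\<Sum>S\<in>Pow {..<m} - {{}}. exp (- 6 * set_entropy n (card S))) \<le> 1 / real n ^ 4"
proof -
  have n0: "0 < real n" using n n1 by simp
  have "(\<Sum>S\<in>Pow {..<m} - {{}}. exp (- 6 * set_entropy n (card S)))
    = (\<Sum>s\<in>{1..m}. \<Sum>S\<in>{S \<in> Pow {..<m} - {{}}. card S = s}. exp (- 6 * set_entropy n (card S)))"
  proof (rule sum.group[symmetric])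
    show "card ` (Pow {..<m} - {{}}) \<subseteq> {1..m}"
    proof
      fix s assume "s \<in> card ` (Pow {..<m} - {{}})"
      then obtain S where S: "S \<subseteq> {..<m}" "S \<noteq> {}" "s = card S" by auto
      then have "finite S" "card S \<le> m" using card_mono[OF _ S(1)] finite_subset by auto
      then show "s \<in> {1..m}" using S by (auto simp: Suc_le_eq card_gt_0_iff)
    qed
  qed auto
  also have "\<dots> \<le> (\<Sum>s\<in>{1..m}. exp (- 5 * (1 + ln (real n))))"
  proof (rule sum_mono)
    fix s assume s: "s \<in> {1..m}"
    have "{S \<in> Pow {..<m} - {{}}. card S = s} = {S. S \<subseteq> {..<m} \<and> card S = s}" using s by auto
    then have "(\<Sum>S\<in>{S \<in> Pow {..<m} - {{}}. card S = s}. exp (- 6 * set_entropy n (card S)))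
      = real (m choose s) * exp (- 6 * set_entropy n s)" by (simp add: n_subsets)
    also have "\<dots> \<le> exp (set_entropy n s) * exp (- 6 * set_entropy n s)"
    proof (rule mult_right_mono)
      have "m choose s \<le> n choose s" using assms by (rule binomial_right_mono)
      then show "real (m choose s) \<le> exp (set_entropy n s)"
        using binomial_le_exp_entropy[of s n] s assms by simp
    qed simp
    also have "\<dots> = exp (- 5 * set_entropy n s)" by (simp add: exp_add[symmetric])
    also have "\<dots> \<le> exp (- 5 * (1 + ln (real n)))" using set_entropy_ge[of s n] s assms by simp
    finally show "(\<Sum>S\<in>{S \<in> Pow {..<m} - {{}}. card S = s}. exp (- 6 * set_entropy n (card S))) \<le> exp (- 5 * (1 + ln (real n)))" .
  qed
  also have "\<dots> \<le> real n * exp (- (5 * ln (real n)))" using assms by (simp add: mult_mono)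
  also have "\<dots> = real n * inverse (real n ^ 5)" using n0 by (simp add: exp_minus exp_of_nat_mult[of 5, simplified])
  also have "\<dots> = 1 / real n ^ 4" using n0 by (simp add: field_simps power_numeral_reduce)
  finally show ?thesis .
qed

lemma degree_tail:
  assumes F: "F \<subseteq> grid" "card F \<le> n" and dn: "2 * ln (real n) \<le> d"
  shows "bern p grid (\<lambda>W. of_bool (8 * d \<le> real (card (W \<inter> F)))) \<le> 1 / real n ^ 12"
proof -
  have n0: "0 < real n" using n n1 by simp
  have "bern p grid (\<lambda>W. of_bool (8 * d \<le> real (card (W \<inter> F)))) \<le> exp (p * real (card F) * (exp 1 - 1) - 1 * (8 * d))"
    using F p by (intro bern_Chernoff) auto
  \<comment> \<open>The exponent is at most \<open>2 * d - 8 * d = - 6 * d\<close>, because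
    \<open>exp 1 - 1 \<le> 2\<close> and the mean is at most \<open>d\<close>.\<close>
  also have "\<dots> \<le> exp (- (12 * ln (real n)))"
  proof -
    have "p * real (card F) * (exp 1 - 1) \<le> d * 2"
      using F p exp_le exp_ge_add_one_self[of "1::real"] by (intro mult_mono) (auto simp: d mult.commute mult_left_mono)
    then show ?thesis using dn by simp
  qed
  also have "\<dots> = 1 / real n ^ 12" using n0 by (simp add: exp_minus exp_of_nat_mult[of 12, simplified] divide_inverse)
  finally show ?thesis .
qed

text \<open>If one set is larger than the other by a factor of at least \<open>d\<close>, adding up
  the degrees over the smaller set already suffices: with \<open>a\<close> the smaller and
  \<open>b\<close> the larger size, \<open>d * a \<le> b\<close> makes \<open>d * a\<close> at most
  \<open>sqrt (d * a * b)\<close>. Only the comparable sizes need the bound on pairs.\<close>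

lemma low_discrepancyI:
  assumes W: "W \<subseteq> grid"
    and rows: "\<And>i. i < n1 \<Longrightarrow> real (card (W \<inter> {i} \<times> {..<n2})) < 8 * d"
    and cols: "\<And>j. j < n2 \<Longrightarrow> real (card (W \<inter> {..<n1} \<times> {j})) < 8 * d"
    and pairs: "\<And>S T. S \<subseteq> {..<n1} \<Longrightarrow> T \<subseteq> {..<n2} \<Longrightarrow> S \<noteq> {} \<Longrightarrow> T \<noteq> {} \<Longrightarrow>
       real (max (card S) (card T)) \<le> d * real (min (card S) (card T)) \<Longrightarrow>
       real (card (W \<inter> S \<times> T)) < 40 * (p * real (card S) * real (card T) + sqrt (d * real (card S) * real (card T)))"
  shows "low_discrepancy n1 n2 p W"
  unfolding low_discrepancy_def n[symmetric] d[symmetric]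
proof (intro allI impI)
  fix S T assume S: "S \<subseteq> {..<n1}" and T: "T \<subseteq> {..<n2}"
  have fin: "finite W" "finite S" "finite T" using W S T finite_subset by (blast, auto intro: finite_subset)
  define s where "s = real (card S)"
  define t where "t = real (card T)"
  have st0: "0 \<le> s" "0 \<le> t" "0 < d" using p n n1 by (auto simp: s_def t_def d)
  have sq: "8 * (d * a) \<le> 40 * (p * s * t + sqrt (d * s * t))" if "a * b = s * t" "d * a \<le> b" "0 \<le> a" for a b
  proof -
    have "d * a = sqrt ((d * a) * (d * a))" using that st0 by simp
    also have "\<dots> \<le> sqrt ((d * a) * b)" using that st0 by (intro real_sqrt_le_mono mult_left_mono) auto
    also have "(d * a) * b = d * s * t" using that by (simp add: mult.assoc)
    finally have "d * a \<le> sqrt (d * s * t)" .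
    moreover have "0 \<le> p * s * t" "0 \<le> sqrt (d * s * t)" using st0 p by auto
    ultimately show ?thesis by argo
  qed
  have rowsum: "real (card (W \<inter> S \<times> T)) \<le> 8 * (d * s)"
  proof -
    have "W \<inter> S \<times> T \<subseteq> (\<Union>i\<in>S. W \<inter> {i} \<times> {..<n2})" using T by auto
    then have "card (W \<inter> S \<times> T) \<le> card (\<Union>i\<in>S. W \<inter> {i} \<times> {..<n2})" using fin by (intro card_mono) auto
    also have "\<dots> \<le> (\<Sum>i\<in>S. card (W \<inter> {i} \<times> {..<n2}))" using fin by (intro card_UN_le)
    finally have "real (card (W \<inter> S \<times> T)) \<le> (\<Sum>i\<in>S. real (card (W \<inter> {i} \<times> {..<n2})))"
      by (metis of_nat_le_iff of_nat_sum)
    also have "\<dots> \<le> (\<Sum>i\<in>S. 8 * d)" using S by (intro sum_mono less_imp_le rows) auto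
    finally show ?thesis by (simp add: s_def mult_ac)
  qed
  have colsum: "real (card (W \<inter> S \<times> T)) \<le> 8 * (d * t)"
  proof -
    have "W \<inter> S \<times> T \<subseteq> (\<Union>j\<in>T. W \<inter> {..<n1} \<times> {j})" using S by auto
    then have "card (W \<inter> S \<times> T) \<le> card (\<Union>j\<in>T. W \<inter> {..<n1} \<times> {j})" using fin by (intro card_mono) auto
    also have "\<dots> \<le> (\<Sum>j\<in>T. card (W \<inter> {..<n1} \<times> {j}))" using fin by (intro card_UN_le)
    finally have "real (card (W \<inter> S \<times> T)) \<le> (\<Sum>j\<in>T. real (card (W \<inter> {..<n1} \<times> {j})))"
      by (metis of_nat_le_iff of_nat_sum)
    also have "\<dots> \<le> (\<Sum>j\<in>T. 8 * d)" using T by (intro sum_mono less_imp_le cols) auto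
    finally show ?thesis by (simp add: t_def mult_ac)
  qed
  have "real (card (W \<inter> S \<times> T)) \<le> 40 * (p * s * t + sqrt (d * s * t))"
  proof (cases "S = {} \<or> T = {}")
    case True
    then show ?thesis by (auto simp: s_def t_def)
  next
    case ne: False
    consider "d * s \<le> t" | "d * t \<le> s" | "t < d * s" "s < d * t" by linarith
    then show ?thesis
    proof cases
      case 1
      then show ?thesis using rowsum sq[of s t] st0 by simp
    next
      case 2
      then show ?thesis using colsum sq[of t s] st0 by (simp add: mult.commute)
    next
      case 3
      then have "real (max (card S) (card T)) \<le> d * real (min (card S) (card T))"
        by (auto simp: s_def t_def max_def min_def)
      then show ?thesis using pairs[OF S T] ne by (simp add: s_def t_def less_imp_le)
    qed
  qed
  then show "real (card (W \<inter> S \<times> T)) \<le> 40 * (p * real (card S) * real (card T) + sqrt (d * real (card S) * real (card T)))"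
    by (simp only: s_def t_def)
qed

lemma bern_Bex_le:
  assumes "finite A"
  shows "bern p grid (\<lambda>W. of_bool (\<exists>a\<in>A. Q a W)) \<le> (\<Sum>a\<in>A. bern p grid (\<lambda>W. of_bool (Q a W)))"
  unfolding bern_sum[symmetric]
proof (rule bern_mono)
  fix W
  show "of_bool (\<exists>a\<in>A. Q a W) \<le> (\<Sum>a\<in>A. of_bool (Q a W) :: real)"
  proof (cases "\<exists>a\<in>A. Q a W")
    case True
    then obtain a where "a \<in> A" "Q a W" by auto
    then show ?thesis using member_le_sum[of a A "\<lambda>a. of_bool (Q a W) :: real"] assms by auto
  qed (simp add: sum_nonneg)
qed (use p in auto)

theorem low_discrepancy_tail:
  assumes dn: "2 * ln (real n) \<le> d"
  shows "bern p grid (\<lambda>W. of_bool (\<not> low_discrepancy n1 n2 p W)) \<le> 3 / real n ^ 8"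
proof -
  have n0: "1 \<le> real n" using n n1 by simp
  define row where "row i W \<longleftrightarrow> 8 * d \<le> real (card (W \<inter> {i} \<times> {..<n2}))" for i and W :: "(nat \<times> nat) set"
  define col where "col j W \<longleftrightarrow> 8 * d \<le> real (card (W \<inter> {..<n1} \<times> {j}))" for j and W :: "(nat \<times> nat) set"
  define bad where "bad ST W \<longleftrightarrow> (case ST of (S, T) \<Rightarrow>
     40 * (p * real (card S) * real (card T) + sqrt (d * real (card S) * real (card T))) \<le> real (card (W \<inter> S \<times> T)))" for ST and W :: "(nat \<times> nat) set"
  define A where "A = {(S, T). (S, T) \<in> (Pow {..<n1} - {{}}) \<times> (Pow {..<n2} - {{}}) \<and>
     real (max (card S) (card T)) \<le> d * real (min (card S) (card T))}"
  have finA: "finite A" by (rule finite_subset[of _ "(Pow {..<n1} - {{}}) \<times> (Pow {..<n2} - {{}})"]) (auto simp: A_def)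
  have p': "0 \<le> p" "p \<le> 1" using p by auto
  have "bern p grid (\<lambda>W. of_bool (\<not> low_discrepancy n1 n2 p W))
     \<le> bern p grid (\<lambda>W. of_bool (\<exists>i\<in>{..<n1}. row i W) + (of_bool (\<exists>j\<in>{..<n2}. col j W) + of_bool (\<exists>ST\<in>A. bad ST W)))"
  proof (rule bern_mono[OF p'])
    fix W assume W: "W \<subseteq> grid"
    have "low_discrepancy n1 n2 p W"
      if "\<not> (\<exists>i\<in>{..<n1}. row i W)" "\<not> (\<exists>j\<in>{..<n2}. col j W)" "\<not> (\<exists>ST\<in>A. bad ST W)"
    proof (rule low_discrepancyI[OF W])
      fix i assume "i < n1" then show "real (card (W \<inter> {i} \<times> {..<n2})) < 8 * d" using that(1) by (auto simp: row_def not_le)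
    next
      fix j assume "j < n2" then show "real (card (W \<inter> {..<n1} \<times> {j})) < 8 * d" using that(2) by (auto simp: col_def not_le)
    next
      fix S T assume "S \<subseteq> {..<n1}" "T \<subseteq> {..<n2}" "S \<noteq> {}" "T \<noteq> {}"
        "real (max (card S) (card T)) \<le> d * real (min (card S) (card T))"
      then have "(S, T) \<in> A" by (auto simp: A_def)
      then have "\<not> bad (S, T) W" using that(3) by blast
      then show "real (card (W \<inter> S \<times> T)) < 40 * (p * real (card S) * real (card T) + sqrt (d * real (card S) * real (card T)))"
        by (simp add: bad_def)
    qed
    then show "of_bool (\<not> low_discrepancy n1 n2 p W) \<le> (of_bool (\<exists>i\<in>{..<n1}. row i W) + (of_bool (\<exists>j\<in>{..<n2}. col j W) + of_bool (\<exists>ST\<in>A. bad ST W)) :: real)"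
      by (auto simp: of_bool_def)
  qed
  also have "\<dots> \<le> (\<Sum>i<n1. 1 / real n ^ 12) + ((\<Sum>j<n2. 1 / real n ^ 12) + 1 / real n ^ 4 * (1 / real n ^ 4))"
    unfolding bern_add
  proof (intro add_mono)
    have "bern p grid (\<lambda>W. of_bool (row i W)) \<le> 1 / real n ^ 12" if "i < n1" for i
      unfolding row_def using that n by (intro degree_tail dn) (auto simp: card_cartesian_product)
    then show "bern p grid (\<lambda>W. of_bool (\<exists>i\<in>{..<n1}. row i W)) \<le> (\<Sum>i<n1. 1 / real n ^ 12)"
      by (intro order_trans[OF bern_Bex_le] sum_mono) auto
    have "bern p grid (\<lambda>W. of_bool (col j W)) \<le> 1 / real n ^ 12" if "j < n2" for j
      unfolding col_def using that n by (intro degree_tail dn) (auto simp: card_cartesian_product)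
    then show "bern p grid (\<lambda>W. of_bool (\<exists>j\<in>{..<n2}. col j W)) \<le> (\<Sum>j<n2. 1 / real n ^ 12)"
      by (intro order_trans[OF bern_Bex_le] sum_mono) auto
    let ?w = "\<lambda>S. exp (- 6 * set_entropy n (card S))"
    have "bern p grid (\<lambda>W. of_bool (\<exists>ST\<in>A. bad ST W)) \<le> (\<Sum>ST\<in>A. bern p grid (\<lambda>W. of_bool (bad ST W)))"
      by (rule bern_Bex_le[OF finA])
    also have "\<dots> \<le> (\<Sum>(S, T)\<in>A. ?w S * ?w T)"
    proof (rule sum_mono)
      fix ST assume ST: "ST \<in> A"
      obtain S T where "ST = (S, T)" by (cases ST)
      then show "bern p grid (\<lambda>W. of_bool (bad ST W)) \<le> (case ST of (S, T) \<Rightarrow> ?w S * ?w T)"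
        using ST pair_tail[of S T] by (simp add: A_def bad_def)
    qed
    \<comment> \<open>The size restriction is dropped so that the sum becomes a product of two
      sums.\<close>
    also have "\<dots> \<le> (\<Sum>(S, T)\<in>(Pow {..<n1} - {{}}) \<times> (Pow {..<n2} - {{}}). ?w S * ?w T)"
      by (intro sum_mono2) (auto simp: A_def)
    also have "\<dots> = (\<Sum>S\<in>Pow {..<n1} - {{}}. ?w S) * (\<Sum>T\<in>Pow {..<n2} - {{}}. ?w T)"
      by (simp add: sum_product sum.cartesian_product)
    also have "\<dots> \<le> 1 / real n ^ 4 * (1 / real n ^ 4)"
      using n by (intro mult_mono sum_exp_entropy) (auto intro: sum_nonneg)
    finally show "bern p grid (\<lambda>W. of_bool (\<exists>ST\<in>A. bad ST W)) \<le> 1 / real n ^ 4 * (1 / real n ^ 4)" .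
  qed
  also have "\<dots> \<le> 3 / real n ^ 8"
  proof -
    have "real k * (1 / real n ^ 12) \<le> 1 / real n ^ 8" if "k \<le> n" for k
    proof -
      have "real k * real n ^ 8 \<le> real n ^ 4 * real n ^ 8"
        using that n0 self_le_power[of "real n" 4] by (intro mult_right_mono) auto
      then show ?thesis using n0 by (simp add: field_simps flip: power_add)
    qed
    then have "real n1 * (1 / real n ^ 12) \<le> 1 / real n ^ 8" "real n2 * (1 / real n ^ 12) \<le> 1 / real n ^ 8"
      using n by auto
    moreover have "1 / real n ^ 4 * (1 / real n ^ 4) = 1 / real n ^ 8" by (simp flip: power_add)
    ultimately show ?thesis by (simp del: times_divide_eq_right)
  qed
  finally show ?thesis .
qed

end

section \<open>Bilinear sums over a sample of low discrepancy\<close>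

text \<open>Subtracting the least nonzero value from the whole support removes a point from the
  support and lowers the upper bound by that value. Hence the coefficients add up to at most the
  bound, however many layers there are.\<close>

lemma layer_decomposition:
  fixes x :: "'a \<Rightarrow> real"
  assumes "finite I" and "\<And>i. i \<in> I \<Longrightarrow> 0 \<le> x i" and "\<And>i. i \<in> I \<Longrightarrow> x i \<le> b" and "0 \<le> b"
  shows "\<exists>k c S. (\<forall>l<k. 0 \<le> c l \<and> S l \<subseteq> I) \<and> (\<forall>i\<in>I. x i = (\<Sum>l<(k::nat). c l * of_bool (i \<in> S l)))
     \<and> (\<Sum>l<k. c l) \<le> b"
  using assms(2-4)
proof (induction "card {i \<in> I. x i \<noteq> 0}" arbitrary: x b rule: less_induct)
  case less
  define A where "A = {i \<in> I. x i \<noteq> 0}"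
  have A: "finite A" "A \<subseteq> I" using assms(1) by (auto simp: A_def)
  show ?case
  proof (cases "A = {}")
    case True
    then show ?thesis using less.prems by (intro exI[of _ "0::nat"]) (auto simp: A_def)
  next
    case False
    define c0 where "c0 = Min (x ` A)"
    have "c0 \<in> x ` A" unfolding c0_def using A False by (intro Min_in) auto
    then obtain i0 where i0: "i0 \<in> A" "x i0 = c0" by auto
    have c0: "c0 \<le> x i" if "i \<in> A" for i unfolding c0_def using that A by (intro Min_le) auto
    have c0pos: "0 \<le> c0" "c0 \<le> b" using i0 less.prems(1,2)[of i0] by (auto simp: A_def)
    define y where "y i = x i - c0 * of_bool (i \<in> A)" for i
    have sub: "{i \<in> I. y i \<noteq> 0} \<subset> A"
      using i0 by (auto simp: y_def A_def)
    have "\<exists>k c S. (\<forall>l<k. 0 \<le> c l \<and> S l \<subseteq> I) \<and> (\<forall>i\<in>I. y i = (\<Sum>l<(k::nat). c l * of_bool (i \<in> S l)))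
       \<and> (\<Sum>l<k. c l) \<le> b - c0"
    proof (rule less.hyps)
      show "card {i \<in> I. y i \<noteq> 0} < card {i \<in> I. x i \<noteq> 0}"
        using psubset_card_mono[OF A(1) sub] by (simp add: A_def)
      fix i assume i: "i \<in> I"
      show "0 \<le> y i" using c0[of i] less.prems(1)[OF i] by (simp add: y_def of_bool_def)
      show "y i \<le> b - c0"
      proof (cases "i \<in> A")
        case True then show ?thesis using less.prems(2)[OF i] by (simp add: y_def)
      next
        case False then show ?thesis using i c0pos by (simp add: y_def A_def)
      qed
    qed (use c0pos in simp)
    then obtain k c S where *: "\<forall>l<k. 0 \<le> c l \<and> S l \<subseteq> I" "\<forall>i\<in>I. y i = (\<Sum>l<(k::nat). c l * of_bool (i \<in> S l))"
       "(\<Sum>l<k. c l) \<le> b - c0" by blast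
    show ?thesis
    proof (intro exI conjI allI ballI impI)
      fix l assume "l < Suc k"
      then show "0 \<le> (c(k := c0)) l" "(S(k := A)) l \<subseteq> I" using * c0pos A by (auto simp: less_Suc_eq)
    next
      fix i assume i: "i \<in> I"
      have "x i = y i + c0 * of_bool (i \<in> A)" by (simp add: y_def)
      then show "x i = (\<Sum>l<Suc k. (c(k := c0)) l * of_bool (i \<in> (S(k := A)) l))"
        using *(2) i by simp
    next
      show "(\<Sum>l<Suc k. (c(k := c0)) l) \<le> b" using *(3) by simp
    qed
  qed
qed

text \<open>Cauchy-Schwarz with weights \<open>c\<close>. Only the total height of the layers
  enters, so a decomposition into many layers costs no logarithmic factor.\<close>

lemma sum_sqrt_card_le:
  assumes "\<And>l. l < k \<Longrightarrow> 0 \<le> c l" and "(\<Sum>l<k. c l) \<le> b" and s: "\<And>l. l < k \<Longrightarrow> 0 \<le> s l"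
  shows "(\<Sum>l<(k::nat). c l * sqrt (s l)) \<le> sqrt (b * (\<Sum>l<k. c l * s l))"
proof -
  have "(\<Sum>l<k. c l * sqrt (s l))\<^sup>2 = (\<Sum>l<k. sqrt (c l) * (sqrt (c l) * sqrt (s l)))\<^sup>2"
    using assms(1) by (intro arg_cong[where f = "\<lambda>x. x\<^sup>2"] sum.cong) (auto simp flip: mult.assoc)
  also have "\<dots> \<le> (\<Sum>l<k. (sqrt (c l))\<^sup>2) * (\<Sum>l<k. (sqrt (c l) * sqrt (s l))\<^sup>2)"
    by (rule Cauchy_Schwarz_ineq_sum)
  also have "\<dots> = (\<Sum>l<k. c l) * (\<Sum>l<k. c l * s l)"
    using assms(1,3) by (simp add: power_mult_distrib)
  also have "\<dots> \<le> b * (\<Sum>l<k. c l * s l)"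
    using assms by (intro mult_right_mono sum_nonneg) auto
  finally show ?thesis by (rule real_le_rsqrt)
qed

text \<open>Each pair of layers contributes the bound for its two sets. The main terms recombine
  exactly by linearity; the square-root terms recombine through
  \<open>sum_sqrt_card_le\<close>.\<close>

theorem low_discrepancy_bilinear:
  assumes ld: "low_discrepancy n1 n2 p W" and W: "W \<subseteq> {..<n1} \<times> {..<n2}" and p: "0 \<le> p"
    and x: "\<And>i. i < n1 \<Longrightarrow> 0 \<le> x i" "\<And>i. i < n1 \<Longrightarrow> x i \<le> bx" "0 \<le> bx"
    and y: "\<And>j. j < n2 \<Longrightarrow> 0 \<le> y j" "\<And>j. j < n2 \<Longrightarrow> y j \<le> b_y" "0 \<le> b_y"
  shows "(\<Sum>(i, j)\<in>W. x i * y j) \<le> 40 * (p * (\<Sum>i<n1. x i) * (\<Sum>j<n2. y j)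
    + sqrt (real (max n1 n2) * p) * sqrt (bx * (\<Sum>i<n1. x i)) * sqrt (b_y * (\<Sum>j<n2. y j)))"
proof -
  have finW: "finite W" using W finite_subset by blast
  obtain k c S where *: "\<forall>l<(k::nat). 0 \<le> c l \<and> S l \<subseteq> {..<n1}"
      "\<forall>i\<in>{..<n1}. x i = (\<Sum>l<k. c l * of_bool (i \<in> S l))" and cb: "(\<Sum>l<k. c l) \<le> bx"
    using layer_decomposition[of "{..<n1}" x bx, OF finite_lessThan _ _ x(3)] x(1,2) unfolding lessThan_iff by blast
  have c: "\<And>l. l < k \<Longrightarrow> 0 \<le> c l" "\<And>l. l < k \<Longrightarrow> S l \<subseteq> {..<n1}" using *(1) by blast+
  have xc: "x i = (\<Sum>l<k. c l * of_bool (i \<in> S l))" if "i < n1" for i using *(2) that by blast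
  obtain h e T where *: "\<forall>l<(h::nat). 0 \<le> e l \<and> T l \<subseteq> {..<n2}"
      "\<forall>j\<in>{..<n2}. y j = (\<Sum>l<h. e l * of_bool (j \<in> T l))" and eb: "(\<Sum>l<h. e l) \<le> b_y"
    using layer_decomposition[of "{..<n2}" y b_y, OF finite_lessThan _ _ y(3)] y(1,2) unfolding lessThan_iff by blast
  have e: "\<And>l. l < h \<Longrightarrow> 0 \<le> e l" "\<And>l. l < h \<Longrightarrow> T l \<subseteq> {..<n2}" using *(1) by blast+
  have ye: "y j = (\<Sum>l<h. e l * of_bool (j \<in> T l))" if "j < n2" for j using *(2) that by blast
  define s where "s l = real (card (S l))" for l
  define t where "t l = real (card (T l))" for l
  have ind: "(\<Sum>i<m. of_bool (i \<in> A)) = real (card A)" if "A \<subseteq> {..<m}" for A and m :: nat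
    using that by (simp add: sum.If_cases of_bool_def Int_absorb1)
  have X: "(\<Sum>i<n1. x i) = (\<Sum>l<k. c l * s l)"
  proof -
    have "(\<Sum>i<n1. x i) = (\<Sum>i<n1. \<Sum>l<k. c l * of_bool (i \<in> S l))" using xc by simp
    also have "\<dots> = (\<Sum>l<k. \<Sum>i<n1. c l * of_bool (i \<in> S l))" by (rule sum.swap)
    also have "\<dots> = (\<Sum>l<k. c l * s l)" unfolding s_def using c ind by (simp flip: sum_distrib_left)
    finally show ?thesis .
  qed
  have Y: "(\<Sum>j<n2. y j) = (\<Sum>l<h. e l * t l)"
  proof -
    have "(\<Sum>j<n2. y j) = (\<Sum>j<n2. \<Sum>l<h. e l * of_bool (j \<in> T l))" using ye by simp
    also have "\<dots> = (\<Sum>l<h. \<Sum>j<n2. e l * of_bool (j \<in> T l))" by (rule sum.swap)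
    also have "\<dots> = (\<Sum>l<h. e l * t l)" unfolding t_def using e ind by (simp flip: sum_distrib_left)
    finally show ?thesis .
  qed
  have "(\<Sum>(i, j)\<in>W. x i * y j) = (\<Sum>ij\<in>W. \<Sum>l<k. \<Sum>m<h. c l * e m * of_bool (ij \<in> S l \<times> T m))"
  proof (rule sum.cong)
    fix ij assume ij: "ij \<in> W"
    obtain i j where eq: "ij = (i, j)" by (cases ij)
    then have "i < n1" "j < n2" using ij W by auto
    then have "x i * y j = (\<Sum>l<k. \<Sum>m<h. (c l * of_bool (i \<in> S l)) * (e m * of_bool (j \<in> T m)))"
      by (simp only: xc ye sum_product)
    also have "\<dots> = (\<Sum>l<k. \<Sum>m<h. c l * e m * of_bool (ij \<in> S l \<times> T m))"
      by (intro sum.cong refl) (simp add: eq)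
    finally show "(case ij of (i, j) \<Rightarrow> x i * y j) = (\<Sum>l<k. \<Sum>m<h. c l * e m * of_bool (ij \<in> S l \<times> T m))"
      by (simp add: eq)
  qed simp
  also have "\<dots> = (\<Sum>l<k. \<Sum>ij\<in>W. \<Sum>m<h. c l * e m * of_bool (ij \<in> S l \<times> T m))" by (rule sum.swap)
  also have "\<dots> = (\<Sum>l<k. \<Sum>m<h. \<Sum>ij\<in>W. c l * e m * of_bool (ij \<in> S l \<times> T m))" by (intro sum.cong refl sum.swap)
  also have "\<dots> = (\<Sum>l<k. \<Sum>m<h. c l * e m * real (card (W \<inter> S l \<times> T m)))"
  proof -
    have "(\<Sum>ij\<in>W. of_bool (ij \<in> S l \<times> T m)) = real (card (W \<inter> S l \<times> T m))" for l m
      using finW by (simp add: of_bool_def sum.If_cases Int_def del: mem_Sigma_iff)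
    then show ?thesis by (simp flip: sum_distrib_left)
  qed
  also have "\<dots> \<le> (\<Sum>l<k. \<Sum>m<h. c l * e m * (40 * (p * s l * t m + sqrt (real (max n1 n2) * p) * sqrt (s l) * sqrt (t m))))"
  proof (intro sum_mono mult_left_mono)
    fix l m assume "l \<in> {..<k}" "m \<in> {..<h}"
    then have "S l \<subseteq> {..<n1}" "T m \<subseteq> {..<n2}" "0 \<le> c l * e m" using c e by auto
    then show "real (card (W \<inter> S l \<times> T m)) \<le> 40 * (p * s l * t m + sqrt (real (max n1 n2) * p) * sqrt (s l) * sqrt (t m))" "0 \<le> c l * e m"
      using ld by (auto simp: low_discrepancy_def s_def t_def real_sqrt_mult)
  qed
  also have "\<dots> = 40 * (p * (\<Sum>l<k. c l * s l) * (\<Sum>m<h. e m * t m)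
     + sqrt (real (max n1 n2) * p) * (\<Sum>l<k. c l * sqrt (s l)) * (\<Sum>m<h. e m * sqrt (t m)))"
  proof -
    have "p * (\<Sum>l<k. c l * s l) * (\<Sum>m<h. e m * t m) = (\<Sum>l<k. \<Sum>m<h. p * ((c l * s l) * (e m * t m)))"
      by (simp only: mult.assoc sum_product) (simp only: sum_distrib_left)
    moreover have "sqrt (real (max n1 n2) * p) * (\<Sum>l<k. c l * sqrt (s l)) * (\<Sum>m<h. e m * sqrt (t m))
       = (\<Sum>l<k. \<Sum>m<h. sqrt (real (max n1 n2) * p) * ((c l * sqrt (s l)) * (e m * sqrt (t m))))"
      by (simp only: mult.assoc sum_product) (simp only: sum_distrib_left)
    ultimately show ?thesis
      by (simp only: sum.distrib[symmetric] sum_distrib_left) (intro sum.cong refl, simp only: distrib_left mult_ac)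
  qed
  also have "\<dots> \<le> 40 * (p * (\<Sum>l<k. c l * s l) * (\<Sum>m<h. e m * t m)
     + sqrt (real (max n1 n2) * p) * sqrt (bx * (\<Sum>l<k. c l * s l)) * sqrt (b_y * (\<Sum>m<h. e m * t m)))"
  proof -
    have "(\<Sum>l<k. c l * sqrt (s l)) \<le> sqrt (bx * (\<Sum>l<k. c l * s l))"
      using c cb by (intro sum_sqrt_card_le) (auto simp: s_def)
    moreover have "(\<Sum>m<h. e m * sqrt (t m)) \<le> sqrt (b_y * (\<Sum>m<h. e m * t m))"
      using e eb by (intro sum_sqrt_card_le) (auto simp: t_def)
    moreover have "0 \<le> (\<Sum>m<h. e m * sqrt (t m))" using e by (intro sum_nonneg) (auto simp: t_def)
    moreover have "0 \<le> sqrt (bx * (\<Sum>l<k. c l * s l))" using c x(3) by (auto intro!: mult_nonneg_nonneg sum_nonneg simp: s_def)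
    ultimately have "(\<Sum>l<k. c l * sqrt (s l)) * (\<Sum>m<h. e m * sqrt (t m))
       \<le> sqrt (bx * (\<Sum>l<k. c l * s l)) * sqrt (b_y * (\<Sum>m<h. e m * t m))" by (intro mult_mono)
    then show ?thesis using p unfolding mult.assoc by (intro mult_left_mono add_left_mono) auto
  qed
  finally show ?thesis unfolding X Y .
qed

text \<open>Serves \<open>core_surj\<close>, where injectivity of the array of \<open>V^T Q\<close>
  comes from a norm estimate.\<close>

lemma square_system_solvable:
  fixes N :: "nat \<Rightarrow> nat \<Rightarrow> real"
  assumes "\<And>z. (\<And>a. a < r \<Longrightarrow> (\<Sum>b<r. N a b * z b) = 0) \<Longrightarrow> (\<forall>b<r. z b = 0)"
  shows "\<exists>z. \<forall>a<r. (\<Sum>b<r. N a b * z b) = w a"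
proof -
  define A where "A = Matrix.mat r r (\<lambda>(a, b). N a b)"
  have A: "A \<in> carrier_mat r r" by (simp add: A_def)
  have app: "vec_index (A *\<^sub>v v) a = (\<Sum>b<r. N a b * vec_index v b)" if "v \<in> carrier_vec r" "a < r" for v a
    using that by (simp add: A_def scalar_prod_def atLeast0LessThan)
  have "Determinant.det A \<noteq> 0"
  proof
    assume "Determinant.det A = 0"
    then obtain v where v: "v \<in> carrier_vec r" "v \<noteq> 0\<^sub>v r" "A *\<^sub>v v = 0\<^sub>v r"
      using det_0_iff_vec_prod_zero_field[OF A] by auto
    have "\<forall>b<r. vec_index v b = 0"
    proof (rule assms)
      fix a assume "a < r"
      then show "(\<Sum>b<r. N a b * vec_index v b) = 0" using app[OF v(1)] v(3) by simp
    qed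
    then show False using v(1,2) by (metis eq_vecI carrier_vecD index_zero_vec)
  qed
  then have "A \<in> Units (ring_mat TYPE(real) r ())" by (rule det_non_zero_imp_unit[OF A])
  then obtain B where B: "B \<in> carrier_mat r r" "A * B = 1\<^sub>m r"
    by (auto simp: Units_def ring_mat_def)
  define v where "v = B *\<^sub>v Matrix.vec r w"
  have v: "v \<in> carrier_vec r" using B by (simp add: v_def)
  have "A *\<^sub>v v = (A * B) *\<^sub>v Matrix.vec r w" unfolding v_def using A B by (subst assoc_mult_mat_vec) auto
  also have "\<dots> = Matrix.vec r w" unfolding B(2) by simp
  finally have "A *\<^sub>v v = Matrix.vec r w" .
  then have "(\<Sum>b<r. N a b * vec_index v b) = w a" if "a < r" for a using app[OF v that] that by simp
  then show ?thesis by blast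
qed

section \<open>Projection kernels\<close>

definition ap :: "'b set \<Rightarrow> ('a \<Rightarrow> 'b \<Rightarrow> real) \<Rightarrow> ('b \<Rightarrow> real) \<Rightarrow> 'a \<Rightarrow> real" where
  "ap J A x = (\<lambda>i. \<Sum>j\<in>J. A i j * x j)"

abbreviation (input) transposed :: "('a \<Rightarrow> 'b \<Rightarrow> real) \<Rightarrow> 'b \<Rightarrow> 'a \<Rightarrow> real" where
  "transposed A \<equiv> \<lambda>j i. A i j"

lemma L2_set_power2: "(L2_set f I)\<^sup>2 = ip I f f"
  unfolding L2_set_def ip_self_power2 by (intro real_sqrt_pow2 sum_nonneg) simp

lemma L2_set_eq_sqrt_ip: "L2_set f I = sqrt (ip I f f)"
  unfolding L2_set_def ip_self_power2 ..

lemma abs_ip_le: "\<bar>ip I f g\<bar> \<le> L2_set f I * L2_set g I"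
  using ip_Cauchy_Schwarz[of I f g]
  by (metis L2_set_eq_sqrt_ip real_sqrt_abs real_sqrt_le_mono real_sqrt_mult)

lemma ip_cong: "(\<And>i. i \<in> I \<Longrightarrow> f i = f' i) \<Longrightarrow> (\<And>i. i \<in> I \<Longrightarrow> g i = g' i) \<Longrightarrow> ip I f g = ip I f' g'"
  by (simp add: ip_def)

lemma ip_ap: "ip I (ap J A x) y = ip J x (ap I (transposed A) y)"
proof -
  have "ip I (ap J A x) y = (\<Sum>i\<in>I. \<Sum>j\<in>J. A i j * x j * y i)"
    by (simp add: ip_def ap_def sum_distrib_right)
  also have "\<dots> = (\<Sum>j\<in>J. \<Sum>i\<in>I. A i j * x j * y i)" by (rule sum.swap)
  also have "\<dots> = ip J x (ap I (transposed A) y)"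
    by (simp add: ip_def ap_def sum_distrib_left mult_ac)
  finally show ?thesis .
qed

lemma ap_mult: "ap J (\<lambda>i j. \<Sum>a\<in>K. L i a * R a j) y = ap K L (ap J R y)"
proof
  fix i
  have "ap J (\<lambda>i j. \<Sum>a\<in>K. L i a * R a j) y i = (\<Sum>j\<in>J. \<Sum>a\<in>K. L i a * R a j * y j)"
    by (simp add: ap_def sum_distrib_right)
  also have "\<dots> = (\<Sum>a\<in>K. \<Sum>j\<in>J. L i a * R a j * y j)" by (rule sum.swap)
  finally show "ap J (\<lambda>i j. \<Sum>a\<in>K. L i a * R a j) y i = ap K L (ap J R y) i"
    by (simp add: ap_def sum_distrib_left mult.assoc)
qed

lemma ap_diff_left: "ap J (\<lambda>i j. A i j - B i j) x i = ap J A x i - ap J B x i"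
  by (simp add: ap_def sum_subtractf left_diff_distrib)

lemma ap_cong: "(\<And>j. j \<in> J \<Longrightarrow> A i j = B i j) \<Longrightarrow> (\<And>j. j \<in> J \<Longrightarrow> x j = y j) \<Longrightarrow> ap J A x i = ap J B y i"
  by (simp add: ap_def)

lemma L2_ap_le: "L2_set (ap J A x) I \<le> sqrt (\<Sum>i\<in>I. \<Sum>j\<in>J. (A i j)\<^sup>2) * L2_set x J"
proof -
  have "(ap J A x i)\<^sup>2 \<le> (\<Sum>j\<in>J. (A i j)\<^sup>2) * ip J x x" for i
    using ip_Cauchy_Schwarz[of J "A i" x] by (simp add: ip_self_power2 ap_def ip_def[of J "A i" x])
  then have "ip I (ap J A x) (ap J A x) \<le> (\<Sum>i\<in>I. \<Sum>j\<in>J. (A i j)\<^sup>2) * ip J x x"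
    unfolding ip_self_power2[of I] sum_distrib_right by (rule sum_mono)
  then show ?thesis by (simp add: L2_set_eq_sqrt_ip real_sqrt_mult[symmetric])
qed

text \<open>Symmetry is required at all arguments, not only in \<open>I\<close>, so that
  transposition is an equality of functions and can be rewritten.\<close>

definition proj_kernel :: "'a set \<Rightarrow> ('a \<Rightarrow> 'a \<Rightarrow> real) \<Rightarrow> bool" where
  "proj_kernel I A \<longleftrightarrow> (\<forall>i k. A i k = A k i) \<and> (\<forall>i\<in>I. \<forall>k\<in>I. (\<Sum>j\<in>I. A i j * A j k) = A i k)"

definition co_kernel :: "('a \<Rightarrow> 'a \<Rightarrow> real) \<Rightarrow> 'a \<Rightarrow> 'a \<Rightarrow> real" where
  "co_kernel A i k = of_bool (i = k) - A i k"

lemma ap_co_kernel: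
  assumes "finite I" "i \<in> I"
  shows "ap I (co_kernel A) f i = f i - ap I A f i"
  using assms by (simp add: ap_def co_kernel_def left_diff_distrib sum_subtractf of_bool_def
      if_distrib[of "\<lambda>x. x * _"] cong: if_cong)

lemma proj_kernel_co_kernel:
  assumes fin: "finite I" and A: "proj_kernel I A"
  shows "proj_kernel I (co_kernel A)"
proof -
  have sym: "A i k = A k i" for i k using A by (auto simp: proj_kernel_def)
  have "(\<Sum>j\<in>I. co_kernel A i j * co_kernel A j k) = co_kernel A i k" if ik: "i \<in> I" "k \<in> I" for i k
  proof -
    have "(\<Sum>j\<in>I. co_kernel A i j * co_kernel A j k) = ap I (co_kernel A) (\<lambda>j. co_kernel A j k) i"
      by (simp add: ap_def)
    also have "\<dots> = co_kernel A i k - ap I A (\<lambda>j. co_kernel A j k) i" using ap_co_kernel[OF fin ik(1)] .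
    also have "ap I A (\<lambda>j. co_kernel A j k) i = ap I (co_kernel A) (\<lambda>j. A i j) k"
      unfolding ap_def by (intro sum.cong) (auto simp: co_kernel_def sym mult.commute)
    also have "\<dots> = A i k - ap I A (\<lambda>j. A i j) k" using ap_co_kernel[OF fin ik(2)] .
    also have "ap I A (\<lambda>j. A i j) k = (\<Sum>j\<in>I. A i j * A j k)" unfolding ap_def by (intro sum.cong) (auto simp: sym mult.commute)
    also have "\<dots> = A i k" using A ik unfolding proj_kernel_def by blast
    finally show ?thesis by simp
  qed
  then show ?thesis unfolding proj_kernel_def by (auto simp: co_kernel_def sym)
qed

text \<open>With \<open>proj_kernel_co_kernel\<close> this yields the projection onto
  \<open>T\<close>, which is the complement of the tensor product of two complements.\<close>

lemma proj_kernel_tensor: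
  assumes A: "proj_kernel I A" and B: "proj_kernel J B"
  shows "proj_kernel (I \<times> J) (\<lambda>k l. A (fst k) (fst l) * B (snd k) (snd l))"
  unfolding proj_kernel_def
proof (intro conjI allI ballI)
  fix k l :: "'a \<times> 'b"
  show "A (fst k) (fst l) * B (snd k) (snd l) = A (fst l) (fst k) * B (snd l) (snd k)"
    using A B by (auto simp: proj_kernel_def)
next
  fix k l assume kl: "k \<in> I \<times> J" "l \<in> I \<times> J"
  have "(\<Sum>m\<in>I \<times> J. A (fst k) (fst m) * B (snd k) (snd m) * (A (fst m) (fst l) * B (snd m) (snd l)))
    = (\<Sum>i\<in>I. A (fst k) i * A i (fst l)) * (\<Sum>j\<in>J. B (snd k) j * B j (snd l))"
    by (simp add: sum_product sum.cartesian_product mult_ac split_def)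
  also have "\<dots> = A (fst k) (fst l) * B (snd k) (snd l)"
    using A B kl by (auto simp: proj_kernel_def)
  finally show "(\<Sum>m\<in>I \<times> J. A (fst k) (fst m) * B (snd k) (snd m) * (A (fst m) (fst l) * B (snd m) (snd l)))
    = A (fst k) (fst l) * B (snd k) (snd l)" .
qed

lemma proj_kernel_ap:
  assumes A: "proj_kernel I A"
  shows "ip I (ap I A f) (ap I A f) = ip I f (ap I A f)"
proof -
  have sym: "transposed A = A" using A by (auto simp: proj_kernel_def)
  have "ip I (ap I A f) (ap I A f) = ip I f (ap I (transposed A) (ap I A f))" by (rule ip_ap)
  also have "ap I (transposed A) (ap I A f) = ap I (\<lambda>i k. \<Sum>j\<in>I. A i j * A j k) f" unfolding sym ap_mult ..
  also have "ip I f \<dots> = ip I f (ap I A f)"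
    using A by (intro ip_cong ap_cong refl) (auto simp: proj_kernel_def)
  finally show ?thesis .
qed

lemma proj_kernel_contraction:
  assumes A: "proj_kernel I A"
  shows "ip I (ap I A f) (ap I A f) \<le> ip I f f"
proof -
  have "0 \<le> (\<Sum>i\<in>I. (f i - ap I A f i)\<^sup>2)" by (intro sum_nonneg) auto
  also have "\<dots> = ip I f f - 2 * ip I f (ap I A f) + ip I (ap I A f) (ap I A f)"
    unfolding ip_def sum_distrib_left sum_subtractf[symmetric] sum.distrib[symmetric]
    by (intro sum.cong refl) (simp add: power2_eq_square algebra_simps)
  finally show ?thesis unfolding proj_kernel_ap[OF A] by simp
qed

text \<open>Reduces the norm bound of a Bessel system to a diagonal entry of the kernel.\<close>

lemma proj_kernel_row:
  assumes A: "proj_kernel I A" and "i \<in> I"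
  shows "ip I (A i) (A i) = A i i"
proof -
  have "A i j = A j i" for j using A unfolding proj_kernel_def by metis
  then have "ip I (A i) (A i) = (\<Sum>j\<in>I. A i j * A j i)" unfolding ip_def by (intro sum.cong refl) metis
  then show ?thesis using A \<open>i \<in> I\<close> unfolding proj_kernel_def by metis
qed

definition range_kernel :: "nat \<Rightarrow> ('a \<Rightarrow> nat \<Rightarrow> real) \<Rightarrow> 'a \<Rightarrow> 'a \<Rightarrow> real" where
  "range_kernel r P i k = (\<Sum>a<r. P i a * P k a)"

definition orthonormal_cols :: "'a set \<Rightarrow> nat \<Rightarrow> ('a \<Rightarrow> nat \<Rightarrow> real) \<Rightarrow> bool" where
  "orthonormal_cols I r P \<longleftrightarrow> (\<forall>a<r. \<forall>b<r. (\<Sum>i\<in>I. P i a * P i b) = of_bool (a = b))"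

lemma orthonormal_ap_transp:
  assumes "orthonormal_cols I r P" "a < r"
  shows "ap I (transposed P) (ap {..<r} P z) a = z a"
proof -
  have "ap I (transposed P) (ap {..<r} P z) a = ap {..<r} (\<lambda>a b. \<Sum>i\<in>I. transposed P a i * P i b) z a"
    by (simp only: ap_mult)
  also have "\<dots> = (\<Sum>b<r. of_bool (a = b) * z b)"
    unfolding ap_def using assms by (intro sum.cong) (auto simp: orthonormal_cols_def)
  also have "\<dots> = z a" using assms(2) by (simp add: of_bool_def if_distrib[of "\<lambda>x. x * _"] cong: if_cong)
  finally show ?thesis .
qed

lemma orthonormal_isometry:
  assumes "orthonormal_cols I r P"
  shows "ip I (ap {..<r} P z) (ap {..<r} P z) = ip {..<r} z z"
  unfolding ip_ap using orthonormal_ap_transp[OF assms] by (intro ip_cong) auto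

lemma ap_range_kernel: "ap I (range_kernel r P) f = ap {..<r} P (ap I (transposed P) f)"
  unfolding range_kernel_def[abs_def] by (rule ap_mult)

lemma proj_kernel_range_kernel:
  assumes o: "orthonormal_cols I r P"
  shows "proj_kernel I (range_kernel r P)"
proof -
  have "(\<Sum>j\<in>I. range_kernel r P i j * range_kernel r P j k) = range_kernel r P i k" for i k
  proof -
    have "range_kernel r P j k = ap {..<r} P (P k) j" for j by (simp add: ap_def range_kernel_def)
    then have "(\<Sum>j\<in>I. range_kernel r P i j * range_kernel r P j k)
       = ap I (range_kernel r P) (ap {..<r} P (P k)) i"
      by (simp add: ap_def)
    also have "\<dots> = ap {..<r} P (ap I (transposed P) (ap {..<r} P (P k))) i" unfolding ap_range_kernel ..
    also have "\<dots> = ap {..<r} P (P k) i" using orthonormal_ap_transp[OF o] by (intro ap_cong) auto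
    finally show ?thesis by (simp add: ap_def range_kernel_def)
  qed
  then show ?thesis by (auto simp: proj_kernel_def range_kernel_def mult.commute)
qed

lemma orthonormal_transp_contraction:
  assumes o: "orthonormal_cols I r P"
  shows "ip {..<r} (ap I (transposed P) f) (ap I (transposed P) f) \<le> ip I f f"
  using proj_kernel_contraction[OF proj_kernel_range_kernel[OF o], of f]
  unfolding ap_range_kernel orthonormal_isometry[OF o] .

lemma co_range_kernel_kills:
  assumes o: "orthonormal_cols I r P" and "finite I" "i \<in> I"
  shows "ap I (co_kernel (range_kernel r P)) (ap {..<r} P z) i = 0"
proof -
  have "ap I (range_kernel r P) (ap {..<r} P z) i = ap {..<r} P z i"
    unfolding ap_range_kernel using orthonormal_ap_transp[OF o] by (intro ap_cong) auto
  then show ?thesis using assms by (simp add: ap_co_kernel)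
qed

section \<open>Factorizations close to a low-rank matrix\<close>

definition factor_err :: "nat \<Rightarrow> ('a \<Rightarrow> nat \<Rightarrow> real) \<Rightarrow> (nat \<Rightarrow> real) \<Rightarrow> ('b \<Rightarrow> nat \<Rightarrow> real) \<Rightarrow>
    ('a \<Rightarrow> nat \<Rightarrow> real) \<Rightarrow> ('b \<Rightarrow> nat \<Rightarrow> real) \<Rightarrow> 'a \<Rightarrow> 'b \<Rightarrow> real" where
  "factor_err r P \<sigma> Q U V i j = (\<Sum>a<r. U i a * V j a) - (\<Sum>a<r. P i a * (\<sigma> a * Q j a))"

lemma factor_err_swap: "factor_err r Q \<sigma> P V U j i = factor_err r P \<sigma> Q U V i j"
  by (simp add: factor_err_def mult_ac)

locale near_factorization =
  fixes I :: "'a set" and J :: "'b set" and r :: nat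
    and P :: "'a \<Rightarrow> nat \<Rightarrow> real" and \<sigma> :: "nat \<Rightarrow> real" and Q :: "'b \<Rightarrow> nat \<Rightarrow> real"
    and U :: "'a \<Rightarrow> nat \<Rightarrow> real" and V :: "'b \<Rightarrow> nat \<Rightarrow> real" and s1 sr :: real
  assumes finI: "finite I" and finJ: "finite J"
    and oP: "orthonormal_cols I r P" and oQ: "orthonormal_cols J r Q"
    and \<sigma>: "\<And>a. a < r \<Longrightarrow> sr \<le> \<sigma> a" "\<And>a. a < r \<Longrightarrow> \<sigma> a \<le> s1" and sr: "0 < sr" "sr \<le> s1"
    and err: "(\<Sum>i\<in>I. \<Sum>j\<in>J. (factor_err r P \<sigma> Q U V i j)\<^sup>2) \<le> (sr / 4)\<^sup>2"
    and bal: "(\<Sum>a<r. \<Sum>b<r. ((\<Sum>i\<in>I. U i a * U i b) - (\<Sum>j\<in>J. V j a * V j b))\<^sup>2) \<le> (sr / 4)\<^sup>2"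
begin

abbreviation "K \<equiv> {..<r}"
abbreviation "D \<equiv> factor_err r P \<sigma> Q U V"

text \<open>The hypotheses are symmetric in the two factors, so each estimate is proved for one of
  them and read off for the other in this instance.\<close>

lemma swapped: "near_factorization J I r Q \<sigma> P V U s1 sr"
proof
  show "(\<Sum>i\<in>J. \<Sum>j\<in>I. (factor_err r Q \<sigma> P V U i j)\<^sup>2) \<le> (sr / 4)\<^sup>2"
    unfolding factor_err_swap[of r Q \<sigma> P V U] by (subst sum.swap) (rule err)
  show "(\<Sum>a<r. \<Sum>b<r. ((\<Sum>i\<in>J. V i a * V i b) - (\<Sum>j\<in>I. U j a * U j b))\<^sup>2) \<le> (sr / 4)\<^sup>2"
    using bal by (subst power2_commute)
qed (use finI finJ oP oQ \<sigma> sr in auto)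

lemma err_apply: "L2_set (ap J D y) I \<le> sr / 4 * L2_set y J"
proof -
  have "sqrt (\<Sum>i\<in>I. \<Sum>j\<in>J. (D i j)\<^sup>2) \<le> sr / 4" using err sr by (intro real_le_lsqrt) auto
  then have "sqrt (\<Sum>i\<in>I. \<Sum>j\<in>J. (D i j)\<^sup>2) * L2_set y J \<le> sr / 4 * L2_set y J" by (intro mult_right_mono) auto
  then show ?thesis using L2_ap_le[where A = D and x = y and I = I and J = J] by simp
qed

lemma ap_err: "ap J D y i = ap K U (ap J (transposed V) y) i - ap K P (\<lambda>a. \<sigma> a * ap J (transposed Q) y a) i"
proof -
  have "ap J D y i = ap J (\<lambda>i j. \<Sum>a<r. U i a * V j a) y i - ap J (\<lambda>i j. \<Sum>a<r. P i a * (\<sigma> a * Q j a)) y i"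
    by (simp add: ap_def factor_err_def sum_subtractf left_diff_distrib)
  also have "ap J (\<lambda>i j. \<Sum>a<r. U i a * V j a) y = ap K U (ap J (transposed V) y)" by (rule ap_mult)
  also have "ap J (\<lambda>i j. \<Sum>a<r. P i a * (\<sigma> a * Q j a)) y = ap K P (ap J (\<lambda>a j. \<sigma> a * Q j a) y)" by (rule ap_mult)
  also have "ap J (\<lambda>a j. \<sigma> a * Q j a) y = (\<lambda>a. \<sigma> a * ap J (transposed Q) y a)"
    by (simp add: ap_def sum_distrib_left mult.assoc)
  finally show ?thesis .
qed

text \<open>Here \<open>w z\<close> is \<open>V^T Q z\<close>. Then \<open>U w\<close> is
  \<open>U V^T\<close> applied to \<open>Q z\<close>, that is \<open>P (\<sigma> z)\<close> plus
  \<open>D Q z\<close>; the first has norm at least \<open>sr |z|\<close>, and the second takes away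
  at most a quarter of that. The other bound is Cauchy-Schwarz for the inner product of
  \<open>V w\<close> and \<open>Q z\<close>.\<close>

lemma core_lower:
  defines "w z \<equiv> ap J (transposed V) (ap K Q z)"
  shows "3 / 4 * sr * L2_set z K \<le> L2_set (ap K U (w z)) I"
    and "(L2_set (w z) K)\<^sup>2 \<le> L2_set (ap K V (w z)) J * L2_set z K"
proof -
  have z: "L2_set (ap K Q z) J = L2_set z K"
    by (simp add: L2_set_eq_sqrt_ip orthonormal_isometry[OF oQ])
  have "sr * L2_set z K = L2_set (\<lambda>a. sr * z a) K" using sr by (simp add: L2_set_right_distrib)
  also have "\<dots> \<le> L2_set (\<lambda>a. \<sigma> a * z a) K"
    unfolding L2_set_eq_sqrt_ip ip_self_power2 power_mult_distrib
    using \<sigma> sr by (intro real_sqrt_le_mono sum_mono mult_right_mono power_mono) auto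
  also have "\<dots> = L2_set (\<lambda>a. \<sigma> a * ap J (transposed Q) (ap K Q z) a) K"
    using orthonormal_ap_transp[OF oQ] by (intro L2_set_cong) auto
  also have "\<dots> = L2_set (ap K P (\<lambda>a. \<sigma> a * ap J (transposed Q) (ap K Q z) a)) I"
    by (simp add: L2_set_eq_sqrt_ip orthonormal_isometry[OF oP])
  also have "\<dots> = L2_set (\<lambda>i. ap K U (w z) i + - ap J D (ap K Q z) i) I"
    by (simp add: ap_err w_def)
  also have "\<dots> \<le> L2_set (ap K U (w z)) I + L2_set (\<lambda>i. - ap J D (ap K Q z) i) I" by (rule L2_set_triangle_ineq)
  also have "L2_set (\<lambda>i. - ap J D (ap K Q z) i) I = L2_set (ap J D (ap K Q z)) I" by (simp add: L2_set_def)
  also have "\<dots> \<le> sr / 4 * L2_set z K" using err_apply[of "ap K Q z"] z by simp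
  finally show "3 / 4 * sr * L2_set z K \<le> L2_set (ap K U (w z)) I" by simp
  have "(L2_set (w z) K)\<^sup>2 = ip K (w z) (ap J (transposed V) (ap K Q z))" by (simp add: L2_set_power2 w_def)
  also have "\<dots> = ip J (ap K V (w z)) (ap K Q z)" by (rule ip_ap[symmetric])
  also have "\<dots> \<le> L2_set (ap K V (w z)) J * L2_set (ap K Q z) J" using abs_ip_le[of J "ap K V (w z)" "ap K Q z"] by simp
  finally show "(L2_set (w z) K)\<^sup>2 \<le> L2_set (ap K V (w z)) J * L2_set z K" unfolding z .
qed

lemma L2_set_zero: "finite A \<Longrightarrow> (\<And>i. i \<in> A \<Longrightarrow> f i = 0) \<Longrightarrow> L2_set f A = 0"
  by (simp add: L2_set_def)

text \<open>\<open>V^T Q\<close> is square and injective by \<open>core_lower\<close>, so every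
  \<open>w\<close> has the form needed to apply those bounds.\<close>

lemma core_surj: "\<exists>z. \<forall>a<r. ap J (transposed V) (ap K Q z) a = w a"
proof -
  define N where "N a b = (\<Sum>j\<in>J. V j a * Q j b)" for a b
  have N: "(\<Sum>b<r. N a b * z b) = ap J (transposed V) (ap K Q z) a" for a z
    using fun_cong[OF ap_mult[where J = K and K = J and L = "transposed V" and R = Q and y = z], of a] by (simp add: ap_def N_def)
  have "\<exists>z. \<forall>a<r. (\<Sum>b<r. N a b * z b) = w a"
  proof (rule square_system_solvable)
    fix z assume "\<And>a. a < r \<Longrightarrow> (\<Sum>b<r. N a b * z b) = 0"
    then have "ap J (transposed V) (ap K Q z) a = 0" if "a < r" for a using that N by simp
    then have "L2_set (ap K U (ap J (transposed V) (ap K Q z))) I = 0" by (intro L2_set_zero finI) (simp add: ap_def)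
    then have "3 / 4 * sr * L2_set z K \<le> 0" using core_lower(1)[of z] by simp
    then have "L2_set z K \<le> 0" using sr by (simp add: mult_le_0_iff)
    then have "L2_set z K = 0" by (simp add: order_antisym)
    then show "\<forall>b<r. z b = 0" by (auto simp: L2_set_def sum_nonneg_eq_0_iff)
  qed
  then show ?thesis unfolding N .
qed

lemma balance: "\<bar>ip I (ap K U w) (ap K U w) - ip J (ap K V w) (ap K V w)\<bar> \<le> sr / 4 * ip K w w"
proof -
  define B where "B a b = (\<Sum>i\<in>I. U i a * U i b) - (\<Sum>j\<in>J. V j a * V j b)" for a b
  have gram: "ip A (ap K L w) (ap K L w) = ip K w (ap K (\<lambda>a b. \<Sum>i\<in>A. L i a * L i b) w)" for A :: "'c set" and L
    unfolding ip_ap ap_mult ..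
  have "ip I (ap K U w) (ap K U w) - ip J (ap K V w) (ap K V w)
    = ip K w (ap K (\<lambda>a b. \<Sum>i\<in>I. U i a * U i b) w) - ip K w (ap K (\<lambda>a b. \<Sum>j\<in>J. V j a * V j b) w)"
    unfolding gram ..
  also have "\<dots> = ip K w (ap K B w)"
    unfolding B_def[abs_def] ip_def ap_diff_left right_diff_distrib sum_subtractf ..
  finally have "ip I (ap K U w) (ap K U w) - ip J (ap K V w) (ap K V w) = ip K w (ap K B w)" .
  moreover have "\<bar>ip K w (ap K B w)\<bar> \<le> L2_set w K * L2_set (ap K B w) K" by (rule abs_ip_le)
  moreover have "L2_set (ap K B w) K \<le> sr / 4 * L2_set w K"
  proof -
    have "sqrt (\<Sum>a<r. \<Sum>b<r. (B a b)\<^sup>2) \<le> sr / 4" using bal sr unfolding B_def by (intro real_le_lsqrt) auto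
    then have "sqrt (\<Sum>a<r. \<Sum>b<r. (B a b)\<^sup>2) * L2_set w K \<le> sr / 4 * L2_set w K" by (intro mult_right_mono) auto
    then show ?thesis using L2_ap_le[of K B w K] by simp
  qed
  then have "L2_set w K * L2_set (ap K B w) K \<le> L2_set w K * (sr / 4 * L2_set w K)" by (intro mult_left_mono) auto
  then have "L2_set w K * L2_set (ap K B w) K \<le> sr / 4 * (L2_set w K)\<^sup>2" by (simp add: power2_eq_square mult_ac)
  ultimately show ?thesis unfolding L2_set_power2 by linarith
qed

text \<open>The two parts of \<open>core_lower\<close> multiply to
  \<open>3/4 sr |w|^2 \<le> |U w| |V w|\<close>, and balance bounds \<open>|U w|^2\<close> by
  \<open>|V w|^2 + sr |w|^2 / 4\<close>. If \<open>|V w|^2\<close> were below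
  \<open>sr |w|^2 / 2\<close>, the squared product would be at most 3/8 of
  \<open>(sr |w|^2)^2\<close>, less than the required 9/16.\<close>

lemma factor_lower: "sr / 2 * ip K w w \<le> ip J (ap K V w) (ap K V w)"
proof -
  obtain z where z: "\<forall>a<r. ap J (transposed V) (ap K Q z) a = w a" using core_surj by blast
  have c: "ap K L (ap J (transposed V) (ap K Q z)) = ap K L w" for L :: "'c \<Rightarrow> nat \<Rightarrow> real"
    using z by (intro ext ap_cong) auto
  have c': "L2_set (ap J (transposed V) (ap K Q z)) K = L2_set w K" using z by (intro L2_set_cong) auto
  define a where "a = ip I (ap K U w) (ap K U w)"
  define b where "b = ip J (ap K V w) (ap K V w)"
  define q where "q = sr * ip K w w"
  have nn: "0 \<le> a" "0 \<le> b" "0 \<le> q" using sr by (auto simp: a_def b_def q_def)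
  have ab: "a = (L2_set (ap K U w) I)\<^sup>2" "b = (L2_set (ap K V w) J)\<^sup>2" by (auto simp: a_def b_def L2_set_power2)
  have "3 / 4 * q = 3 / 4 * sr * (L2_set w K)\<^sup>2" by (simp add: q_def L2_set_power2)
  also have "\<dots> \<le> 3 / 4 * sr * (L2_set (ap K V w) J * L2_set z K)"
    using core_lower(2)[of z] sr unfolding c c' by (intro mult_left_mono) auto
  also have "\<dots> = (3 / 4 * sr * L2_set z K) * L2_set (ap K V w) J" by simp
  also have "\<dots> \<le> L2_set (ap K U w) I * L2_set (ap K V w) J"
    using core_lower(1)[of z] unfolding c by (intro mult_right_mono) auto
  finally have "(3 / 4 * q)\<^sup>2 \<le> (L2_set (ap K U w) I * L2_set (ap K V w) J)\<^sup>2"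
    using nn by (intro power_mono) auto
  then have 1: "9 / 16 * (q * q) \<le> a * b" by (simp add: ab power_mult_distrib power2_eq_square mult_ac)
  have 2: "a \<le> b + q / 4" using order_trans[OF abs_ge_self balance[of w]] by (simp add: a_def b_def q_def)
  have "q / 2 \<le> b"
  proof (rule ccontr)
    assume h: "\<not> q / 2 \<le> b"
    then have q: "0 < q" using nn by simp
    have "a * b \<le> (3 / 4 * q) * (q / 2)" using h 2 nn by (intro mult_mono) auto
    also have "\<dots> = 3 / 8 * (q * q)" by simp
    finally have "9 / 16 * (q * q) \<le> 3 / 8 * (q * q)" using 1 by simp
    moreover have "0 < q * q" using q by simp
    ultimately show False by linarith
  qed
  then show ?thesis by (simp add: q_def b_def)
qed

text \<open>The bound \<open>|V w|\<^sup>2 \<ge> |U w|\<^sup>2 - \<sigma>\<^sub>r |w|\<^sup>2 / 4\<close> is used for \<open>w = U\<^sup>T y\<close>; the lemma \<open>factor_lower\<close> in its place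
  would lose a condition number.\<close>

lemma transp_apply_bound: "ip K (ap I (transposed U) y) (ap I (transposed U) y) \<le> 2 * s1 * ip I y y"
proof -
  interpret sw: near_factorization J I r Q \<sigma> P V U s1 sr by (rule swapped)
  define w where "w = ap I (transposed U) y"
  define t where "t = L2_set y I"
  define u where "u = L2_set (ap K U w) I"
  have s1: "0 < s1" using sr by simp
  have tu: "0 \<le> t" "0 \<le> u" by (auto simp: t_def u_def)
  have "L2_set (ap K V w) J = L2_set (\<lambda>j. ap I sw.D y j + ap K Q (\<lambda>a. \<sigma> a * ap I (transposed P) y a) j) J"
    unfolding sw.ap_err w_def by simp
  also have "\<dots> \<le> L2_set (ap I sw.D y) J + L2_set (ap K Q (\<lambda>a. \<sigma> a * ap I (transposed P) y a)) J" by (rule L2_set_triangle_ineq)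
  also have "L2_set (ap K Q (\<lambda>a. \<sigma> a * ap I (transposed P) y a)) J = L2_set (\<lambda>a. \<sigma> a * ap I (transposed P) y a) K"
    by (simp add: L2_set_eq_sqrt_ip orthonormal_isometry[OF oQ])
  also have "\<dots> \<le> L2_set (\<lambda>a. s1 * ap I (transposed P) y a) K"
    unfolding L2_set_eq_sqrt_ip ip_self_power2 power_mult_distrib
    using \<sigma> sr by (intro real_sqrt_le_mono sum_mono mult_right_mono power_mono) (auto intro: order_trans[OF less_imp_le])
  also have "\<dots> = s1 * L2_set (ap I (transposed P) y) K" using s1 by (simp add: L2_set_right_distrib)
  also have "\<dots> \<le> s1 * t" unfolding t_def L2_set_eq_sqrt_ip
    using s1 orthonormal_transp_contraction[OF oP, of y] by (intro mult_left_mono real_sqrt_le_mono) auto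
  finally have "L2_set (ap K V w) J \<le> L2_set (ap I sw.D y) J + s1 * t" by simp
  also have "L2_set (ap I sw.D y) J \<le> s1 / 4 * t"
  proof -
    have "sr / 4 * t \<le> s1 / 4 * t" using sr tu by (intro mult_right_mono) auto
    then show ?thesis using sw.err_apply[of y] by (simp add: t_def)
  qed
  finally have v: "L2_set (ap K V w) J \<le> 5 / 4 * s1 * t" by simp
  have "(L2_set w K)\<^sup>2 = ip K w (ap I (transposed U) y)" by (simp add: L2_set_power2 w_def)
  also have "\<dots> = ip I (ap K U w) y" by (rule ip_ap[symmetric])
  also have "\<dots> \<le> u * t" unfolding u_def t_def using abs_ip_le[of I "ap K U w" y] by simp
  finally have w: "ip K w w \<le> u * t" by (simp add: L2_set_power2)
  have "u\<^sup>2 \<le> (L2_set (ap K V w) J)\<^sup>2 + sr / 4 * ip K w w"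
    using order_trans[OF abs_ge_self balance[of w]] by (simp add: u_def L2_set_power2)
  also have "(L2_set (ap K V w) J)\<^sup>2 \<le> (5 / 4 * s1 * t)\<^sup>2" using v by (intro power_mono) auto
  also have "sr / 4 * ip K w w \<le> s1 / 4 * (u * t)" using w sr by (intro mult_mono) auto
  finally have u2: "u * u \<le> 25 / 16 * (s1 * t * (s1 * t)) + s1 * t / 4 * u" by (simp add: power2_eq_square algebra_simps)
  \<comment> \<open>The quadratic inequality \<open>u2\<close> cannot hold beyond this point: for
    \<open>u > 2 * s1 * t\<close> its right side is at most 33/64 of \<open>u * u\<close>.\<close>
  have "u \<le> 2 * (s1 * t)"
  proof (rule ccontr)
    assume h: "\<not> u \<le> 2 * (s1 * t)"
    have x: "0 \<le> s1 * t" using s1 tu by simp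
    have "(s1 * t) * (s1 * t) \<le> (u / 2) * (u / 2)" using h x by (intro mult_mono) auto
    moreover have "s1 * t * u \<le> (u / 2) * u" using h x tu by (intro mult_right_mono) auto
    moreover have "0 < u * u" using h x by (intro mult_pos_pos) auto
    ultimately show False using u2 by (simp add: algebra_simps)
  qed
  then have "u * t \<le> 2 * (s1 * t) * t" using tu by (intro mult_right_mono)
  then have "ip K w w \<le> 2 * s1 * (t * t)" using w by (simp add: algebra_simps)
  then show ?thesis using L2_set_power2[of y I] by (simp add: w_def t_def power2_eq_square)
qed

text \<open>Row \<open>i\<close> of the matrix \<open>A\<close> of the overview; the matrix
  \<open>B\<close> is the same constant in the swapped instance.\<close>

definition residual :: "'a \<Rightarrow> nat \<Rightarrow> real" where
  "residual i a = ap I (co_kernel (range_kernel r P)) (\<lambda>i. U i a) i"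

text \<open>\<open>A V^T = (1 - P P^T) D\<close>: the projection annihilates the columns of the
  low-rank matrix, so in \<open>U V^T\<close> only the error survives.\<close>

lemma residual_mult:
  assumes i: "i \<in> I"
  shows "ap K V (residual i) j = ap I (co_kernel (range_kernel r P)) (\<lambda>i. D i j) i"
proof -
  let ?C = "co_kernel (range_kernel r P)"
  have "ap K V (residual i) j = (\<Sum>a<r. \<Sum>k\<in>I. V j a * (?C i k * U k a))"
    by (simp add: ap_def residual_def sum_distrib_left)
  also have "\<dots> = (\<Sum>k\<in>I. \<Sum>a<r. V j a * (?C i k * U k a))" by (rule sum.swap)
  also have "\<dots> = ap I ?C (\<lambda>k. \<Sum>a<r. U k a * V j a) i"
    by (simp add: ap_def sum_distrib_left mult_ac)
  also have "\<dots> = ap I ?C (\<lambda>k. D k j + ap K P (\<lambda>a. \<sigma> a * Q j a) k) i"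
    by (simp add: factor_err_def ap_def[of K P])
  also have "\<dots> = ap I ?C (\<lambda>k. D k j) i + ap I ?C (ap K P (\<lambda>a. \<sigma> a * Q j a)) i"
    by (simp add: ap_def[of I ?C] distrib_left sum.distrib)
  finally show ?thesis using co_range_kernel_kills[OF oP finI i] by simp
qed

text \<open>Applying \<open>factor_lower\<close> to every row of \<open>A\<close> bounds
  \<open>sr / 2 |A|_F^2\<close> by \<open>|A V^T|_F^2\<close>, which is at most
  \<open>|D|_F^2\<close> by \<open>residual_mult\<close> and contraction.\<close>

lemma residual_energy: "(\<Sum>i\<in>I. ip K (residual i) (residual i)) \<le> 2 / sr * (\<Sum>i\<in>I. \<Sum>j\<in>J. (D i j)\<^sup>2)"
proof -
  let ?C = "co_kernel (range_kernel r P)"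
  have C: "proj_kernel I ?C" by (intro proj_kernel_co_kernel finI proj_kernel_range_kernel oP)
  have "sr / 2 * (\<Sum>i\<in>I. ip K (residual i) (residual i)) \<le> (\<Sum>i\<in>I. ip J (ap K V (residual i)) (ap K V (residual i)))"
    unfolding sum_distrib_left by (intro sum_mono factor_lower)
  also have "\<dots> = (\<Sum>i\<in>I. \<Sum>j\<in>J. (ap I ?C (\<lambda>i. D i j) i)\<^sup>2)"
    unfolding ip_self_power2 by (intro sum.cong refl) (simp add: residual_mult)
  also have "\<dots> = (\<Sum>j\<in>J. \<Sum>i\<in>I. (ap I ?C (\<lambda>i. D i j) i)\<^sup>2)" by (rule sum.swap)
  also have "\<dots> \<le> (\<Sum>j\<in>J. \<Sum>i\<in>I. (D i j)\<^sup>2)"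
    unfolding ip_self_power2[symmetric] by (intro sum_mono proj_kernel_contraction[OF C])
  also have "\<dots> = (\<Sum>i\<in>I. \<Sum>j\<in>J. (D i j)\<^sup>2)" by (rule sum.swap)
  finally show ?thesis using sr by (simp add: field_simps)
qed

text \<open>Row \<open>i\<close> of \<open>P P^T U\<close> is \<open>U^T y\<close> with
  \<open>y\<close> the \<open>i\<close>-th row of \<open>P P^T\<close>, and
  \<open>|y| = |P_i|\<close>. So the rows of \<open>A\<close> inherit the incoherence of both
  \<open>U\<close> and \<open>P\<close>.\<close>

lemma residual_row_bound:
  assumes i: "i \<in> I"
  shows "ip K (residual i) (residual i) \<le> 2 * ip K (U i) (U i) + 4 * s1 * ip K (P i) (P i)"
proof -
  define y where "y = ap K P (P i)"
  have "residual i a = U i a - ap I (transposed U) y a" for a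
  proof -
    have "residual i a = U i a - (\<Sum>k\<in>I. range_kernel r P i k * U k a)"
      unfolding residual_def ap_co_kernel[OF finI i] by (simp add: ap_def)
    then show ?thesis by (simp add: ap_def y_def range_kernel_def mult_ac)
  qed
  then have "ip K (residual i) (residual i) = (\<Sum>a<r. (U i a - ap I (transposed U) y a)\<^sup>2)"
    by (simp add: ip_self_power2)
  also have "\<dots> \<le> (\<Sum>a<r. 2 * (U i a)\<^sup>2 + 2 * (ap I (transposed U) y a)\<^sup>2)"
  proof (rule sum_mono)
    fix a
    have "0 \<le> (U i a + ap I (transposed U) y a)\<^sup>2" by simp
    then show "(U i a - ap I (transposed U) y a)\<^sup>2 \<le> 2 * (U i a)\<^sup>2 + 2 * (ap I (transposed U) y a)\<^sup>2"
      unfolding power2_sum power2_diff by linarith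
  qed
  also have "\<dots> = 2 * ip K (U i) (U i) + 2 * ip K (ap I (transposed U) y) (ap I (transposed U) y)"
    by (simp add: ip_self_power2 sum.distrib sum_distrib_left)
  also have "ip K (ap I (transposed U) y) (ap I (transposed U) y) \<le> 2 * s1 * ip I y y" by (rule transp_apply_bound)
  also have "ip I y y = ip K (P i) (P i)" unfolding y_def by (rule orthonormal_isometry[OF oP])
  finally show ?thesis by simp
qed

end

section \<open>The tangent space and the restricted isometry\<close>

definition normal_kernel :: "nat \<Rightarrow> ('a \<Rightarrow> nat \<Rightarrow> real) \<Rightarrow> ('b \<Rightarrow> nat \<Rightarrow> real) \<Rightarrow> 'a \<times> 'b \<Rightarrow> 'a \<times> 'b \<Rightarrow> real" where
  "normal_kernel r P Q k l = co_kernel (range_kernel r P) (fst k) (fst l) * co_kernel (range_kernel r Q) (snd k) (snd l)"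

text \<open>The kernel of the projection onto the matrices \<open>P A\<^sup>T + B Q\<^sup>T\<close>.\<close>

definition tangent_kernel :: "nat \<Rightarrow> ('a \<Rightarrow> nat \<Rightarrow> real) \<Rightarrow> ('b \<Rightarrow> nat \<Rightarrow> real) \<Rightarrow> 'a \<times> 'b \<Rightarrow> 'a \<times> 'b \<Rightarrow> real" where
  "tangent_kernel r P Q = co_kernel (normal_kernel r P Q)"

lemma proj_kernel_tangent:
  assumes "finite I" "finite J" "orthonormal_cols I r P" "orthonormal_cols J r Q"
  shows "proj_kernel (I \<times> J) (tangent_kernel r P Q)"
  unfolding tangent_kernel_def normal_kernel_def[abs_def] using assms
  by (intro proj_kernel_co_kernel proj_kernel_tensor proj_kernel_range_kernel) auto

text \<open>The squared norm of a row is the diagonal entry \<open>1 - (1 - a) (1 - b)\<close>, at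
  most \<open>a + b\<close>, with \<open>a\<close> and \<open>b\<close> the squared row norms of
  \<open>P\<close> and \<open>Q\<close>.\<close>

lemma bessel_system_tangent:
  assumes fin: "finite I" "finite J" and o: "orthonormal_cols I r P" "orthonormal_cols J r Q"
    and M: "\<And>i j. i \<in> I \<Longrightarrow> j \<in> J \<Longrightarrow> ip {..<r} (P i) (P i) + ip {..<r} (Q j) (Q j) \<le> M" and "0 < M"
  shows "bessel_system (I \<times> J) (tangent_kernel r P Q) M"
proof
  note pk = proj_kernel_tangent[OF fin o]
  show "finite (I \<times> J)" using fin by simp
  show "0 < M" by fact
  show "(\<Sum>k\<in>I \<times> J. (ip (I \<times> J) (tangent_kernel r P Q k) f)\<^sup>2) \<le> ip (I \<times> J) f f" for f
    using proj_kernel_contraction[OF pk, of f]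
    unfolding ip_self_power2[of _ "ap _ _ _"] by (simp only: ap_def ip_def[of _ "tangent_kernel r P Q _"])
  fix k assume k: "k \<in> I \<times> J"
  define a where "a = ip {..<r} (P (fst k)) (P (fst k))"
  define b where "b = ip {..<r} (Q (snd k)) (Q (snd k))"
  have "ip (I \<times> J) (tangent_kernel r P Q k) (tangent_kernel r P Q k) = tangent_kernel r P Q k k"
    by (rule proj_kernel_row[OF pk k])
  also have "\<dots> = 1 - (1 - a) * (1 - b)"
    by (simp add: tangent_kernel_def normal_kernel_def co_kernel_def range_kernel_def a_def b_def ip_def)
  also have "\<dots> \<le> a + b" by (simp add: algebra_simps a_def b_def)
  also have "\<dots> \<le> M" using M k by (auto simp: a_def b_def)
  finally show "ip (I \<times> J) (tangent_kernel r P Q k) (tangent_kernel r P Q k) \<le> M" .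
qed

context near_factorization
begin

text \<open>The left projection turns \<open>D\<close> into \<open>A V^T\<close> by
  \<open>residual_mult\<close>; the right one then acts on \<open>V\<close> alone and produces
  \<open>B\<close>.\<close>

lemma normal_part:
  assumes ij: "i \<in> I" "j \<in> J"
  shows "ap (I \<times> J) (normal_kernel r P Q) (\<lambda>k. D (fst k) (snd k)) (i, j)
    = ip K (residual i) (near_factorization.residual J r Q V j)"
proof -
  interpret sw: near_factorization J I r Q \<sigma> P V U s1 sr by (rule swapped)
  let ?A = "co_kernel (range_kernel r P)" and ?B = "co_kernel (range_kernel r Q)"
  have "ap (I \<times> J) (normal_kernel r P Q) (\<lambda>k. D (fst k) (snd k)) (i, j)
     = (\<Sum>k\<in>I. \<Sum>l\<in>J. ?A i k * ?B j l * D k l)"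
    by (simp add: ap_def normal_kernel_def sum.cartesian_product split_def)
  also have "\<dots> = (\<Sum>l\<in>J. \<Sum>k\<in>I. ?A i k * ?B j l * D k l)" by (rule sum.swap)
  also have "\<dots> = (\<Sum>l\<in>J. ?B j l * ap I ?A (\<lambda>k. D k l) i)"
    by (simp add: ap_def sum_distrib_left mult_ac)
  also have "\<dots> = (\<Sum>l\<in>J. ?B j l * ap K V (residual i) l)" by (simp add: residual_mult[OF ij(1)])
  also have "\<dots> = ip J (?B j) (ap K V (residual i))" by (simp add: ip_def)
  also have "\<dots> = ip K (residual i) (ap J (transposed V) (?B j))" by (subst ip_commute) (rule ip_ap)
  also have "ap J (transposed V) (?B j) = sw.residual j"
    by (rule ext) (simp add: sw.residual_def ap_def mult.commute)
  finally show ?thesis .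
qed


end

section \<open>Deterministic isometry for a good sample\<close>

text \<open>The error budget: \<open>rip\<close> controls only the tangential part \<open>z\<close>,
  with factors \<open>1 - 3/4 \<epsilon>\<close> and \<open>1 + \<epsilon>/4\<close> after square
  roots are taken. The normal part \<open>R\<close> costs \<open>\<epsilon>/8\<close> on either
  side, through its energy on \<open>E\<close> and through the discrepancy on
  \<open>W\<close>.\<close>

theorem near_factorization_isometry:
  fixes n1 n2 :: nat
  defines "E \<equiv> {..<n1} \<times> {..<n2}"
  assumes nf: "near_factorization {..<n1} {..<n2} r P \<sigma> Q U V s1 sr"
    and f: "f = (\<lambda>k. factor_err r P \<sigma> Q U V (fst k) (snd k))"
    and z: "z = ap E (tangent_kernel r P Q) f"
    and W: "W \<subseteq> E" and ld: "low_discrepancy n1 n2 p W" and p: "0 < p" and \<epsilon>: "0 < \<epsilon>" "\<epsilon> < 1"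
    and rip: "\<bar>(\<Sum>k\<in>W. (z k)\<^sup>2) - p * (\<Sum>k\<in>E. (z k)\<^sup>2)\<bar> \<le> \<epsilon> / 2 * p * ip E f f"
    and small: "L2_set f E \<le> \<epsilon> * sr / 144"
    and bx: "\<And>i. i < n1 \<Longrightarrow> 2 * ip {..<r} (U i) (U i) + 4 * s1 * ip {..<r} (P i) (P i) \<le> bx" "0 \<le> bx"
    and b_y: "\<And>j. j < n2 \<Longrightarrow> 2 * ip {..<r} (V j) (V j) + 4 * s1 * ip {..<r} (Q j) (Q j) \<le> b_y" "0 \<le> b_y"
    and incoh: "10240 * (sqrt (real (max n1 n2) * p) * sqrt (bx * b_y)) \<le> p * \<epsilon>\<^sup>2 * sr"
  shows "(1 - \<epsilon>) * (sqrt p * L2_set f E) \<le> L2_set f W" "L2_set f W \<le> (1 + \<epsilon>) * (sqrt p * L2_set f E)"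
proof -
  interpret near_factorization "{..<n1}" "{..<n2}" r P \<sigma> Q U V s1 sr by (rule nf)
  interpret sw: near_factorization "{..<n2}" "{..<n1}" r Q \<sigma> P V U s1 sr by (rule swapped)
  have finE: "finite E" by (simp add: E_def)
  have finW: "finite W" using W finE finite_subset by blast
  define F where "F = L2_set f E"
  have F0: "0 \<le> F" by (simp add: F_def)
  have FF: "(\<Sum>i<n1. \<Sum>j<n2. (D i j)\<^sup>2) = F\<^sup>2"
    by (simp add: F_def L2_set_power2 ip_self_power2 E_def f sum.cartesian_product split_def)
  define R where "R k = ip K (residual (fst k)) (sw.residual (snd k))" for k
  have dec: "f k = z k + R k" if "k \<in> E" for k
  proof -
    obtain i j where k: "k = (i, j)" by (cases k)
    have ij: "i \<in> {..<n1}" "j \<in> {..<n2}" using that k by (auto simp: E_def)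
    have "z k = f k - ap E (normal_kernel r P Q) f k"
      unfolding z tangent_kernel_def by (rule ap_co_kernel[OF finE that])
    also have "ap E (normal_kernel r P Q) f k = R k"
      unfolding k E_def f normal_part[OF ij] by (simp add: R_def)
    finally show ?thesis by simp
  qed
  define x where "x i = ip K (residual i) (residual i)" for i
  define y where "y j = ip K (sw.residual j) (sw.residual j)" for j
  define X where "X = (\<Sum>i<n1. x i)"
  define Y where "Y = (\<Sum>j<n2. y j)"
  have x0: "0 \<le> x i" "0 \<le> y i" for i by (auto simp: x_def y_def)
  have XY0: "0 \<le> X" "0 \<le> Y" using x0 by (auto simp: X_def Y_def intro: sum_nonneg)
  have Xle: "X \<le> 2 / sr * F\<^sup>2" using residual_energy unfolding FF X_def x_def .
  have Yle: "Y \<le> 2 / sr * F\<^sup>2"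
  proof -
    have "(\<Sum>j<n2. \<Sum>i<n1. (sw.D j i)\<^sup>2) = F\<^sup>2"
      unfolding factor_err_swap[of r Q \<sigma> P V U] FF[symmetric] by (rule sum.swap)
    then show ?thesis using sw.residual_energy unfolding Y_def y_def by simp
  qed
  have R2: "(R k)\<^sup>2 \<le> x (fst k) * y (snd k)" for k
    unfolding R_def x_def y_def by (rule ip_Cauchy_Schwarz)
  have XYF: "X * Y \<le> (2 / sr * F\<^sup>2) * (2 / sr * F\<^sup>2)" using Xle Yle XY0 sr by (intro mult_mono) auto
  have "(L2_set R E)\<^sup>2 \<le> (\<Sum>k\<in>E. x (fst k) * y (snd k))"
    unfolding L2_set_power2 ip_self_power2 by (intro sum_mono R2)
  also have "\<dots> = X * Y" by (simp add: E_def X_def Y_def sum_product sum.cartesian_product split_def)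
  also have "\<dots> \<le> (2 / sr * F\<^sup>2)\<^sup>2" using XYF by (simp only: power2_eq_square)
  finally have "L2_set R E \<le> 2 / sr * F\<^sup>2" using sr by (intro power2_le_imp_le[of "L2_set R E"]) auto
  also have "\<dots> \<le> \<epsilon> / 8 * F"
  proof -
    have "F * F \<le> \<epsilon> * sr / 144 * F" using small F0 by (intro mult_right_mono) (auto simp: F_def)
    also have "\<dots> \<le> \<epsilon> * sr / 16 * F" using \<epsilon> sr F0 by (intro mult_right_mono) auto
    finally show ?thesis using sr by (simp add: power2_eq_square field_simps)
  qed
  finally have RE: "L2_set R E \<le> \<epsilon> / 8 * F" .
  have RW: "L2_set R W \<le> \<epsilon> / 8 * (sqrt p * F)"
  proof (rule power2_le_imp_le)
    have xb: "x i \<le> bx" if "i < n1" for i using residual_row_bound[of i] bx(1)[OF that] that by (simp add: x_def)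
    have yb: "y j \<le> b_y" if "j < n2" for j using sw.residual_row_bound[of j] b_y(1)[OF that] that by (simp add: y_def)
    have "(L2_set R W)\<^sup>2 \<le> (\<Sum>k\<in>W. x (fst k) * y (snd k))"
      unfolding L2_set_power2 ip_self_power2 by (intro sum_mono R2)
    also have "\<dots> = (\<Sum>(i, j)\<in>W. x i * y j)" by (simp add: split_def)
    also have "\<dots> \<le> 40 * (p * X * Y + sqrt (real (max n1 n2) * p) * sqrt (bx * X) * sqrt (b_y * Y))"
      unfolding X_def Y_def
      using W p by (intro low_discrepancy_bilinear[OF ld]) (auto simp: E_def x0 xb yb bx b_y)
    also have "sqrt (real (max n1 n2) * p) * sqrt (bx * X) * sqrt (b_y * Y) = sqrt (real (max n1 n2) * p) * sqrt (bx * b_y) * sqrt (X * Y)"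
      by (simp add: real_sqrt_mult)
    \<comment> \<open>The constant in \<open>incoh\<close> is \<open>10240 = 40 * 2 * 128\<close>,
      so the square-root term becomes \<open>\<epsilon>\<^sup>2 / 128\<close>.\<close>
    also have "40 * (p * X * Y + sqrt (real (max n1 n2) * p) * sqrt (bx * b_y) * sqrt (X * Y))
      \<le> 40 * (p * (2 / sr * F\<^sup>2 * (2 / sr * F\<^sup>2)) + p * \<epsilon>\<^sup>2 * sr / 10240 * (2 / sr * F\<^sup>2))"
    proof (intro mult_left_mono add_mono)
      show "p * X * Y \<le> p * (2 / sr * F\<^sup>2 * (2 / sr * F\<^sup>2))"
        unfolding mult.assoc[of p] using XYF p by (intro mult_left_mono) auto
      have "sqrt (X * Y) \<le> sqrt ((2 / sr * F\<^sup>2)\<^sup>2)" using XYF by (simp only: real_sqrt_le_iff power2_eq_square)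
      also have "\<dots> = 2 / sr * F\<^sup>2" using sr by (intro real_sqrt_unique) auto
      finally show "sqrt (real (max n1 n2) * p) * sqrt (bx * b_y) * sqrt (X * Y) \<le> p * \<epsilon>\<^sup>2 * sr / 10240 * (2 / sr * F\<^sup>2)"
        using incoh p XY0 sr \<epsilon> by (intro mult_mono) auto
    qed auto
    also have "\<dots> = p * F\<^sup>2 * (160 * (F / sr)\<^sup>2 + \<epsilon>\<^sup>2 / 128)"
      using sr by (simp add: power2_eq_square field_simps)
    \<comment> \<open>Each summand gets \<open>\<epsilon>\<^sup>2 / 128\<close>. For the first this
      asks for \<open>160 * 128 = 20480 \<le> 144^2\<close>, which is the origin of 144.\<close>
    also have "\<dots> \<le> p * F\<^sup>2 * (\<epsilon>\<^sup>2 / 64)"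
    proof (rule mult_left_mono)
      have "F / sr \<le> \<epsilon> / 144" using small sr by (simp add: F_def pos_divide_le_eq)
      then have "(F / sr)\<^sup>2 \<le> (\<epsilon> / 144)\<^sup>2" using F0 sr by (intro power_mono) auto
      also have "\<dots> = \<epsilon>\<^sup>2 / 20736" by (simp add: power_divide)
      finally show "160 * (F / sr)\<^sup>2 + \<epsilon>\<^sup>2 / 128 \<le> \<epsilon>\<^sup>2 / 64"
        using zero_le_power2[of "F / sr"] by linarith
    qed (use p in auto)
    also have "\<dots> = (\<epsilon> / 8 * (sqrt p * F))\<^sup>2" using p by (simp add: power_mult_distrib power_divide)
    finally show "(L2_set R W)\<^sup>2 \<le> (\<epsilon> / 8 * (sqrt p * F))\<^sup>2" .
  qed (use \<epsilon> p F0 in auto)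
  have zE: "(\<Sum>k\<in>E. (z k)\<^sup>2) = (L2_set z E)\<^sup>2" and zW: "(\<Sum>k\<in>W. (z k)\<^sup>2) = (L2_set z W)\<^sup>2"
    and fE: "ip E f f = F\<^sup>2"
    by (simp_all add: L2_set_power2 ip_self_power2 F_def)
  have zup: "L2_set z E \<le> F"
  proof -
    have "ip E z z \<le> ip E f f"
      unfolding z E_def by (intro proj_kernel_contraction proj_kernel_tangent oP oQ) auto
    then show ?thesis unfolding F_def L2_set_eq_sqrt_ip by simp
  qed
  have "F = L2_set (\<lambda>k. z k + R k) E" unfolding F_def by (intro L2_set_cong) (auto simp: dec)
  also have "\<dots> \<le> L2_set z E + L2_set R E" by (rule L2_set_triangle_ineq)
  finally have zlow: "(1 - \<epsilon> / 8) * F \<le> L2_set z E" using RE by (simp add: algebra_simps)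
  have fW: "L2_set f W = L2_set (\<lambda>k. z k + R k) W" using W by (intro L2_set_cong) (auto simp: dec)
  have sp: "(sqrt p)\<^sup>2 = p" using p by simp
  have pF: "0 \<le> p * F\<^sup>2" using p by simp
  have "(L2_set z W)\<^sup>2 \<le> p * (L2_set z E)\<^sup>2 + \<epsilon> / 2 * p * F\<^sup>2"
    using rip unfolding zE zW fE by linarith
  also have "\<dots> \<le> p * F\<^sup>2 + \<epsilon> / 2 * p * F\<^sup>2" using zup p by (intro add_right_mono mult_left_mono power_mono) auto
  also have "\<dots> = p * F\<^sup>2 * (1 + \<epsilon> / 2)" by (simp add: algebra_simps)
  also have "\<dots> \<le> p * F\<^sup>2 * (1 + \<epsilon> / 4)\<^sup>2" using pF by (intro mult_left_mono) (simp_all add: power2_eq_square algebra_simps)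
  also have "\<dots> = ((1 + \<epsilon> / 4) * (sqrt p * F))\<^sup>2" by (simp add: power_mult_distrib sp)
  finally have zWup: "L2_set z W \<le> (1 + \<epsilon> / 4) * (sqrt p * F)"
    by (rule power2_le_imp_le) (use \<epsilon> p F0 in auto)
  have "L2_set f W \<le> L2_set z W + L2_set R W" unfolding fW by (rule L2_set_triangle_ineq)
  also have "\<dots> \<le> (1 + \<epsilon> / 4) * (sqrt p * F) + \<epsilon> / 8 * (sqrt p * F)" using zWup RW by simp
  also have "\<dots> = (1 + 3 / 8 * \<epsilon>) * (sqrt p * F)" by (simp add: algebra_simps)
  also have "\<dots> \<le> (1 + \<epsilon>) * (sqrt p * F)" using \<epsilon> p F0 by (intro mult_right_mono) auto
  finally show "L2_set f W \<le> (1 + \<epsilon>) * (sqrt p * L2_set f E)" by (simp add: F_def)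
  have "((1 - 3 / 4 * \<epsilon>) * (sqrt p * F))\<^sup>2 = p * F\<^sup>2 * (1 - 3 / 4 * \<epsilon>)\<^sup>2" by (simp add: power_mult_distrib sp)
  also have "\<dots> \<le> p * F\<^sup>2 * ((1 - \<epsilon> / 8)\<^sup>2 - \<epsilon> / 2)"
  proof (rule mult_left_mono)
    have "(1 - \<epsilon> / 8)\<^sup>2 - \<epsilon> / 2 - (1 - 3 / 4 * \<epsilon>)\<^sup>2 = 3 / 4 * \<epsilon> - 35 / 64 * (\<epsilon> * \<epsilon>)"
      by (simp add: power2_eq_square algebra_simps)
    moreover have "\<epsilon> * \<epsilon> \<le> \<epsilon> * 1" using \<epsilon> by (intro mult_left_mono) auto
    ultimately show "(1 - 3 / 4 * \<epsilon>)\<^sup>2 \<le> (1 - \<epsilon> / 8)\<^sup>2 - \<epsilon> / 2" using \<epsilon>(1) by linarith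
  qed (use p in auto)
  also have "\<dots> = p * ((1 - \<epsilon> / 8) * F)\<^sup>2 - \<epsilon> / 2 * p * F\<^sup>2"
    by (simp only: power_mult_distrib right_diff_distrib) (simp add: mult_ac)
  also have "\<dots> \<le> p * (L2_set z E)\<^sup>2 - \<epsilon> / 2 * p * F\<^sup>2"
    using zlow p \<epsilon> F0 by (intro diff_right_mono mult_left_mono power_mono) auto
  also have "\<dots> \<le> (L2_set z W)\<^sup>2" using rip unfolding zE zW fE by linarith
  finally have zWlow: "(1 - 3 / 4 * \<epsilon>) * (sqrt p * F) \<le> L2_set z W"
    by (rule power2_le_imp_le) auto
  have "L2_set z W = L2_set (\<lambda>k. f k + - R k) W" using W by (intro L2_set_cong) (auto simp: dec)
  also have "\<dots> \<le> L2_set f W + L2_set (\<lambda>k. - R k) W" by (rule L2_set_triangle_ineq)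
  also have "L2_set (\<lambda>k. - R k) W = L2_set R W" by (simp add: L2_set_def)
  finally have low: "(1 - 3 / 4 * \<epsilon>) * (sqrt p * F) - \<epsilon> / 8 * (sqrt p * F) \<le> L2_set f W" using zWlow RW by simp
  have "(1 - \<epsilon>) * (sqrt p * F) \<le> (1 - 7 / 8 * \<epsilon>) * (sqrt p * F)" using \<epsilon> p F0 by (intro mult_right_mono) auto
  also have "\<dots> = (1 - 3 / 4 * \<epsilon>) * (sqrt p * F) - \<epsilon> / 8 * (sqrt p * F)" by (simp add: algebra_simps)
  finally show "(1 - \<epsilon>) * (sqrt p * L2_set f E) \<le> L2_set f W" using low by (simp add: F_def)
qed

section \<open>Failure probability of the two sampling events\<close>

lemma sampling_failure:
  fixes n1 n2 r :: nat and \<beta> \<mu> \<epsilon> p :: real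
  defines "n \<equiv> max n1 n2" and "E \<equiv> {..<n1} \<times> {..<n2}"
  assumes \<beta>: "0 < \<beta>" "\<beta> \<le> 1" and n12: "1 \<le> n1" "1 \<le> n2" and n: "2 \<le> n" and r: "1 \<le> r" and \<mu>: "1 \<le> \<mu>"
    and p: "0 < p" "p \<le> 1" and \<epsilon>: "0 < \<epsilon>" "\<epsilon> < 1"
    and large: "(102400 / \<beta>)\<^sup>2 * (\<mu> * real r) * ln (real n) \<le> \<epsilon>\<^sup>2 * (real n * p)"
    and bs: "bessel_system E G (2 * \<mu> * real r / (\<beta> * real n))"
  shows "(real (n1 * n2) + 1) * bern p E (\<lambda>W. of_bool
     ((\<exists>f. \<epsilon> / 2 * p * ip E f f < \<bar>ip E f (bessel_system.frame_op E G p W f)\<bar>) \<or> \<not> low_discrepancy n1 n2 p W))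
    \<le> 3 / real n ^ 3"
proof -
  define x where "x = real n"
  define M where "M = 2 * \<mu> * real r / (\<beta> * x)"
  \<comment> \<open>The largest real moment order that \<open>frame_op_tail\<close> admits for
    accuracy \<open>\<epsilon> / 2\<close>; halving the accuracy turns 10 into 40.\<close>
  define q where "q = \<epsilon>\<^sup>2 * p / (40 * exp 1 * M)"
  define Q where "Q = nat \<lfloor>q\<rfloor>"
  interpret bessel_system E G M using bs by (simp add: M_def x_def)
  have x2: "2 \<le> x" using n by (simp add: x_def)
  have mr: "1 \<le> \<mu> * real r" using mult_mono[of 1 \<mu> 1 "real r"] \<mu> r by simp
  have ln2: "1 / 2 \<le> ln x"
  proof -
    have "ln 2 \<le> ln x" using x2 by simp
    then show ?thesis using ln2_ge_two_thirds by linarith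
  qed
  have C: "102400 / \<beta> \<le> (102400 / \<beta>)\<^sup>2 * \<beta>" "1 \<le> 102400 / \<beta>"
    using \<beta> by (auto simp: power2_eq_square field_simps)
  have e3: "exp 1 \<le> (3::real)" by (rule exp_le)
  \<comment> \<open>Eight logarithms are wanted for the power \<open>x ^ 8\<close>; rounding
    \<open>q\<close> down costs at most 1, which is below the other two.\<close>
  have q1: "10 * ln x \<le> q"
  proof -
    have "10 * ln x * (40 * exp 1 * M) \<le> 10 * ln x * (40 * 3 * M)"
      using e3 M ln2 by (intro mult_left_mono mult_right_mono) auto
    also have "\<dots> = 2400 * (\<mu> * real r) * ln x / (\<beta> * x)" by (simp add: M_def)
    also have "\<dots> \<le> (102400 / \<beta>)\<^sup>2 * \<beta> * (\<mu> * real r) * ln x / (\<beta> * x)"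
    proof -
      have "2400 \<le> 102400 / \<beta>" using \<beta> by (simp add: field_simps)
      then have "2400 \<le> (102400 / \<beta>)\<^sup>2 * \<beta>" using C(1) by linarith
      then show ?thesis using mr ln2 \<beta> x2 by (intro divide_right_mono mult_right_mono) auto
    qed
    also have "\<dots> = (102400 / \<beta>)\<^sup>2 * (\<mu> * real r) * ln x / x" using \<beta> by simp
    also have "\<dots> \<le> \<epsilon>\<^sup>2 * p" using large x2 by (simp add: x_def pos_divide_le_eq mult_ac)
    finally show ?thesis unfolding q_def using M by (simp add: pos_le_divide_eq)
  qed
  have Q: "real Q \<le> q" "q - 1 \<le> real Q" "8 * ln x \<le> real Q"
  proof -
    have "0 \<le> q" using q1 ln2 by linarith
    then show 1: "real Q \<le> q" unfolding Q_def by simp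
    show 2: "q - 1 \<le> real Q" using \<open>0 \<le> q\<close> unfolding Q_def by linarith
    show "8 * ln x \<le> real Q" using 2 q1 ln2 by linarith
  qed
  have Qpos: "0 < Q"
  proof -
    have "0 < real Q" using Q(3) ln2 by linarith
    then show ?thesis by simp
  qed
  have "bern p E (\<lambda>W. of_bool (\<exists>f. \<bar>ip E f (frame_op p W f)\<bar> > \<epsilon> / 2 * p * ip E f f)) \<le> exp (- real Q) * real (card E)"
  proof (rule frame_op_tail[OF p _ _ Qpos])
    have "real Q * (10 * exp 1 * M) \<le> q * (10 * exp 1 * M)" using Q(1) M by (intro mult_right_mono) auto
    also have "\<dots> = (\<epsilon> / 2)\<^sup>2 * p" using M by (simp add: q_def power2_eq_square)
    finally show "10 * exp 1 * real Q * M \<le> (\<epsilon> / 2)\<^sup>2 * p" by (simp add: mult_ac)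
  qed (use \<epsilon> in auto)
  also have "\<dots> \<le> 1 / x ^ 8 * x\<^sup>2"
  proof (rule mult_mono)
    have "exp (- real Q) \<le> exp (- (8 * ln x))" using Q(3) by simp
    also have "\<dots> = 1 / x ^ 8" using x2 by (simp add: exp_minus exp_of_nat_mult[of 8, simplified] divide_inverse)
    finally show "exp (- real Q) \<le> 1 / x ^ 8" .
    have "n1 * n2 \<le> n * n" by (intro mult_mono) (auto simp: n_def)
    then have "real (n1 * n2) \<le> real (n * n)" by (rule of_nat_mono)
    then show "real (card E) \<le> x\<^sup>2" by (simp add: E_def card_cartesian_product x_def power2_eq_square)
  qed (use x2 in auto)
  finally have A: "bern p E (\<lambda>W. of_bool (\<exists>f. \<bar>ip E f (frame_op p W f)\<bar> > \<epsilon> / 2 * p * ip E f f)) \<le> x\<^sup>2 / x ^ 8" by simp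
  interpret random_bipartite n1 n2 n p "x * p"
    by unfold_locales (use n12 p in \<open>auto simp: n_def x_def\<close>)
  have B: "bern p E (\<lambda>W. of_bool (\<not> low_discrepancy n1 n2 p W)) \<le> 3 / x ^ 8"
    unfolding E_def x_def
  proof (rule low_discrepancy_tail[unfolded x_def])
    have "2 * ln x \<le> (102400 / \<beta>)\<^sup>2 * (\<mu> * real r) * ln x"
    proof (rule mult_right_mono)
      have "2 \<le> 102400 / \<beta>" using \<beta> by (simp add: field_simps)
      also have "\<dots> \<le> (102400 / \<beta>)\<^sup>2" using C(2) by (simp add: self_le_power)
      finally show "2 \<le> (102400 / \<beta>)\<^sup>2 * (\<mu> * real r)"
        using mult_mono[of 2 "(102400 / \<beta>)\<^sup>2" 1 "\<mu> * real r"] mr by simp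
    qed (use ln2 in auto)
    also have "\<dots> \<le> \<epsilon>\<^sup>2 * (x * p)" using large by (simp add: x_def)
    also have "\<dots> \<le> 1 * (x * p)" using \<epsilon> x2 p by (intro mult_right_mono) (auto simp: power_le_one)
    finally show "2 * ln (real n) \<le> real n * p" by (simp add: x_def)
  qed
  let ?bad = "\<lambda>W. (\<exists>f. \<epsilon> / 2 * p * ip E f f < \<bar>ip E f (frame_op p W f)\<bar>) \<or> \<not> low_discrepancy n1 n2 p W"
  have "bern p E (\<lambda>W. of_bool (?bad W))
     \<le> bern p E (\<lambda>W. of_bool (\<exists>f. \<bar>ip E f (frame_op p W f)\<bar> > \<epsilon> / 2 * p * ip E f f) + of_bool (\<not> low_discrepancy n1 n2 p W))"
    using p by (intro bern_mono) (auto simp: of_bool_def)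
  also have "\<dots> \<le> x\<^sup>2 / x ^ 8 + 3 / x ^ 8" unfolding bern_add using A B by (rule add_mono)
  also have "\<dots> = (x\<^sup>2 + 3) / x ^ 8" by (simp add: add_divide_distrib)
  finally have AB: "bern p E (\<lambda>W. of_bool (?bad W)) \<le> (x\<^sup>2 + 3) / x ^ 8" .
  have "real (n1 * n2) \<le> x\<^sup>2"
    using mult_mono[of "real n1" x "real n2" x] by (simp add: x_def n_def power2_eq_square)
  then have "(real (n1 * n2) + 1) * bern p E (\<lambda>W. of_bool (?bad W)) \<le> (x\<^sup>2 + 1) * ((x\<^sup>2 + 3) / x ^ 8)"
    using p AB by (intro mult_mono bern_nonneg) auto
  \<comment> \<open>The conversion factor and the failure bound multiply to at most
    \<open>4 / x ^ 4\<close>, and \<open>4 \<le> 3 * x\<close>.\<close>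
  also have "\<dots> \<le> 3 / x ^ 3"
  proof -
    have x4: "4 \<le> x\<^sup>2" using power_mono[OF x2, of 2] by simp
    have "(x\<^sup>2 + 1) * (x\<^sup>2 + 3) \<le> (2 * x\<^sup>2) * (2 * x\<^sup>2)" using x4 by (intro mult_mono) auto
    also have "\<dots> = 4 * x ^ 4" by (simp add: power2_eq_square power4_eq_xxxx)
    also have "\<dots> \<le> 3 * x ^ 5"
    proof -
      have "4 * x ^ 4 \<le> 3 * x * x ^ 4" using x2 by (intro mult_right_mono) auto
      then show ?thesis by (simp add: eval_nat_numeral mult_ac)
    qed
    finally have "(x\<^sup>2 + 1) * (x\<^sup>2 + 3) / x ^ 8 \<le> 3 * x ^ 5 / x ^ 8" using x2 by (intro divide_right_mono) auto
    also have "3 * x ^ 5 / x ^ 8 = 3 / x ^ 3" using x2 by (simp add: eval_nat_numeral field_simps)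
    finally show ?thesis by simp
  qed
  finally show ?thesis by (simp add: x_def)
qed

section \<open>Singular values\<close>

text \<open>Sylvester's identity, from two block eliminations of the matrix with blocks \<open>x\<close>, \<open>A\<close>, \<open>B\<close>, \<open>1\<close>.\<close>

lemma char_poly_mult_commute:
  fixes A B :: "'a :: idom mat"
  assumes A: "A \<in> carrier_mat n m" and B: "B \<in> carrier_mat m n"
  shows "char_poly (A * B) * [:0, 1:] ^ m = char_poly (B * A) * [:0, 1:] ^ n"
proof -
  let ?h = "map_mat (\<lambda>a. [:a:])"
  define a where "a = ?h A"
  define b where "b = ?h B"
  define a' where "a' = ?h (- A)"
  define b' where "b' = ?h (- B)"
  define xn where "xn = [:0, 1:] \<cdot>\<^sub>m (1\<^sub>m n :: 'a poly mat)"
  define xm where "xm = [:0, 1:] \<cdot>\<^sub>m (1\<^sub>m m :: 'a poly mat)"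
  have car: "a \<in> carrier_mat n m" "b \<in> carrier_mat m n" "a' \<in> carrier_mat n m" "b' \<in> carrier_mat m n"
    "xn \<in> carrier_mat n n" "xm \<in> carrier_mat m m"
    using A B by (auto simp: a_def b_def a'_def b'_def xn_def xm_def)
  have mA: "- A \<in> carrier_mat n m" and mB: "- B \<in> carrier_mat m n" using A B by auto
  have cpn: "char_poly_matrix (A * B) = xn + a * b'"
  proof -
    have "a * b' = ?h (A * (- B))" unfolding a_def b'_def by (rule map_poly_mult(1)[OF A mB, symmetric])
    also have "A * (- B) = - (A * B)" using A B by simp
    finally show ?thesis using A B unfolding char_poly_matrix_def xn_def by (auto intro!: eq_matI)
  qed
  have cpm: "char_poly_matrix (B * A) = b * a' + xm"
  proof -
    have "b * a' = ?h (B * (- A))" unfolding b_def a'_def by (rule map_poly_mult(1)[OF B mA, symmetric])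
    also have "B * (- A) = - (B * A)" using A B by simp
    finally show ?thesis using A B unfolding char_poly_matrix_def xm_def by (auto intro!: eq_matI)
  qed
  define M where "M = four_block_mat xn a b (1\<^sub>m m)"
  have M: "M \<in> carrier_mat (n + m) (n + m)" using car by (auto simp: M_def)
  define L1 where "L1 = four_block_mat (1\<^sub>m n) (0\<^sub>m n m) b' (1\<^sub>m m)"
  define L2 where "L2 = four_block_mat (1\<^sub>m n) a' (0\<^sub>m m n) xm"
  have L: "L1 \<in> carrier_mat (n + m) (n + m)" "L2 \<in> carrier_mat (n + m) (n + m)"
    using car by (auto simp: L1_def L2_def)
  have bb: "b + b' = 0\<^sub>m m n" unfolding b_def b'_def using B by (auto intro!: eq_matI)
  have aa: "a + a' = 0\<^sub>m n m" unfolding a_def a'_def using A by (auto intro!: eq_matI)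
  have "M * L1 = four_block_mat (xn * 1\<^sub>m n + a * b') (xn * 0\<^sub>m n m + a * 1\<^sub>m m)
      (b * 1\<^sub>m n + 1\<^sub>m m * b') (b * 0\<^sub>m n m + 1\<^sub>m m * 1\<^sub>m m)"
    unfolding M_def L1_def by (rule mult_four_block_mat) (use car in auto)
  also have "\<dots> = four_block_mat (char_poly_matrix (A * B)) a (0\<^sub>m m n) (1\<^sub>m m)"
    using car bb by (simp add: cpn)
  finally have 1: "M * L1 = four_block_mat (char_poly_matrix (A * B)) a (0\<^sub>m m n) (1\<^sub>m m)" .
  have "det (M * L1) = char_poly (A * B)"
    unfolding 1 char_poly_def
    by (subst det_four_block_mat_lower_left_zero[of _ n _ m]) (use A B car in auto)
  moreover have "det L1 = 1" unfolding L1_def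
    by (subst det_four_block_mat_upper_right_zero[of _ n _ m]) (use car in auto)
  ultimately have dM: "det M = char_poly (A * B)" using det_mult[OF M L(1)] by simp
  have top: "xn * a' + a * xm = 0\<^sub>m n m"
  proof -
    have "xn * a' + a * xm = [:0, 1:] \<cdot>\<^sub>m (a + a')"
      using car unfolding xn_def xm_def
      by (subst mult_smult_assoc_mat[of _ n n _ m], simp, simp, subst mult_smult_distrib[of _ n m _ m])
        (auto intro!: eq_matI simp: algebra_simps)
    then show ?thesis unfolding aa by (auto intro!: eq_matI)
  qed
  have "M * L2 = four_block_mat (xn * 1\<^sub>m n + a * 0\<^sub>m m n) (xn * a' + a * xm)
      (b * 1\<^sub>m n + 1\<^sub>m m * 0\<^sub>m m n) (b * a' + 1\<^sub>m m * xm)"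
    unfolding M_def L2_def by (rule mult_four_block_mat) (use car in auto)
  also have "\<dots> = four_block_mat xn (0\<^sub>m n m) b (char_poly_matrix (B * A))"
    using car top by (simp add: cpm)
  finally have 2: "M * L2 = four_block_mat xn (0\<^sub>m n m) b (char_poly_matrix (B * A))" .
  have "det (M * L2) = [:0, 1:] ^ n * char_poly (B * A)"
    unfolding 2 char_poly_def
    by (subst det_four_block_mat_upper_right_zero[of _ n _ m]) (use A B car in \<open>auto simp: xn_def\<close>)
  moreover have "det L2 = [:0, 1:] ^ m" unfolding L2_def
    by (subst det_four_block_mat_lower_left_zero[of _ n _ m]) (use car in \<open>auto simp: xm_def\<close>)
  ultimately show ?thesis using det_mult[OF M L(2)] dM by (simp add: mult.commute)
qed

text \<open>\<open>proots\<close> collects real roots only, so the length requires that the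
  characteristic polynomial splits. The decomposition gives this without the spectral theorem:
  \<open>X^T X = Q B\<close> with \<open>B = S^T S Q^T\<close>, and the commuted product
  \<open>B Q = S^T S\<close> is diagonal. The length keeps the indices up to \<open>r\<close> inside
  the list, where its ordering can be used.\<close>

lemma length_singular_values:
  assumes X: "X \<in> carrier_mat n1 n2" and svd: "reduced_svd r X P S Q"
  shows "length (singular_values X) = n2"
proof -
  have c: "P \<in> carrier_mat n1 r" "S \<in> carrier_mat r r" "Q \<in> carrier_mat n2 r"
    and o: "transpose_mat P * P = 1\<^sub>m r" "transpose_mat Q * Q = 1\<^sub>m r"
    and d: "diagonal_mat S" and eq: "X = P * S * transpose_mat Q"
    using svd X by (auto simp: reduced_svd_def)
  let ?B = "transpose_mat S * S * transpose_mat Q"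
  have ct: "transpose_mat P \<in> carrier_mat r n1" "transpose_mat S \<in> carrier_mat r r" "transpose_mat Q \<in> carrier_mat r n2"
    using c by auto
  have "transpose_mat (P * S * transpose_mat Q) = transpose_mat (transpose_mat Q) * transpose_mat (P * S)"
    using c ct by (intro transpose_mult) auto
  also have "transpose_mat (P * S) = transpose_mat S * transpose_mat P"
    using c by (intro transpose_mult) auto
  finally have "transpose_mat X = Q * (transpose_mat S * transpose_mat P)"
    unfolding eq by simp
  then have "transpose_mat X * X = Q * (transpose_mat S * transpose_mat P) * (P * S * transpose_mat Q)"
    by (simp only: eq)
  also have "P * S * transpose_mat Q = P * (S * transpose_mat Q)"
    using c ct by (intro assoc_mult_mat) auto
  also have "Q * (transpose_mat S * transpose_mat P) * (P * (S * transpose_mat Q))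
      = Q * (transpose_mat S * transpose_mat P * (P * (S * transpose_mat Q)))"
    by (rule assoc_mult_mat[of _ n2 r _ n1 _ n2]) (use c ct in auto)
  also have "transpose_mat S * transpose_mat P * (P * (S * transpose_mat Q))
      = transpose_mat S * (transpose_mat P * (P * (S * transpose_mat Q)))"
    by (rule assoc_mult_mat[of _ r r _ n1 _ n2]) (use c ct in auto)
  also have "transpose_mat P * (P * (S * transpose_mat Q)) = transpose_mat P * P * (S * transpose_mat Q)"
    by (rule assoc_mult_mat[of _ r n1 _ r _ n2, symmetric]) (use c ct in auto)
  also have "\<dots> = S * transpose_mat Q" unfolding o using c ct by (intro left_mult_one_mat) auto
  also have "transpose_mat S * (S * transpose_mat Q) = ?B"
    by (rule assoc_mult_mat[of _ r r _ r _ n2, symmetric]) (use c ct in auto)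
  finally have XX: "transpose_mat X * X = Q * ?B" .
  have "?B * Q = transpose_mat S * S * (transpose_mat Q * Q)"
    by (rule assoc_mult_mat[of _ r r _ n2 _ r]) (use c ct in auto)
  then have BQ: "?B * Q = transpose_mat S * S" unfolding o using c ct by simp
  have ut: "upper_triangular (transpose_mat S * S)"
  proof
    fix i j assume ij: "j < i" "i < dim_row (transpose_mat S * S)"
    then have "(transpose_mat S * S) $$ (i, j) = (\<Sum>k<r. S $$ (k, i) * S $$ (k, j))"
      using c by (simp add: scalar_prod_def atLeast0LessThan)
    also have "\<dots> = 0"
    proof (rule sum.neutral, rule ballI)
      fix k assume "k \<in> {..<r}"
      then show "S $$ (k, i) * S $$ (k, j) = 0"
        using d ij c unfolding diagonal_mat_def by (cases "k = i") auto
    qed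
    finally show "(transpose_mat S * S) $$ (i, j) = 0" .
  qed
  define D where "D = (\<Prod>a\<leftarrow>diag_mat (transpose_mat S * S). [:- a, 1:])"
  have SS: "transpose_mat S * S \<in> carrier_mat r r" using c by auto
  let ?c = "char_poly (transpose_mat X * X)"
  have "D = char_poly (?B * Q)" unfolding BQ D_def by (rule char_poly_upper_triangular[OF SS ut, symmetric])
  then have eqp: "?c * [:0, 1:] ^ r = D * [:0, 1:] ^ n2"
    unfolding XX using c ct char_poly_mult_commute[of Q n2 r ?B] by simp
  have c0: "?c \<noteq> 0"
  proof -
    have "transpose_mat X * X \<in> carrier_mat n2 n2" using X by auto
    from degree_monic_char_poly[OF this] show ?thesis by auto
  qed
  have D0: "D \<noteq> 0" by (auto simp: D_def prod_list_zero_iff)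
  have p0: "proots ([:0, 1 :: real:] ^ k) = repeat_mset k {#0#}" for k
    using proots_linear_factor[of "0::real"] by (simp add: proots_power)
  have "proots ?c + repeat_mset r {#0#} = proots D + repeat_mset n2 {#0#}"
    using arg_cong[OF eqp, of proots] c0 D0 by (simp add: proots_mult p0)
  from arg_cong[OF this, of size] have "size (proots ?c) + r = size (proots D) + n2"
    by simp
  moreover have "size (proots D) = r"
  proof -
    have *: "size (proots (\<Prod>a\<leftarrow>xs. [:- a, 1 :: real:])) = length xs" for xs
    proof (induction xs)
      case (Cons a xs)
      have "(\<Prod>a\<leftarrow>xs. [:- a, 1 :: real:]) \<noteq> 0" by (auto simp: prod_list_zero_iff)
      then show ?case using Cons by (simp add: proots_mult del: mult_pCons_left)
    qed simp
    show ?thesis unfolding D_def * using c by (simp add: diag_mat_def)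
  qed
  moreover have "length (sorted_list_of_multiset M) = size M" for M :: "real multiset"
    by (metis mset_sorted_list_of_multiset size_mset)
  ultimately show ?thesis by (simp add: singular_values_def)
qed

lemma singular_value_antimono:
  assumes "1 \<le> i" "i \<le> j" "j \<le> length (singular_values X)"
  shows "singular_value j X \<le> singular_value i X"
proof -
  have "sorted (rev (singular_values X))" by (simp add: singular_values_def)
  then have "sorted_wrt (\<ge>) (singular_values X)" by (simp add: sorted_wrt_rev)
  then show ?thesis using assms unfolding singular_value_def
    by (cases "i = j") (auto intro: sorted_wrt_nth_less)
qed

section \<open>From matrices to arrays\<close>

lemma frobenius_norm_carrier:
  "A \<in> carrier_mat n1 n2 \<Longrightarrow> frobenius_norm A = L2_set (\<lambda>ij. A $$ ij) ({..<n1} \<times> {..<n2})"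
  by (simp add: frobenius_norm_def)

lemma frobenius_norm_power2:
  assumes "A \<in> carrier_mat n1 n2"
  shows "(frobenius_norm A)\<^sup>2 = (\<Sum>i<n1. \<Sum>j<n2. (A $$ (i, j))\<^sup>2)"
  unfolding frobenius_norm_carrier[OF assms] L2_set_power2 ip_self_power2
  by (simp add: sum.cartesian_product split_def)

lemma two_inf_norm_row:
  assumes A: "A \<in> carrier_mat n r" and le: "two_inf_norm A \<le> sqrt c" and i: "i < n"
  shows "ip {..<r} (\<lambda>a. A $$ (i, a)) (\<lambda>a. A $$ (i, a)) \<le> c"
proof -
  let ?l = "L2_set (\<lambda>a. A $$ (i, a)) {..<r}"
  have "?l \<le> two_inf_norm A"
    unfolding two_inf_norm_def using A i by (intro Max_ge) auto
  then have l: "?l \<le> sqrt c" using le by simp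
  \<comment> \<open>The real \<open>sqrt\<close> is negative at negative arguments, so this yields
    \<open>0 \<le> c\<close>, which is needed for \<open>(sqrt c)\<^sup>2 = c\<close>.\<close>
  then have "0 \<le> sqrt c" using L2_set_nonneg[of "\<lambda>a. A $$ (i, a)" "{..<r}"] by linarith
  then have "0 \<le> c" by simp
  moreover have "?l\<^sup>2 \<le> (sqrt c)\<^sup>2" using l by (intro power_mono) auto
  ultimately show ?thesis by (simp add: L2_set_power2)
qed

lemma orthonormal_cols_mat:
  assumes P: "P \<in> carrier_mat n r" and o: "transpose_mat P * P = 1\<^sub>m r"
  shows "orthonormal_cols {..<n} r (\<lambda>i a. P $$ (i, a))"
  unfolding orthonormal_cols_def
proof (intro allI impI)
  fix a b assume ab: "a < r" "b < r"
  have "(transpose_mat P * P) $$ (a, b) = (\<Sum>i<n. P $$ (i, a) * P $$ (i, b))"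
    using P ab by (simp add: scalar_prod_def atLeast0LessThan)
  moreover have "(transpose_mat P * P) $$ (a, b) = of_bool (a = b)" unfolding o using ab by simp
  ultimately show "(\<Sum>i<n. P $$ (i, a) * P $$ (i, b)) = of_bool (a = b)" by metis
qed

lemma factor_err_mat:
  assumes c: "P \<in> carrier_mat n1 r" "S \<in> carrier_mat r r" "Q \<in> carrier_mat n2 r" "U \<in> carrier_mat n1 r" "V \<in> carrier_mat n2 r"
    and d: "diagonal_mat S" and ij: "i < n1" "j < n2"
  shows "(U * transpose_mat V - P * S * transpose_mat Q) $$ (i, j)
    = factor_err r (\<lambda>i a. P $$ (i, a)) (\<lambda>a. S $$ (a, a)) (\<lambda>j a. Q $$ (j, a)) (\<lambda>i a. U $$ (i, a)) (\<lambda>j a. V $$ (j, a)) i j"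
proof -
  have PS: "(P * S) $$ (i, b) = P $$ (i, b) * S $$ (b, b)" if b: "b < r" for b
  proof -
    have "(P * S) $$ (i, b) = (\<Sum>a<r. P $$ (i, a) * S $$ (a, b))"
      using c ij b by (simp add: scalar_prod_def atLeast0LessThan)
    also have "\<dots> = (\<Sum>a<r. if a = b then P $$ (i, b) * S $$ (b, b) else 0)"
      using d c b by (intro sum.cong) (auto simp: diagonal_mat_def)
    finally show ?thesis using b by simp
  qed
  have PSc: "P * S \<in> carrier_mat n1 r" using c by auto
  have "(T * transpose_mat Q) $$ (i, j) = (\<Sum>b<r. T $$ (i, b) * Q $$ (j, b))" if "T \<in> carrier_mat n1 r" for T
    using c that ij by (simp add: scalar_prod_def atLeast0LessThan)
  from this[OF PSc] have "(P * S * transpose_mat Q) $$ (i, j) = (\<Sum>b<r. (P * S) $$ (i, b) * Q $$ (j, b))" .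
  also have "\<dots> = (\<Sum>b<r. P $$ (i, b) * (S $$ (b, b) * Q $$ (j, b)))" by (intro sum.cong) (auto simp: PS)
  finally have 1: "(P * S * transpose_mat Q) $$ (i, j) = (\<Sum>b<r. P $$ (i, b) * (S $$ (b, b) * Q $$ (j, b)))" .
  have 2: "(U * transpose_mat V) $$ (i, j) = (\<Sum>a<r. U $$ (i, a) * V $$ (j, a))"
    using c ij by (simp add: scalar_prod_def atLeast0LessThan)
  have "(U * transpose_mat V - P * S * transpose_mat Q) $$ (i, j)
     = (U * transpose_mat V) $$ (i, j) - (P * S * transpose_mat Q) $$ (i, j)"
    using c ij by (intro index_minus_mat(1)) auto
  then show ?thesis unfolding 1 2 factor_err_def .
qed

text \<open>The sets \<open>B_err\<close>, \<open>B_bln\<close> and \<open>B_mu\<close> assert only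
  that some pair stacks to the given matrix; injectivity identifies it with the pair at
  hand.\<close>

lemma append_rows_inject:
  assumes c: "U \<in> carrier_mat n1 r" "U' \<in> carrier_mat n1 r" "V \<in> carrier_mat n2 r" "V' \<in> carrier_mat n2 r"
    and eq: "U @\<^sub>r V = U' @\<^sub>r V'"
  shows "U = U'" "V = V'"
proof -
  have top: "(A @\<^sub>r B) $$ (i, j) = A $$ (i, j)" and bot: "k < n2 \<Longrightarrow> (A @\<^sub>r B) $$ (n1 + k, j) = B $$ (k, j)"
    if "A \<in> carrier_mat n1 r" "B \<in> carrier_mat n2 r" "i < n1" "j < r" for A B :: "'a mat" and i j k
    using that by (auto simp: append_rows_def)
  show "U = U'" using c eq top[of U V] top[of U' V'] by (intro eq_matI) auto
  show "V = V'"
  proof (rule eq_matI)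
    fix k j assume "k < dim_row V'" "j < dim_col V'"
    then have "(A @\<^sub>r B) $$ (n1 + k, j) = B $$ (k, j)" if "A \<in> carrier_mat n1 r" "B \<in> carrier_mat n2 r" for A B :: "'a mat"
      using that c by (auto simp: append_rows_def)
    from this[of U V] this[of U' V'] show "V $$ (k, j) = V' $$ (k, j)" using c eq by simp
  qed (use c in auto)
qed

lemma stacked_memD:
  assumes Xs: "Xs \<in> carrier_mat n1 n2" and U: "U \<in> carrier_mat n1 r" and V: "V \<in> carrier_mat n2 r"
  shows "U @\<^sub>r V \<in> B_err r Xs e \<Longrightarrow> frobenius_norm (U * transpose_mat V - Xs) \<le> e * singular_value r Xs"
    and "U @\<^sub>r V \<in> B_bln r Xs e \<Longrightarrow> frobenius_norm (transpose_mat U * U - transpose_mat V * V) \<le> e * singular_value r Xs"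
    and "U @\<^sub>r V \<in> B_mu r Xs \<mu> \<Longrightarrow> two_inf_norm U \<le> sqrt (3 * \<mu> * real r * singular_value 1 Xs / real n1)
      \<and> two_inf_norm V \<le> sqrt (3 * \<mu> * real r * singular_value 1 Xs / real n2)"
  unfolding B_err_def B_bln_def B_mu_def
  using Xs U V append_rows_inject[of U n1 r _ V n2] by (smt (verit, best) carrier_matD mem_Collect_eq)+

section \<open>Transfer to the uniform sample and to matrices\<close>

text \<open>\<open>bad\<close> is a property of subsets of any size, so that its Bernoulli
  probability makes sense.\<close>

lemma prob_uniform_sample_ge:
  fixes n1 n2 m :: nat
  defines "E \<equiv> {..<n1} \<times> {..<n2}"
  assumes m: "m \<le> n1 * n2" and n: "0 < n1" "0 < n2" and p: "p = real m / (real n1 * real n2)"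
    and good: "\<And>W. W \<subseteq> E \<Longrightarrow> \<not> bad W \<Longrightarrow> W \<in> A"
    and fail: "(real (n1 * n2) + 1) * bern p E (\<lambda>W. of_bool (bad W)) \<le> \<delta>"
  shows "1 - \<delta> \<le> measure_pmf.prob (uniform_sample n1 n2 m) A"
proof -
  let ?S = "{W. W \<subseteq> E \<and> card W = m}"
  have finE: "finite E" and cE: "card E = n1 * n2" by (auto simp: E_def card_cartesian_product)
  have finS: "finite ?S" using finE by (auto intro: finite_subset[of _ "Pow E"])
  have cS: "card ?S = (n1 * n2) choose m" using n_subsets[OF finE, of m] cE by simp
  have cpos: "0 < card ?S" unfolding cS using m by simp
  have ne: "?S \<noteq> {}" using cpos by (metis card.empty less_nat_zero_code)
  have 1: "measure_pmf.prob (uniform_sample n1 n2 m) A = real (card (?S \<inter> A)) / real (card ?S)"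
    unfolding uniform_sample_def E_def[symmetric] by (rule measure_pmf_of_set[OF ne finS])
  have "?S - A \<subseteq> {W. W \<subseteq> E \<and> card W = m \<and> bad W}" using good by auto
  moreover have "finite {W. W \<subseteq> E \<and> card W = m \<and> bad W}" using finE by (auto intro: finite_subset[of _ "Pow E"])
  ultimately have "card (?S - A) \<le> card {W. W \<subseteq> E \<and> card W = m \<and> bad W}" by (rule card_mono[rotated])
  then have "real (card (?S - A)) / real (card ?S) \<le> real (card {W. W \<subseteq> E \<and> card W = m \<and> bad W}) / real (card ?S)"
    by (intro divide_right_mono) auto
  also have "\<dots> \<le> (real (n1 * n2) + 1) * bern p E (\<lambda>W. of_bool (bad W))"
    unfolding cS using finE cE n m p by (intro card_subsets_le_bern) auto
  also have "\<dots> \<le> \<delta>" by (rule fail)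
  finally have 2: "real (card (?S - A)) / real (card ?S) \<le> \<delta>" .
  have "card ?S = card (?S \<inter> A) + card (?S - A)"
    using card_Int_Diff[OF finS] .
  then have eq: "real (card ?S) = real (card (?S \<inter> A)) + real (card (?S - A))" by linarith
  have "real (card ?S) \<noteq> 0" using cpos by linarith
  then have "1 = real (card ?S) / real (card ?S)" by (rule divide_self[symmetric])
  also have "\<dots> = (real (card (?S \<inter> A)) + real (card (?S - A))) / real (card ?S)"
    by (rule arg_cong[OF eq, of "\<lambda>x. x / real (card ?S)"])
  also have "\<dots> = real (card (?S \<inter> A)) / real (card ?S) + real (card (?S - A)) / real (card ?S)"
    by (rule add_divide_distrib)
  finally have "1 = real (card (?S \<inter> A)) / real (card ?S) + real (card (?S - A)) / real (card ?S)" .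
  then show ?thesis unfolding 1 using 2 by linarith
qed

lemma (in bessel_system) frame_op_quadratic_form:
  assumes "W \<subseteq> E"
  shows "ip E f (frame_op p W f) = (\<Sum>k\<in>W. (ip E (g k) f)\<^sup>2) - p * (\<Sum>k\<in>E. (ip E (g k) f)\<^sup>2)"
proof -
  have "ip E f (frame_op p W f) = (\<Sum>k\<in>E. (of_bool (k \<in> W) - p) * ip E (g k) f * ip E (g k) f)"
    by (subst ip_commute) (rule ip_frame_op)
  also have "\<dots> = (\<Sum>k\<in>E. if k \<in> W then (ip E (g k) f)\<^sup>2 else 0) - p * (\<Sum>k\<in>E. (ip E (g k) f)\<^sup>2)"
    unfolding sum_distrib_left sum_subtractf[symmetric]
    by (intro sum.cong) (auto simp: power2_eq_square algebra_simps)
  also have "(\<Sum>k\<in>E. if k \<in> W then (ip E (g k) f)\<^sup>2 else 0) = (\<Sum>k\<in>W. (ip E (g k) f)\<^sup>2)"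
    using assms fin by (simp add: sum.inter_restrict[symmetric] Int_absorb1)
  finally show ?thesis .
qed

text \<open>Serves the case of a nonpositive \<open>r\<close>-th singular value, where all three
  quantities of the claim vanish.\<close>

lemma frobenius_deviation_le_zero:
  assumes Y: "Y \<in> carrier_mat n1 n2" and "frobenius_norm Y \<le> 0" and W: "W \<subseteq> {..<n1} \<times> {..<n2}"
  shows "frobenius_norm Y = 0" "L2_set (P_obs W Y) W = 0"
proof -
  have "0 \<le> frobenius_norm Y" by (simp add: frobenius_norm_def)
  then show 0: "frobenius_norm Y = 0" using assms(2) by simp
  then have z: "Y $$ k = 0" if "k \<in> {..<n1} \<times> {..<n2}" for k
    using that unfolding frobenius_norm_carrier[OF Y] by (subst (asm) L2_set_eq_0_iff) auto
  have "L2_set (P_obs W Y) W = L2_set (\<lambda>_. 0) W"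
    using W z by (intro L2_set_cong) (auto simp: P_obs_def)
  then show "L2_set (P_obs W Y) W = 0" by (simp add: L2_set_def)
qed

lemma sampled_isometry:
  fixes n1 n2 r :: nat
  defines "n \<equiv> max n1 n2" and "E \<equiv> {..<n1} \<times> {..<n2}"
  assumes svd: "P \<in> carrier_mat n1 r" "S \<in> carrier_mat r r" "Q \<in> carrier_mat n2 r"
      "transpose_mat P * P = 1\<^sub>m r" "transpose_mat Q * Q = 1\<^sub>m r" "diagonal_mat S"
    and Xs: "Xs = P * S * transpose_mat Q"
    and \<sigma>: "\<And>a. a < r \<Longrightarrow> sr \<le> S $$ (a, a)" "\<And>a. a < r \<Longrightarrow> S $$ (a, a) \<le> s1" and sr: "0 < sr" "sr \<le> s1"
    and UV: "U \<in> carrier_mat n1 r" "V \<in> carrier_mat n2 r"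
    and err: "frobenius_norm (U * transpose_mat V - Xs) \<le> \<epsilon> / 144 * sr"
    and bal: "frobenius_norm (transpose_mat U * U - transpose_mat V * V) \<le> 1 / 4 * sr"
    and rP: "\<And>i. i < n1 \<Longrightarrow> ip {..<r} (\<lambda>a. P $$ (i, a)) (\<lambda>a. P $$ (i, a)) \<le> \<nu>"
    and rQ: "\<And>j. j < n2 \<Longrightarrow> ip {..<r} (\<lambda>a. Q $$ (j, a)) (\<lambda>a. Q $$ (j, a)) \<le> \<nu>"
    and rU: "\<And>i. i < n1 \<Longrightarrow> ip {..<r} (\<lambda>a. U $$ (i, a)) (\<lambda>a. U $$ (i, a)) \<le> 3 * s1 * \<nu>"
    and rV: "\<And>j. j < n2 \<Longrightarrow> ip {..<r} (\<lambda>a. V $$ (j, a)) (\<lambda>a. V $$ (j, a)) \<le> 3 * s1 * \<nu>"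
    and \<nu>: "0 < \<nu>" and p: "0 < p" and \<epsilon>: "0 < \<epsilon>" "\<epsilon> < 1"
    and incoh: "102400 * (sqrt (real n * p) * (s1 * \<nu>)) \<le> p * \<epsilon>\<^sup>2 * sr"
    and W: "W \<subseteq> E" and ld: "low_discrepancy n1 n2 p W"
    and rip: "\<And>f. \<bar>ip E f (bessel_system.frame_op E
        (tangent_kernel r (\<lambda>i a. P $$ (i, a)) (\<lambda>j a. Q $$ (j, a))) p W f)\<bar> \<le> \<epsilon> / 2 * p * ip E f f"
  shows "(1 - \<epsilon>) * frobenius_norm (U * transpose_mat V - Xs)
      \<le> 1 / sqrt p * L2_set (P_obs W (U * transpose_mat V - Xs)) W"
    and "1 / sqrt p * L2_set (P_obs W (U * transpose_mat V - Xs)) W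
      \<le> (1 + \<epsilon>) * frobenius_norm (U * transpose_mat V - Xs)"
proof -
  let ?P = "\<lambda>i a. P $$ (i, a)" and ?Q = "\<lambda>j a. Q $$ (j, a)" and ?\<sigma> = "\<lambda>a. S $$ (a, a)"
    and ?U = "\<lambda>i a. U $$ (i, a)" and ?V = "\<lambda>j a. V $$ (j, a)"
  define Y where "Y = U * transpose_mat V - Xs"
  define f where "f = (\<lambda>k. factor_err r ?P ?\<sigma> ?Q ?U ?V (fst k) (snd k))"
  define G where "G = tangent_kernel r ?P ?Q"
  define z where "z = ap E G f"
  have Yc: "Y \<in> carrier_mat n1 n2" unfolding Y_def Xs using svd UV by auto
  have Yf: "Y $$ k = f k" if "k \<in> E" for k
    using that factor_err_mat[OF svd(1-3) UV svd(6)] by (auto simp: Y_def Xs f_def E_def)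
  have FY: "frobenius_norm Y = L2_set f E"
    unfolding frobenius_norm_carrier[OF Yc] E_def[symmetric] by (intro L2_set_cong) (auto simp: Yf)
  have oP: "orthonormal_cols {..<n1} r ?P" and oQ: "orthonormal_cols {..<n2} r ?Q"
    using svd by (auto intro: orthonormal_cols_mat)
  have small: "L2_set f E \<le> \<epsilon> * sr / 144" using err FY by (simp add: Y_def)
  have s4: "\<epsilon> * sr / 144 \<le> sr / 4" using \<epsilon> sr by simp
  have nf: "near_factorization {..<n1} {..<n2} r ?P ?\<sigma> ?Q ?U ?V s1 sr"
  proof
    have "(\<Sum>i<n1. \<Sum>j<n2. (factor_err r ?P ?\<sigma> ?Q ?U ?V i j)\<^sup>2) = (L2_set f E)\<^sup>2"
      by (simp add: L2_set_power2 ip_self_power2 E_def f_def sum.cartesian_product split_def)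
    also have "\<dots> \<le> (sr / 4)\<^sup>2" using small s4 by (intro power_mono) auto
    finally show "(\<Sum>i<n1. \<Sum>j<n2. (factor_err r ?P ?\<sigma> ?Q ?U ?V i j)\<^sup>2) \<le> (sr / 4)\<^sup>2" .
    have c: "transpose_mat U * U - transpose_mat V * V \<in> carrier_mat r r" using UV by auto
    have "(\<Sum>a<r. \<Sum>b<r. ((\<Sum>i<n1. ?U i a * ?U i b) - (\<Sum>j<n2. ?V j a * ?V j b))\<^sup>2)
      = (\<Sum>a<r. \<Sum>b<r. ((transpose_mat U * U - transpose_mat V * V) $$ (a, b))\<^sup>2)"
      using UV by (intro sum.cong refl) (simp add: scalar_prod_def atLeast0LessThan)
    also have "\<dots> = (frobenius_norm (transpose_mat U * U - transpose_mat V * V))\<^sup>2"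
      by (rule frobenius_norm_power2[OF c, symmetric])
    also have "\<dots> \<le> (sr / 4)\<^sup>2" using bal by (intro power_mono) (auto simp: frobenius_norm_def)
    finally show "(\<Sum>a<r. \<Sum>b<r. ((\<Sum>i<n1. ?U i a * ?U i b) - (\<Sum>j<n2. ?V j a * ?V j b))\<^sup>2) \<le> (sr / 4)\<^sup>2" .
  qed (use oP oQ \<sigma> sr in auto)
  have "ip {..<r} (?P i) (?P i) + ip {..<r} (?Q j) (?Q j) \<le> 2 * \<nu>" if "i < n1" "j < n2" for i j
    using rP[OF that(1)] rQ[OF that(2)] by linarith
  then have bs: "bessel_system E G (2 * \<nu>)"
    unfolding E_def G_def using oP oQ \<nu> by (intro bessel_system_tangent) auto
  have zk: "z k = ip E (G k) f" for k by (simp add: z_def ap_def ip_def)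
  have "ip E f (bessel_system.frame_op E G p W f) = (\<Sum>k\<in>W. (z k)\<^sup>2) - p * (\<Sum>k\<in>E. (z k)\<^sup>2)"
    unfolding zk by (rule bessel_system.frame_op_quadratic_form[OF bs W])
  then have rip': "\<bar>(\<Sum>k\<in>W. (z k)\<^sup>2) - p * (\<Sum>k\<in>E. (z k)\<^sup>2)\<bar> \<le> \<epsilon> / 2 * p * ip E f f"
    using rip[of f] by (simp add: G_def)
  \<comment> \<open>\<open>10 = 2 * 3 + 4\<close>: the rows of \<open>U\<close> and \<open>V\<close>
    carry the constant 3 of \<open>B_mu\<close>, those of \<open>P\<close> and \<open>Q\<close> the
    constant 1.\<close>
  define b where "b = 10 * (s1 * \<nu>)"
  have b0: "0 \<le> b" using sr \<nu> by (simp add: b_def)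
  have rows: "2 * u + 4 * s1 * v \<le> b" if "u \<le> 3 * s1 * \<nu>" "v \<le> \<nu>" for u v
  proof -
    have "4 * s1 * v \<le> 4 * s1 * \<nu>" using that sr by (intro mult_left_mono) auto
    then show ?thesis using that(1) by (simp add: b_def)
  qed
  have rowsU: "2 * ip {..<r} (?U i) (?U i) + 4 * s1 * ip {..<r} (?P i) (?P i) \<le> b" if "i < n1" for i
    by (rule rows[OF rU[OF that] rP[OF that]])
  have rowsV: "2 * ip {..<r} (?V j) (?V j) + 4 * s1 * ip {..<r} (?Q j) (?Q j) \<le> b" if "j < n2" for j
    by (rule rows[OF rV[OF that] rQ[OF that]])
  have inc': "10240 * (sqrt (real (max n1 n2) * p) * sqrt (b * b)) \<le> p * \<epsilon>\<^sup>2 * sr"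
  proof -
    have "sqrt (b * b) = b" using b0 by simp
    then show ?thesis using incoh by (simp only: n_def) (simp add: b_def)
  qed
  have obs: "L2_set (P_obs W Y) W = L2_set f W"
    using W Yf by (intro L2_set_cong) (auto simp: P_obs_def)
  have sp: "0 < sqrt p" using p by simp
  have "(1 - \<epsilon>) * (sqrt p * frobenius_norm Y) \<le> L2_set (P_obs W Y) W"
    "L2_set (P_obs W Y) W \<le> (1 + \<epsilon>) * (sqrt p * frobenius_norm Y)"
    unfolding obs FY
    using near_factorization_isometry[OF nf f_def z_def[unfolded G_def E_def] W[unfolded E_def] ld p \<epsilon>
        rip'[unfolded E_def] small[unfolded E_def] rowsU b0 rowsV b0 inc'] by (simp_all add: E_def)
  then show "(1 - \<epsilon>) * frobenius_norm (U * transpose_mat V - Xs)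
      \<le> 1 / sqrt p * L2_set (P_obs W (U * transpose_mat V - Xs)) W"
    "1 / sqrt p * L2_set (P_obs W (U * transpose_mat V - Xs)) W
      \<le> (1 + \<epsilon>) * frobenius_norm (U * transpose_mat V - Xs)"
    unfolding Y_def[symmetric] using sp by (simp_all add: pos_le_divide_eq pos_divide_le_eq mult_ac)
qed

text \<open>The squared row norms of \<open>P\<close> sum to \<open>r\<close>, so a common upper
  bound is at least their average \<open>r / n\<close>.\<close>

lemma incoherence_ge_one:
  assumes o: "orthonormal_cols {..<n} r P" and r: "1 \<le> r" and n: "1 \<le> n"
    and rows: "\<And>i. i < n \<Longrightarrow> ip {..<r} (P i) (P i) \<le> \<mu> * real r / real n"
  shows "1 \<le> \<mu>"
proof -
  have "real r = (\<Sum>a<r. \<Sum>i<n. P i a * P i a)" using o by (simp add: orthonormal_cols_def)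
  also have "\<dots> = (\<Sum>i<n. ip {..<r} (P i) (P i))" unfolding ip_def by (rule sum.swap)
  also have "\<dots> \<le> (\<Sum>i<n. \<mu> * real r / real n)" using rows by (intro sum_mono) auto
  also have "\<dots> = \<mu> * real r" using n by simp
  finally have "1 * real r \<le> \<mu> * real r" by simp
  then show ?thesis using r by simp
qed

text \<open>The event is a variable \<open>A\<close> given by its members, so that the final theorem
  can put its set comprehension there.\<close>

lemma uniform_sample_isometry:
  fixes \<beta> \<mu> \<kappa> \<epsilon> :: real and n1 n2 r m :: nat and Xs :: "real mat"
  defines "n \<equiv> max n1 n2" and "p \<equiv> real m / (real n1 * real n2)"
  assumes \<beta>: "0 < \<beta>" "\<beta> \<le> 1" and mn: "\<beta> * real n \<le> real (min n1 n2)" and r: "1 \<le> r"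
    and Xs: "Xs \<in> incoherent_mats n1 n2 r \<mu> \<kappa>" and \<epsilon>: "0 < \<epsilon>" "\<epsilon> < 1" and m: "m \<le> n1 * n2"
    and np: "(102400 / \<beta>)\<^sup>2 / \<epsilon>\<^sup>2 * \<mu> * real r * max (ln (real n)) (\<mu> * real r * \<kappa>\<^sup>2 / \<epsilon>\<^sup>2) \<le> real n * p"
    and A: "\<And>W. W \<in> A \<longleftrightarrow> (\<forall>U V. U \<in> carrier_mat n1 r \<longrightarrow> V \<in> carrier_mat n2 r \<longrightarrow>
             U @\<^sub>r V \<in> B_err r Xs (\<epsilon> / 144) \<inter> B_bln r Xs (1 / 4) \<inter> B_mu r Xs \<mu> \<longrightarrow>
             (1 - \<epsilon>) * frobenius_norm (U * transpose_mat V - Xs)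
                 \<le> 1 / sqrt p * L2_set (P_obs W (U * transpose_mat V - Xs)) W \<and>
               1 / sqrt p * L2_set (P_obs W (U * transpose_mat V - Xs)) W
                 \<le> (1 + \<epsilon>) * frobenius_norm (U * transpose_mat V - Xs))"
  shows "1 - 3 / real n ^ 3 \<le> measure_pmf.prob (uniform_sample n1 n2 m) A"
proof -
  have Xc: "Xs \<in> carrier_mat n1 n2" and rank: "vec_space.rank n1 Xs = r" and \<kappa>: "singular_value 1 Xs / singular_value r Xs = \<kappa>"
    using Xs by (auto simp: incoherent_mats_def)
  obtain P S Q where svd: "reduced_svd r Xs P S Q"
    and muP: "two_inf_norm P \<le> sqrt (\<mu> * real r / real n1)" and muQ: "two_inf_norm Q \<le> sqrt (\<mu> * real r / real n2)"
    using Xs Xc by (auto simp: incoherent_mats_def incoherent_def)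
  have c: "P \<in> carrier_mat n1 r" "S \<in> carrier_mat r r" "Q \<in> carrier_mat n2 r"
    and o: "transpose_mat P * P = 1\<^sub>m r" "transpose_mat Q * Q = 1\<^sub>m r"
    and d: "diagonal_mat S" and S: "\<And>i. i < r \<Longrightarrow> S $$ (i, i) = singular_value (i + 1) Xs"
    and eq: "Xs = P * S * transpose_mat Q"
    using svd Xc by (auto simp: reduced_svd_def)
  \<comment> \<open>A positive rank excludes \<open>n2 = 0\<close>, so \<open>n\<close> is positive,
    and the aspect ratio then makes both dimensions positive.\<close>
  have rn2: "r \<le> n2" using vec_space.rank_le_nc[OF Xc] rank by simp
  then have "0 < \<beta> * real n" using r \<beta> by (simp add: n_def)
  then have n12: "1 \<le> n1" "1 \<le> n2" using mn by (auto simp: Suc_le_eq intro!: Nat.gr0I)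
  have n0: "0 < real n" using n12 by (simp add: n_def)
  have \<beta>n: "\<beta> * real n \<le> real n1" "\<beta> * real n \<le> real n2" using mn by auto
  \<comment> \<open>For \<open>n = 1\<close> the logarithm vanishes, but the claimed probability
    \<open>1 - 3\<close> is negative.\<close>
  show ?thesis
  proof (cases "n = 1")
    case True
    then have "1 - 3 / real n ^ 3 \<le> 0" by simp
    also have "0 \<le> measure_pmf.prob (uniform_sample n1 n2 m) A" by (rule measure_nonneg)
    finally show ?thesis .
  next
    case False
    then have n2: "2 \<le> n" using n0 by simp
    define sr where "sr = singular_value r Xs"
    define s1 where "s1 = singular_value 1 Xs"
    define E where "E = {..<n1} \<times> {..<n2}"
    have finE: "finite E" by (simp add: E_def)
    have \<delta>0: "0 \<le> 3 / real n ^ 3" by simp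
    \<comment> \<open>Splitting on the sign of \<open>sr\<close> spares a derivation of its
      positivity from the rank.\<close>
    show ?thesis
    proof (cases "sr \<le> 0")
      case True
      \<comment> \<open>Then \<open>B_err\<close> forces \<open>U V\<^sup>T = Xs\<close>.\<close>
      show ?thesis
      proof (rule prob_uniform_sample_ge[where bad = "\<lambda>_. False" and p = p])
        fix W assume W: "W \<subseteq> {..<n1} \<times> {..<n2}"
        show "W \<in> A"
          unfolding A
        proof (intro allI impI)
          fix U V assume UV: "U \<in> carrier_mat n1 r" "V \<in> carrier_mat n2 r"
            and mem: "U @\<^sub>r V \<in> B_err r Xs (\<epsilon> / 144) \<inter> B_bln r Xs (1 / 4) \<inter> B_mu r Xs \<mu>"
          have Yc: "U * transpose_mat V - Xs \<in> carrier_mat n1 n2" using UV Xc by auto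
          have "frobenius_norm (U * transpose_mat V - Xs) \<le> \<epsilon> / 144 * sr"
            using stacked_memD(1)[OF Xc UV IntD1[OF IntD1[OF mem]]] unfolding sr_def .
          also have "\<dots> \<le> 0" using True \<epsilon> by (intro mult_nonneg_nonpos) auto
          finally have le: "frobenius_norm (U * transpose_mat V - Xs) \<le> 0" .
          show "(1 - \<epsilon>) * frobenius_norm (U * transpose_mat V - Xs)
                 \<le> 1 / sqrt p * L2_set (P_obs W (U * transpose_mat V - Xs)) W \<and>
               1 / sqrt p * L2_set (P_obs W (U * transpose_mat V - Xs)) W
                 \<le> (1 + \<epsilon>) * frobenius_norm (U * transpose_mat V - Xs)"
            using frobenius_deviation_le_zero[OF Yc le W] by simp
        qed
      qed (use m n12 \<delta>0 in \<open>auto simp: p_def\<close>)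
    next
      case False
      then have sr: "0 < sr" by simp
      have len: "length (singular_values Xs) = n2" by (rule length_singular_values[OF Xc svd])
      have \<sigma>: "sr \<le> S $$ (a, a)" "S $$ (a, a) \<le> s1" if "a < r" for a
        unfolding S[OF that] sr_def s1_def using that rn2 len by (auto intro!: singular_value_antimono)
      have s1: "sr \<le> s1" unfolding sr_def s1_def using r rn2 len by (intro singular_value_antimono) auto
      have "s1 / sr = \<kappa>" unfolding s1_def sr_def by (rule \<kappa>)
      then have \<kappa>': "s1 = \<kappa> * sr" "0 < \<kappa>" using sr s1 by auto
      have oP: "orthonormal_cols {..<n1} r (\<lambda>i a. P $$ (i, a))" and oQ: "orthonormal_cols {..<n2} r (\<lambda>j a. Q $$ (j, a))"
        using c o by (auto intro: orthonormal_cols_mat)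
      have \<mu>: "1 \<le> \<mu>" by (rule incoherence_ge_one[OF oP r n12(1) two_inf_norm_row[OF c(1) muP]])
      define t where "t = \<mu> * real r"
      have t: "1 \<le> t" unfolding t_def using mult_mono[of 1 \<mu> 1 "real r"] \<mu> r by simp
      define \<nu> where "\<nu> = t / (\<beta> * real n)"
      have \<nu>: "0 < \<nu>" unfolding \<nu>_def using t \<beta> n0 by simp
      have scale: "v / real k \<le> v / (\<beta> * real n)" if "0 \<le> v" "\<beta> * real n \<le> real k" for v and k :: nat
      proof -
        have "0 < \<beta> * real n" using \<beta> n0 by simp
        then have "0 < \<beta> * real n" "0 < real k" using that(2) by linarith+
        then show ?thesis using that by (intro frac_le order_refl)
      qed
      have rP: "ip {..<r} (\<lambda>a. P $$ (i, a)) (\<lambda>a. P $$ (i, a)) \<le> \<nu>" if "i < n1" for i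
        using two_inf_norm_row[OF c(1) muP that] scale[of t n1] t \<beta>n by (simp add: \<nu>_def t_def)
      have rQ: "ip {..<r} (\<lambda>a. Q $$ (j, a)) (\<lambda>a. Q $$ (j, a)) \<le> \<nu>" if "j < n2" for j
        using two_inf_norm_row[OF c(3) muQ that] scale[of t n2] t \<beta>n by (simp add: \<nu>_def t_def)
      define C where "C = (102400 / \<beta>)\<^sup>2"
      have C0: "0 < C" using \<beta> by (simp add: C_def)
      have np': "C * t / \<epsilon>\<^sup>2 * max (ln (real n)) (t * \<kappa>\<^sup>2 / \<epsilon>\<^sup>2) \<le> real n * p"
        using np by (simp add: C_def t_def mult_ac)
      have Cte: "0 < C * t / \<epsilon>\<^sup>2" using C0 t \<epsilon> by simp
      have "C * t / \<epsilon>\<^sup>2 * ln (real n) \<le> C * t / \<epsilon>\<^sup>2 * max (ln (real n)) (t * \<kappa>\<^sup>2 / \<epsilon>\<^sup>2)"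
        using Cte by (intro mult_left_mono) auto
      then have np1: "C * t / \<epsilon>\<^sup>2 * ln (real n) \<le> real n * p" using np' by linarith
      have "C * t / \<epsilon>\<^sup>2 * (t * \<kappa>\<^sup>2 / \<epsilon>\<^sup>2) \<le> C * t / \<epsilon>\<^sup>2 * max (ln (real n)) (t * \<kappa>\<^sup>2 / \<epsilon>\<^sup>2)"
        using Cte by (intro mult_left_mono) auto
      then have np2: "C * t / \<epsilon>\<^sup>2 * (t * \<kappa>\<^sup>2 / \<epsilon>\<^sup>2) \<le> real n * p" using np' by linarith
      have "0 < C * t / \<epsilon>\<^sup>2 * (t * \<kappa>\<^sup>2 / \<epsilon>\<^sup>2)" using Cte t \<kappa>' \<epsilon> by (intro mult_pos_pos) auto
      then have "0 < real n * p" using np2 by linarith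
      then have p0: "0 < p" using n0 by (simp add: zero_less_mult_iff)
      have p1: "p \<le> 1" unfolding p_def using n12 of_nat_mono[OF m, where 'a = real] by (simp add: divide_le_eq)
      have large: "(102400 / \<beta>)\<^sup>2 * (\<mu> * real r) * ln (real n) \<le> \<epsilon>\<^sup>2 * (real n * p)"
      proof -
        have "C * t * ln (real n) = \<epsilon>\<^sup>2 * (C * t / \<epsilon>\<^sup>2 * ln (real n))" using \<epsilon> by simp
        also have "\<dots> \<le> \<epsilon>\<^sup>2 * (real n * p)" using np1 by (rule mult_left_mono) simp
        finally show ?thesis unfolding C_def t_def .
      qed
      \<comment> \<open>The second branch of the maximum under a square root; \<open>C\<close> is a
        square because the discrepancy contributes \<open>sqrt (n p)\<close>. The factor
        \<open>102400 = 10 * 10240\<close> combines the row bound \<open>10 * (s1 * \<nu>)\<close>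
        with the constant of the deterministic isometry.\<close>
      have root: "102400 / \<beta> * t * \<kappa> / \<epsilon>\<^sup>2 \<le> sqrt (real n * p)"
      proof (rule real_le_rsqrt)
        have "(102400 / \<beta> * t * \<kappa> / \<epsilon>\<^sup>2)\<^sup>2 = C * t / \<epsilon>\<^sup>2 * (t * \<kappa>\<^sup>2 / \<epsilon>\<^sup>2)"
          by (simp add: C_def power_mult_distrib power_divide power2_eq_square mult_ac)
        then show "(102400 / \<beta> * t * \<kappa> / \<epsilon>\<^sup>2)\<^sup>2 \<le> real n * p" using np2 by simp
      qed
      have incoh: "102400 * (sqrt (real n * p) * (s1 * \<nu>)) \<le> p * \<epsilon>\<^sup>2 * sr"
      proof -
        have "102400 * (sqrt (real n * p) * (s1 * \<nu>)) = sqrt (real n * p) * (102400 / \<beta> * t * \<kappa> / \<epsilon>\<^sup>2) * (\<epsilon>\<^sup>2 * sr / real n)"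
          using \<epsilon> by (simp add: \<nu>_def \<kappa>'(1))
        also have "\<dots> \<le> sqrt (real n * p) * sqrt (real n * p) * (\<epsilon>\<^sup>2 * sr / real n)"
          using root sr n0 p0 by (intro mult_right_mono mult_left_mono) auto
        also have "sqrt (real n * p) * sqrt (real n * p) = real n * p" using n0 p0 by simp
        also have "real n * p * (\<epsilon>\<^sup>2 * sr / real n) = p * \<epsilon>\<^sup>2 * sr" using n0 by simp
        finally show ?thesis .
      qed
      let ?G = "tangent_kernel r (\<lambda>i a. P $$ (i, a)) (\<lambda>j a. Q $$ (j, a))"
      have "ip {..<r} (\<lambda>a. P $$ (i, a)) (\<lambda>a. P $$ (i, a)) + ip {..<r} (\<lambda>a. Q $$ (j, a)) (\<lambda>a. Q $$ (j, a)) \<le> 2 * \<nu>"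
        if "i < n1" "j < n2" for i j
        using rP[OF that(1)] rQ[OF that(2)] by linarith
      then have "bessel_system ({..<n1} \<times> {..<n2}) ?G (2 * \<nu>)"
        using oP oQ \<nu> by (intro bessel_system_tangent) auto
      then have bs: "bessel_system ({..<n1} \<times> {..<n2}) ?G (2 * \<mu> * real r / (\<beta> * real (max n1 n2)))"
        by (simp only: \<nu>_def t_def n_def times_divide_eq_right mult.assoc)
      let ?bad = "\<lambda>W. (\<exists>f. \<epsilon> / 2 * p * ip E f f < \<bar>ip E f (bessel_system.frame_op E ?G p W f)\<bar>)
         \<or> \<not> low_discrepancy n1 n2 p W"
      show ?thesis
      proof (rule prob_uniform_sample_ge[where bad = ?bad and p = p])
        show "(real (n1 * n2) + 1) * bern p ({..<n1} \<times> {..<n2}) (\<lambda>W. of_bool (?bad W)) \<le> 3 / real n ^ 3"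
          unfolding E_def n_def
          by (rule sampling_failure[OF \<beta> n12 n2[unfolded n_def] r \<mu> p0 p1 \<epsilon> large[unfolded n_def] bs])
      next
        fix W assume W: "W \<subseteq> {..<n1} \<times> {..<n2}" and good: "\<not> ?bad W"
        show "W \<in> A"
          unfolding A
        proof (intro allI impI)
          fix U V assume UV: "U \<in> carrier_mat n1 r" "V \<in> carrier_mat n2 r"
            and mem: "U @\<^sub>r V \<in> B_err r Xs (\<epsilon> / 144) \<inter> B_bln r Xs (1 / 4) \<inter> B_mu r Xs \<mu>"
          have err: "frobenius_norm (U * transpose_mat V - Xs) \<le> \<epsilon> / 144 * sr"
            and bal: "frobenius_norm (transpose_mat U * U - transpose_mat V * V) \<le> 1 / 4 * sr"
            and mu: "two_inf_norm U \<le> sqrt (3 * \<mu> * real r * s1 / real n1)"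
              "two_inf_norm V \<le> sqrt (3 * \<mu> * real r * s1 / real n2)"
            using stacked_memD(1)[OF Xc UV IntD1[OF IntD1[OF mem]]] stacked_memD(2)[OF Xc UV IntD2[OF IntD1[OF mem]]]
              stacked_memD(3)[OF Xc UV IntD2[OF mem]] unfolding sr_def s1_def by blast+
          have st: "0 \<le> 3 * s1 * t" using sr s1 t by simp
          have rU: "ip {..<r} (\<lambda>a. U $$ (i, a)) (\<lambda>a. U $$ (i, a)) \<le> 3 * s1 * \<nu>" if "i < n1" for i
            using two_inf_norm_row[OF UV(1) mu(1) that] scale[OF st \<beta>n(1)] by (simp add: \<nu>_def t_def mult_ac)
          have rV: "ip {..<r} (\<lambda>a. V $$ (j, a)) (\<lambda>a. V $$ (j, a)) \<le> 3 * s1 * \<nu>" if "j < n2" for j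
            using two_inf_norm_row[OF UV(2) mu(2) that] scale[OF st \<beta>n(2)] by (simp add: \<nu>_def t_def mult_ac)
          have rip: "\<bar>ip ({..<n1} \<times> {..<n2}) f (bessel_system.frame_op ({..<n1} \<times> {..<n2}) ?G p W f)\<bar>
              \<le> \<epsilon> / 2 * p * ip ({..<n1} \<times> {..<n2}) f f" for f
            using good by (auto simp: E_def not_less)
          have ld: "low_discrepancy n1 n2 p W" using good by simp
          note iso = sampled_isometry[OF c o d eq \<sigma> sr s1 UV err bal rP rQ rU rV \<nu> p0 \<epsilon> incoh[unfolded n_def] W ld rip]
          show "(1 - \<epsilon>) * frobenius_norm (U * transpose_mat V - Xs)
                 \<le> 1 / sqrt p * L2_set (P_obs W (U * transpose_mat V - Xs)) W \<and>
               1 / sqrt p * L2_set (P_obs W (U * transpose_mat V - Xs)) W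
                 \<le> (1 + \<epsilon>) * frobenius_norm (U * transpose_mat V - Xs)"
            by (intro conjI iso)
        qed
      qed (use m n12 in \<open>auto simp: p_def\<close>)
    qed
  qed
qed

theorem theorem3p9:
  fixes \<beta> :: real
  assumes "0 < \<beta>" and "\<beta> \<le> 1"
  shows "\<exists>C c_l c_e :: real. 0 < C \<and> 0 < c_l \<and> 0 < c_e \<and>
    (\<forall>(n1 :: nat) (n2 :: nat) (r :: nat) (\<mu> :: real) (\<kappa> :: real) (Xs :: real mat)
       (\<epsilon> :: real) (m :: nat).
      let n = max n1 n2; p = real m / (real n1 * real n2) in
        real (min n1 n2) \<ge> \<beta> * real n \<longrightarrow>
        1 \<le> r \<longrightarrow>
        Xs \<in> incoherent_mats n1 n2 r \<mu> \<kappa> \<longrightarrow>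
        0 < \<epsilon> \<longrightarrow> \<epsilon> < 1 \<longrightarrow>
        m \<le> n1 * n2 \<longrightarrow>
        real n * p \<ge> C / \<epsilon>\<^sup>2 * \<mu> * real r
          * max (ln (real n)) (\<mu> * real r * \<kappa>\<^sup>2 / \<epsilon>\<^sup>2) \<longrightarrow>
        measure_pmf.prob (uniform_sample n1 n2 m)
          {\<Omega>. \<forall>U V. U \<in> carrier_mat n1 r \<longrightarrow> V \<in> carrier_mat n2 r \<longrightarrow>
             U @\<^sub>r V \<in> B_err r Xs (\<epsilon> / c_e) \<inter> B_bln r Xs (1 / c_l) \<inter> B_mu r Xs \<mu> \<longrightarrow>
             (let X = U * transpose_mat V in
               (1 - \<epsilon>) * frobenius_norm (X - Xs)
                 \<le> 1 / sqrt p * L2_set (P_obs \<Omega> (X - Xs)) \<Omega> \<and>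
               1 / sqrt p * L2_set (P_obs \<Omega> (X - Xs)) \<Omega>
                 \<le> (1 + \<epsilon>) * frobenius_norm (X - Xs))}
          \<ge> 1 - 3 / real n ^ 3)"
  unfolding Let_def
\<comment> \<open>The witness 4 is the quarter of \<open>sr\<close> allowed to the imbalance in
  \<open>near_factorization\<close>, and 144 the radius of
  \<open>near_factorization_isometry\<close>. Only \<open>C\<close> depends on
  \<open>\<beta>\<close>, through \<open>min n1 n2 \<ge> \<beta> n\<close> in the row
  bounds.\<close>
proof (rule exI[of _ "(102400 / \<beta>)\<^sup>2"], rule exI[of _ 4], rule exI[of _ 144], intro conjI allI impI)
  show "0 < (102400 / \<beta>)\<^sup>2" using assms by simp
qed (simp, simp, rule uniform_sample_isometry[OF assms], (assumption | rule mem_Collect_eq)+)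

end
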